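(* Consider the sequence of linear models $\mathbf y=\mathbf X\boldsymbol\beta+\boldsymbol\epsilon$ described in the context. Fix $L\ge2$ and $0<\lambda_1<\dots<\lambda_L$, and for each $n$ and $i=1,\dots,L$ set, with $\gamma_n=p/n$ and $\hat{\boldsymbol\beta}_{\lambda}=(\mathbf X^\top\mathbf X+\lambda\mathbf I)^{-1}\mathbf X^\top\mathbf y$, $$a_i=\frac{\lambda_i^2}{\gamma_n}\left(v_{\mathbf D}(-\lambda_i)-\lambda_iv'_{\mathbf D}(-\lambda_i)\right),\qquad b_i=\lambda_i^2v'_{\mathbf D}(-\lambda_i),\qquad t_i=\frac1n\|\mathbf y-\mathbf X\hat{\boldsymbol\beta}_{\lambda_i}\|_2^2 .$$ Define the estimators $$\hat\sigma^2=\frac{\sum_{i=1}^L\left(\frac{t_i}{a_i}-\frac{t_1}{a_1}\right)\left(\frac{b_i}{a_i}-\frac{b_1}{a_1}\right)}{\sum_{i=1}^L\left(\frac{b_i}{a_i}-\frac{b_1}{a_1}\right)^2},\qquad \hat r^2=\frac{\sum_{i=1}^L\left(\frac{t_i}{b_i}-\frac{t_1}{b_1}\right)\left(\frac{a_i}{b_i}-\frac{a_1}{b_1}\right)}{\sum_{i=1}^L\left(\frac{a_i}{b_i}-\frac{a_1}{b_1}\right)^2}.$$ Assume the following non-degeneracy condition on $\mathbf D$: (1) with $A_n=\bigcup_{i=1}^L\{a_i=0\}$ and $B_n=\bigcup_{i=1}^L\{b_i=0\}$, one has $\mathbf 1(A_n\cup B_n)\xrightarrow{a.s.}0$; (2)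 there exist $i_*\in\{2,\dots,L\}$ and a constant $c>0$ such that almost surely $\liminf_{n\to\infty}|a_{i_*}b_1-a_1b_{i_*}|>c$. Then $\hat r^2$ and $\hat\sigma^2$ are strongly consistent for $r^2$ and $\sigma^2$ respectively, i.e. $\hat r^2\xrightarrow{a.s.}r^2$ and $\hat\sigma^2\xrightarrow{a.s.}\sigma^2$ as $n\to\infty$.
   Context: Right-rotationally invariant design: a random matrix $\mathbf X\in\mathbb R^{n\times p}$ with $\mathbf X\mathbf O_0\stackrel d=\mathbf X$ for every $p\times p$ orthogonal matrix $\mathbf O_0$; equivalently, it has a singular value decomposition $\mathbf X=\mathbf Q^\top\mathbf D\mathbf O$ ($\mathbf Q$ an $n\times n$ orthogonal matrix, $\mathbf D\in\mathbb R^{n\times p}$ diagonal with the singular values on the diagonal, $\mathbf O$ a $p\times p$ orthogonal matrix) with $\mathbf O$ Haar distributed on the orthogonal group and independent of $(\mathbf Q,\mathbf D)$. Setting (all objects are indexed by $n$; the index is suppressed): - $\mathbf X=\mathbf Q^\top\mathbf D\mathbf O\in\mathbb R^{n\times p}$ is right-rotationally invariant, $p=p(n)$, $n\to\infty$, $p(n)/n\to\gamma\in(0,\infty)$. - There is a constant $C$ such that almost surely the limsup as $n\to\infty$ of the largest diagonal entry (largest singular value) of $\mathbf D$ is $<C$. - $\mathbf y=\mathbf X\boldsymbol\beta+\boldsymbol\epsilon$, with $\boldsymbol\beta\in\mathbb R^p$, $\|\boldsymbol\beta\|=r\sqrt n$ for a constant $r\ge 0$, and $\boldsymbol\beta$ either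 fixed or random and independent of $(\mathbf X,\boldsymbol\epsilon)$. - $\boldsymbol\epsilon\in\mathbb R^n$ is independent of $\mathbf X$ and has independent entries with $\mathbb E[\epsilon_i]=0$, $\mathbb E[\epsilon_i^2]=\sigma^2$, and $\mathbb E[|\epsilon_i|^{4+\eta}]<\infty$ for some $\eta>0$. Notation: with $D_{ii}:=0$ for $i>\min(n,p)$, $v_{\mathbf D}(z)=\frac1n\sum_{i=1}^n\frac{1}{D_{ii}^2-z}$, and $v'_{\mathbf D}$ is its derivative in $z$, so $v'_{\mathbf D}(-\lambda)=\frac1n\sum_{i=1}^n\frac1{(D_{ii}^2+\lambda)^2}$.
   Formalization: The moment condition E|ε_i|^{4+η}<∞ is taken uniformly: one η>0 and one bound K for all n and i. Without uniformity the claim fails, e.g. ε_i=±nσ with probability 1/(2n²) each and 0 otherwise. *)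

theory Defs
  imports "HOL-Probability.Probability" "Jordan_Normal_Form.Gauss_Jordan_Elimination"
begin

(* HOL-Analysis and Jordan_Normal_Form both use these infixes; keep the latter's. *)
no_notation vec_nth (infixl "$" 90)
no_notation inner (infix "\<bullet>" 70)

text \<open>
  The Borel sigma-algebras on \<open>n\<close>-vectors and on \<open>n\<close> by \<open>p\<close> matrices, obtained by
  identifying a vector or matrix with the family of its entries.
\<close>

definition vec_borel :: "nat \<Rightarrow> real Matrix.vec measure" where
  "vec_borel n = vimage_algebra (carrier_vec n)
     (\<lambda>v. \<lambda>i\<in>{..<n}. v $ i) (\<Pi>\<^sub>M i\<in>{..<n}. borel)"

definition mat_borel :: "nat \<Rightarrow> nat \<Rightarrow> real mat measure" where
  "mat_borel n p = vimage_algebra (carrier_mat n p)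
     (\<lambda>A. \<lambda>ij\<in>{..<n} \<times> {..<p}. A $$ ij) (\<Pi>\<^sub>M ij\<in>{..<n} \<times> {..<p}. borel)"

lemma space_vec_borel: "space (vec_borel n) = carrier_vec n"
  by (simp add: vec_borel_def)

lemma space_mat_borel: "space (mat_borel n p) = carrier_mat n p"
  by (simp add: mat_borel_def)

text \<open>
  The library's \<open>indep_var\<close> forces both variables to have the same value type, which fails
  for a vector and a matrix.
\<close>

definition indep_rv ::
    "'w measure \<Rightarrow> 'b measure \<Rightarrow> ('w \<Rightarrow> 'b) \<Rightarrow> 'c measure \<Rightarrow> ('w \<Rightarrow> 'c) \<Rightarrow> bool" where
  "indep_rv M S X T Y \<longleftrightarrow>
     X \<in> M \<rightarrow>\<^sub>M S \<and> Y \<in> M \<rightarrow>\<^sub>M T \<and>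
     prob_space.indep_set M {X -` A \<inter> space M | A. A \<in> sets S} {Y -` B \<inter> space M | B. B \<in> sets T}"

definition l2_norm_vec :: "real Matrix.vec \<Rightarrow> real" where
  "l2_norm_vec v = sqrt (v \<bullet> v)"

text \<open>
  The library predicate \<^const>\<open>orthogonal_mat\<close> only asks for pairwise orthogonal nonzero
  columns, so orthonormality is required here explicitly.
\<close>

definition orthogonal_group :: "nat \<Rightarrow> real mat set" where
  "orthogonal_group m = {U \<in> carrier_mat m m. transpose_mat U * U = 1\<^sub>m m}"

definition right_rotationally_invariant ::
    "'w measure \<Rightarrow> nat \<Rightarrow> nat \<Rightarrow> ('w \<Rightarrow> real mat) \<Rightarrow> bool" where
  "right_rotationally_invariant M n p X \<longleftrightarrow>
     X \<in> M \<rightarrow>\<^sub>M mat_borel n p \<and>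
     (\<forall>U\<in>orthogonal_group p.
        distr M (mat_borel n p) (\<lambda>\<omega>. X \<omega> * U) = distr M (mat_borel n p) X)"

definition is_svd :: "nat \<Rightarrow> nat \<Rightarrow> real mat \<Rightarrow> real mat \<Rightarrow> real mat \<Rightarrow> real mat \<Rightarrow> bool" where
  "is_svd n p X Q D V \<longleftrightarrow>
     Q \<in> orthogonal_group n \<and> V \<in> orthogonal_group p \<and>
     D \<in> carrier_mat n p \<and> diagonal_mat D \<and> (\<forall>i<min n p. 0 \<le> D $$ (i, i)) \<and>
     X = transpose_mat Q * D * V"

text \<open>The matrix inverted here is positive definite for positive \<open>l\<close>, so
  \<^const>\<open>mat_inverse\<close> is then not \<^const>\<open>None\<close>.\<close>

definition ridge :: "real mat \<Rightarrow> real Matrix.vec \<Rightarrow> real \<Rightarrow> real Matrix.vec" where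
  "ridge X y l =
     the (mat_inverse (transpose_mat X * X + l \<cdot>\<^sub>m 1\<^sub>m (dim_col X))) *\<^sub>v (transpose_mat X *\<^sub>v y)"

definition train_err :: "real mat \<Rightarrow> real Matrix.vec \<Rightarrow> real \<Rightarrow> real" where
  "train_err X y l = (l2_norm_vec (y - X *\<^sub>v ridge X y l))\<^sup>2 / real (dim_row X)"

text \<open>Entries beyond the shorter side count as zero singular values.\<close>

definition diag_entry :: "real mat \<Rightarrow> nat \<Rightarrow> real" where
  "diag_entry D i = (if i < min (dim_row D) (dim_col D) then D $$ (i, i) else 0)"

definition v_fun :: "real mat \<Rightarrow> real \<Rightarrow> real" where
  "v_fun D z = (\<Sum>i<dim_row D. 1 / ((diag_entry D i)\<^sup>2 - z)) / real (dim_row D)"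

definition coef_a :: "real mat \<Rightarrow> real \<Rightarrow> real" where
  "coef_a D l = l\<^sup>2 / (real (dim_col D) / real (dim_row D)) *
     (v_fun D (- l) - l * deriv (v_fun D) (- l))"

definition coef_b :: "real mat \<Rightarrow> real \<Rightarrow> real" where
  "coef_b D l = l\<^sup>2 * deriv (v_fun D) (- l)"

definition sigma2_hat :: "nat \<Rightarrow> (nat \<Rightarrow> real) \<Rightarrow> (nat \<Rightarrow> real) \<Rightarrow> (nat \<Rightarrow> real) \<Rightarrow> real" where
  "sigma2_hat L a b t =
     (\<Sum>i=1..L. (t i / a i - t 1 / a 1) * (b i / a i - b 1 / a 1)) /
     (\<Sum>i=1..L. (b i / a i - b 1 / a 1)\<^sup>2)"

definition r2_hat :: "nat \<Rightarrow> (nat \<Rightarrow> real) \<Rightarrow> (nat \<Rightarrow> real) \<Rightarrow> (nat \<Rightarrow> real) \<Rightarrow> real" where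
  "r2_hat L a b t =
     (\<Sum>i=1..L. (t i / b i - t 1 / b 1) * (a i / b i - a 1 / b 1)) /
     (\<Sum>i=1..L. (a i / b i - a 1 / b 1)\<^sup>2)"

end

theory Submission
  imports Defs "Jordan_Normal_Form.Determinant"
begin

text \<open>
  Let \<open>R\<close> be \<open>l\<close> times the inverse of \<open>X X\<^sup>T + l I\<close>. The residual of ridge regression with penalty \<open>l\<close> is \<open>R y\<close>, so
  with \<open>y = X \<beta> + \<epsilon>\<close> the training error is
  \<open>(|R X \<beta>|\<^sup>2 + 2 (R X \<beta>) \<bullet> (R \<epsilon>) + |R \<epsilon>|\<^sup>2) / n\<close>. The signal term concentrates at
  \<open>r\<^sup>2 n / p\<close> times the squared Frobenius norm of \<open>R X\<close>, the noise term at \<open>\<sigma>\<^sup>2\<close> times that of \<open>R\<close>,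
  and the cross term is negligible. In a singular basis these squared Frobenius norms are \<open>p a\<close>
  and \<open>n b\<close> (\<open>svd_coefficients\<close>). Hence \<open>t\<^sub>i - (r\<^sup>2 a\<^sub>i + \<sigma>\<^sup>2 b\<^sub>i)\<close> tends to \<open>0\<close> almost surely
  for each penalty. Both estimators are least squares slopes that solve the system
  \<open>t\<^sub>i = r\<^sup>2 a\<^sub>i + \<sigma>\<^sup>2 b\<^sub>i\<close> exactly; they stay continuous in the limit because bounded singular
  values and a determinant bounded away from zero keep all \<open>a\<^sub>i\<close>, \<open>b\<^sub>i\<close> and the denominators
  away from zero (\<open>coef_lower_bounds\<close>, \<open>r2_hat_tendsto\<close>).

  Nothing relates the models for different \<open>n\<close>, so each almost sure limit comes from moments
  that are summable in \<open>n\<close> (\<open>AE_tendsto_of_moment\<close>). Three estimates supply them, all for a fixed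
  design and then integrated over the independent design.

  Adding one independent centred summand changes the square root of a fourth moment at most
  additively (\<open>fourth_moment_step\<close>). Therefore a linear form with coefficients \<open>c\<close> has fourth moment
  \<open>O(|c|\<^sup>4)\<close>, and the off-diagonal part of a quadratic form has fourth moment of the order of the
  fourth power of its Frobenius norm, given only fourth moments of the variables. As \<open>R\<close> is a
  contraction and \<open>R X\<close> has norm at most \<open>sqrt l / 2\<close>, both are \<open>O(n\<^sup>2)\<close> here and, divided by
  \<open>n\<^sup>4\<close>, summable.

  The diagonal part of the noise term is a sum of independent centred variables for which only
  moments of some order \<open>q\<close> slightly above two are available. Its moment of order \<open>q\<close> is
  \<open>O(n powr (q / 2))\<close> (\<open>smoothed_power_moment\<close>), which is summable after division by \<open>n powr q\<close>.

  For the signal, invariance of the law of \<open>X\<close> makes the law of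
  \<open>|R X b|\<^sup>2 / |b|\<^sup>2\<close> independent of the direction of \<open>b\<close>. The direction may thus be replaced by that of
  any sign vector, and even be averaged over all sign vectors. The average is a quadratic form
  in independent signs, whose diagonal part is exactly the squared Frobenius norm of \<open>R X\<close>, and
  the fourth moment bound for off-diagonal forms applies again (\<open>signal_fourth_moment\<close>).
\<close>

section \<open>Almost sure convergence from summable moments\<close>

text \<open>The series of the functions has finite integral, so it converges almost everywhere and
  its terms tend to zero.\<close>

lemma AE_tendsto_zero_of_summable_nn_integral:
  fixes f :: "nat \<Rightarrow> 'a \<Rightarrow> real"
  assumes meas: "\<And>n. n \<ge> N \<Longrightarrow> f n \<in> borel_measurable M"
    and nonneg: "\<And>n x. f n x \<ge> 0"
    and bound: "\<And>n. n \<ge> N \<Longrightarrow> (\<integral>\<^sup>+x. ennreal (f n x) \<partial>M) \<le> ennreal (g n)"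
    and g: "summable g" "\<And>n. g n \<ge> 0"
  shows "AE x in M. (\<lambda>n. f n x) \<longlonglongrightarrow> 0"
proof -
  define f' where "f' n x = f (n + N) x" for n x
  have m[measurable]: "f' n \<in> borel_measurable M" for n
    unfolding f'_def using meas by simp
  have s: "summable (\<lambda>n. g (n + N))" using g(1) by (rule summable_ignore_initial_segment)
  have "(\<integral>\<^sup>+x. (\<Sum>n. ennreal (f' n x)) \<partial>M) = (\<Sum>n. \<integral>\<^sup>+x. ennreal (f' n x) \<partial>M)"
    by (rule nn_integral_suminf) simp
  also have "\<dots> \<le> (\<Sum>n. ennreal (g (n + N)))"
    unfolding f'_def by (intro suminf_le bound) auto
  also have "\<dots> = ennreal (\<Sum>n. g (n + N))"
    using s g(2) by (intro suminf_ennreal2) auto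
  finally have "(\<integral>\<^sup>+x. (\<Sum>n. ennreal (f' n x)) \<partial>M) \<noteq> \<infinity>"
    by (auto simp: top_unique)
  then have "AE x in M. (\<Sum>n. ennreal (f' n x)) \<noteq> \<infinity>"
    by (intro nn_integral_PInf_AE) simp_all
  then show ?thesis
  proof eventually_elim
    case (elim x)
    have "summable (\<lambda>n. f' n x)"
      using elim nonneg by (intro summable_suminf_not_top) (auto simp: f'_def)
    then have "(\<lambda>n. f' n x) \<longlonglongrightarrow> 0" by (rule summable_LIMSEQ_zero)
    then show ?case unfolding f'_def by (rule LIMSEQ_offset)
  qed
qed

lemma integrable_between:
  fixes f g :: "'a \<Rightarrow> real"
  assumes "integrable M g" "f \<in> borel_measurable M" "\<And>x. 0 \<le> f x" "\<And>x. f x \<le> g x"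
  shows "integrable M f"
proof (rule Bochner_Integration.integrable_bound[OF assms(1,2)], rule AE_I2)
  fix x show "norm (f x) \<le> norm (g x)" using assms(3,4)[of x] by simp
qed

text \<open>The moment of order \<open>q\<close> of \<open>Z n / n\<close> is \<open>O(n powr (- q / 2))\<close>, which is summable because \<open>q > 2\<close>.\<close>

lemma AE_tendsto_of_moment:
  fixes Z :: "nat \<Rightarrow> 'a \<Rightarrow> real"
  assumes meas: "\<And>n. n \<ge> N \<Longrightarrow> Z n \<in> borel_measurable M"
    and q: "2 < q" and B: "0 \<le> B" and N: "0 < N"
    and bound: "\<And>n. n \<ge> N \<Longrightarrow> (\<integral>\<^sup>+\<omega>. ennreal (\<bar>Z n \<omega>\<bar> powr q) \<partial>M) \<le> ennreal (B * real n powr (q / 2))"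
  shows "AE \<omega> in M. (\<lambda>n. Z n \<omega> / real n) \<longlonglongrightarrow> 0"
proof -
  have "AE \<omega> in M. (\<lambda>n. (\<bar>Z n \<omega>\<bar> / real n) powr q) \<longlonglongrightarrow> 0"
  proof (rule AE_tendsto_zero_of_summable_nn_integral)
    fix n assume n: "n \<ge> N"
    note [measurable] = meas[OF n]
    show "(\<lambda>\<omega>. (\<bar>Z n \<omega>\<bar> / real n) powr q) \<in> borel_measurable M" by measurable
    have n0: "0 < real n" using n N by simp
    have "(\<integral>\<^sup>+\<omega>. ennreal ((\<bar>Z n \<omega>\<bar> / real n) powr q) \<partial>M)
        = (\<integral>\<^sup>+\<omega>. ennreal (real n powr (- q)) * ennreal (\<bar>Z n \<omega>\<bar> powr q) \<partial>M)"
      using n0 by (intro nn_integral_cong)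
        (simp add: powr_divide powr_minus_divide flip: ennreal_mult)
    also have "\<dots> = ennreal (real n powr (- q)) * (\<integral>\<^sup>+\<omega>. ennreal (\<bar>Z n \<omega>\<bar> powr q) \<partial>M)"
      by (rule nn_integral_cmult) measurable
    also have "\<dots> \<le> ennreal (real n powr (- q)) * ennreal (B * real n powr (q / 2))"
      by (intro mult_left_mono bound n) simp
    also have "\<dots> = ennreal (B * real n powr (- (q / 2)))"
    proof -
      have "real n powr (- q) * real n powr (q / 2) = real n powr (- (q / 2))"
        by (simp flip: powr_add)
      then show ?thesis using B by (simp add: mult.left_commute flip: ennreal_mult)
    qed
    finally show "(\<integral>\<^sup>+\<omega>. ennreal ((\<bar>Z n \<omega>\<bar> / real n) powr q) \<partial>M) \<le> ennreal (B * real n powr (- (q / 2)))" .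
  next
    show "summable (\<lambda>n. B * real n powr (- (q / 2)))"
      using q by (intro summable_mult) (simp add: summable_real_powr_iff)
  qed (use B in auto)
  then show ?thesis
  proof eventually_elim
    case (elim \<omega>)
    have "(\<lambda>n. ((\<bar>Z n \<omega>\<bar> / real n) powr q) powr (1 / q)) \<longlonglongrightarrow> 0 powr (1 / q)"
      using elim q by (intro tendsto_powr' tendsto_const) auto
    then have "(\<lambda>n. \<bar>Z n \<omega> / real n\<bar>) \<longlonglongrightarrow> 0" using q by (simp add: powr_powr)
    then show ?case by (rule tendsto_rabs_zero_cancel)
  qed
qed

lemma AE_tendsto_of_fourth_moment:
  fixes Z :: "nat \<Rightarrow> 'a \<Rightarrow> real"
  assumes meas: "\<And>n. n \<ge> N \<Longrightarrow> Z n \<in> borel_measurable M" and B: "0 \<le> B" and N: "0 < N"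
    and bound: "\<And>n. n \<ge> N \<Longrightarrow> (\<integral>\<^sup>+\<omega>. ennreal (Z n \<omega> ^ 4) \<partial>M) \<le> ennreal (B * (real n)\<^sup>2)"
  shows "AE \<omega> in M. (\<lambda>n. Z n \<omega> / real n) \<longlonglongrightarrow> 0"
proof (rule AE_tendsto_of_moment[OF meas _ B N])
  have "\<bar>x\<bar> powr 4 = x ^ 4" for x :: real by (cases "x = 0") (simp_all add: power_even_abs)
  then show "(\<integral>\<^sup>+\<omega>. ennreal (\<bar>Z n \<omega>\<bar> powr 4) \<partial>M) \<le> ennreal (B * real n powr (4 / 2))" if "n \<ge> N" for n
    using bound[OF that] that N by simp
qed simp_all

section \<open>Fourth moments of linear and quadratic forms in independent variables\<close>

text \<open>The Cauchy-Schwarz inequality for the squares: \<open>t \<mapsto> E (t A\<^sup>2 - B\<^sup>2)\<^sup>2\<close> is a nonnegative quadratic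
  polynomial, so its discriminant is not positive.\<close>

lemma (in prob_space) expectation_mult_squares_le:
  fixes A B :: "'a \<Rightarrow> real"
  assumes [measurable]: "A \<in> borel_measurable M" "B \<in> borel_measurable M"
    and iA: "integrable M (\<lambda>\<omega>. A \<omega> ^ 4)" and iB: "integrable M (\<lambda>\<omega>. B \<omega> ^ 4)"
  shows "integrable M (\<lambda>\<omega>. A \<omega> ^ 2 * B \<omega> ^ 2)"
    "expectation (\<lambda>\<omega>. A \<omega> ^ 2 * B \<omega> ^ 2)
       \<le> sqrt (expectation (\<lambda>\<omega>. A \<omega> ^ 4)) * sqrt (expectation (\<lambda>\<omega>. B \<omega> ^ 4))"
proof -
  define x where "x = expectation (\<lambda>\<omega>. A \<omega> ^ 4)"
  define y where "y = expectation (\<lambda>\<omega>. B \<omega> ^ 4)"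
  define z where "z = expectation (\<lambda>\<omega>. A \<omega> ^ 2 * B \<omega> ^ 2)"
  have amgm: "2 * (u ^ 2 * v ^ 2) \<le> u ^ 4 + v ^ 4" for u v :: real
    using sum_squares_bound[of "u\<^sup>2" "v\<^sup>2"] by simp
  show i: "integrable M (\<lambda>\<omega>. A \<omega> ^ 2 * B \<omega> ^ 2)"
  proof (rule integrable_between[OF Bochner_Integration.integrable_add[OF iA iB]])
    fix \<omega>
    show "0 \<le> (A \<omega>)\<^sup>2 * (B \<omega>)\<^sup>2" by simp
    then show "(A \<omega>)\<^sup>2 * (B \<omega>)\<^sup>2 \<le> A \<omega> ^ 4 + B \<omega> ^ 4" using amgm[of "A \<omega>" "B \<omega>"] by linarith
  qed simp
  have x0: "0 \<le> x" and y0: "0 \<le> y" unfolding x_def y_def by simp_all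
  have key: "2 * z * t \<le> x * t\<^sup>2 + y" for t
  proof -
    have "expectation (\<lambda>\<omega>. 2 * t * (A \<omega> ^ 2 * B \<omega> ^ 2)) \<le> expectation (\<lambda>\<omega>. t\<^sup>2 * A \<omega> ^ 4 + B \<omega> ^ 4)"
    proof (rule integral_mono)
      fix \<omega>
      show "2 * t * (A \<omega> ^ 2 * B \<omega> ^ 2) \<le> t\<^sup>2 * A \<omega> ^ 4 + B \<omega> ^ 4"
        using sum_squares_bound[of "t * (A \<omega>)\<^sup>2" "(B \<omega>)\<^sup>2"] by (simp add: power_mult_distrib algebra_simps)
    qed (use i iA iB in auto)
    then show ?thesis using i iA iB by (simp add: x_def y_def z_def algebra_simps)
  qed
  have "z\<^sup>2 \<le> x * y"
  proof (cases "x = 0")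
    case True
    have "z \<le> 0"
    proof (rule ccontr)
      assume "\<not> z \<le> 0"
      with key[of "(y + 1) / (2 * z)"] True show False by simp
    qed
    moreover have "0 \<le> z" unfolding z_def by simp
    ultimately show ?thesis using True by simp
  next
    case False
    then have x: "x > 0" using x0 by simp
    have "2 * z * (z / x) \<le> x * (z / x)\<^sup>2 + y" by (rule key)
    then have "z\<^sup>2 / x \<le> y" using x by (simp add: power2_eq_square field_simps)
    then show ?thesis using x by (simp add: field_simps)
  qed
  then show "z \<le> sqrt x * sqrt y"
    by (metis real_le_rsqrt real_sqrt_mult)
qed

text \<open>Expand \<open>(A + B \<xi>)\<^sup>4\<close>. The term with \<open>\<xi>\<close> to the first power has mean zero, and the term
  \<open>4 A B\<^sup>3 \<xi>\<^sup>3\<close> is absorbed into its neighbours, which leaves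
  \<open>E A\<^sup>4 + 8 E A\<^sup>2 B\<^sup>2 E \<xi>\<^sup>2 + 3 E B\<^sup>4 E \<xi>\<^sup>4\<close>; by Cauchy-Schwarz this is at most the square of the
  claimed bound. Independence of
  the pair \<open>(A, B)\<close> from \<open>\<xi>\<close> is stated through real functions of the pair, as only
  such products are integrated.\<close>

lemma (in prob_space) fourth_moment_step:
  fixes A B \<xi> :: "'a \<Rightarrow> real"
  assumes [measurable]: "A \<in> borel_measurable M" "B \<in> borel_measurable M"
    and ind: "\<forall>f\<in>borel \<Otimes>\<^sub>M borel \<rightarrow>\<^sub>M borel. indep_var borel (\<lambda>\<omega>. f (A \<omega>, B \<omega>) :: real) borel \<xi>"
    and iA: "integrable M (\<lambda>\<omega>. A \<omega> ^ 4)" and iB: "integrable M (\<lambda>\<omega>. B \<omega> ^ 4)"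
    and i\<xi>: "integrable M (\<lambda>\<omega>. \<xi> \<omega> ^ 4)"
    and mean: "expectation \<xi> = 0" and K: "expectation (\<lambda>\<omega>. \<xi> \<omega> ^ 4) \<le> K"
  shows "integrable M (\<lambda>\<omega>. (A \<omega> + B \<omega> * \<xi> \<omega>) ^ 4)"
    "sqrt (expectation (\<lambda>\<omega>. (A \<omega> + B \<omega> * \<xi> \<omega>) ^ 4))
       \<le> sqrt (expectation (\<lambda>\<omega>. A \<omega> ^ 4)) + 4 * sqrt K * sqrt (expectation (\<lambda>\<omega>. B \<omega> ^ 4))"
proof -
  have [measurable]: "\<xi> \<in> borel_measurable M" by (rule indep_var_rv2[OF bspec[OF ind, of "\<lambda>_. 0"]]) simp
  have K0: "0 \<le> K" using order_trans[OF _ K] by simp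
  have ind': "indep_var borel (\<lambda>\<omega>. f (A \<omega>) (B \<omega>)) borel (\<lambda>\<omega>. g (\<xi> \<omega>))"
    if "(\<lambda>(u, v). f u v) \<in> borel \<Otimes>\<^sub>M borel \<rightarrow>\<^sub>M borel" "g \<in> borel \<rightarrow>\<^sub>M borel" for f :: "real \<Rightarrow> real \<Rightarrow> real" and g :: "real \<Rightarrow> real"
    using indep_var_compose[OF bspec[OF ind, of "\<lambda>(u, v). f u v"] measurable_ident that(2)] that(1) by (simp add: comp_def)
  have pw1: "\<bar>u ^ 3 * v\<bar> \<le> u ^ 4 + v ^ 4" for u v :: real
  proof -
    have *: "\<bar>u ^ 3 * v\<bar> = \<bar>u\<bar> ^ 3 * \<bar>v\<bar>" by (simp add: abs_mult power_abs)
    let ?m = "max \<bar>u\<bar> \<bar>v\<bar>"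
    have "\<bar>u\<bar> ^ 3 * \<bar>v\<bar> \<le> ?m ^ 3 * ?m" by (intro mult_mono power_mono) auto
    also have "\<dots> = ?m ^ 4" by (simp only: power3_eq_cube power4_eq_xxxx)
    also have "\<dots> \<le> u ^ 4 + v ^ 4" by (auto simp: max_def power_even_abs)
    finally show ?thesis using * by simp
  qed
  have i3: "integrable M (\<lambda>\<omega>. A \<omega> ^ 3 * B \<omega>)"
    by (rule Bochner_Integration.integrable_bound[OF Bochner_Integration.integrable_add[OF iA iB]])
      (use pw1 in auto)
  note i22 = expectation_mult_squares_le[OF _ _ iA iB]
  have i\<xi>2: "integrable M (\<lambda>\<omega>. \<xi> \<omega> ^ 2)"
    "expectation (\<lambda>\<omega>. \<xi> \<omega> ^ 2) \<le> sqrt K"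
  proof -
    have one: "integrable M (\<lambda>\<omega>. 1 ^ 4 :: real)" by simp
    note * = expectation_mult_squares_le[of "\<lambda>_. 1" \<xi>, OF _ _ one i\<xi>]
    show "integrable M (\<lambda>\<omega>. \<xi> \<omega> ^ 2)" using *(1) by simp
    show "expectation (\<lambda>\<omega>. \<xi> \<omega> ^ 2) \<le> sqrt K"
      using *(2) K by (simp add: prob_space) (meson order_trans real_sqrt_le_iff)
  qed
  have i\<xi>1: "integrable M \<xi>" by (rule square_integrable_imp_integrable[OF _ i\<xi>2(1)]) simp
  have d3: "indep_var borel (\<lambda>\<omega>. A \<omega> ^ 3 * B \<omega>) borel \<xi>"
    by (rule ind'[of "\<lambda>u v. u ^ 3 * v" "\<lambda>x. x"]) measurable
  have d2: "indep_var borel (\<lambda>\<omega>. A \<omega> ^ 2 * B \<omega> ^ 2) borel (\<lambda>\<omega>. \<xi> \<omega> ^ 2)"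
    by (rule ind'[of "\<lambda>u v. u ^ 2 * v ^ 2" "\<lambda>x. x ^ 2"]) measurable
  have d4: "indep_var borel (\<lambda>\<omega>. B \<omega> ^ 4) borel (\<lambda>\<omega>. \<xi> \<omega> ^ 4)"
    by (rule ind'[of "\<lambda>u v. v ^ 4" "\<lambda>x. x ^ 4"]) measurable
  have j3: "integrable M (\<lambda>\<omega>. A \<omega> ^ 3 * B \<omega> * \<xi> \<omega>)" "expectation (\<lambda>\<omega>. A \<omega> ^ 3 * B \<omega> * \<xi> \<omega>) = 0"
    using indep_var_integrable[OF d3 i3 i\<xi>1] indep_var_lebesgue_integral[OF d3 i3 i\<xi>1] mean by simp_all
  have i22': "integrable M (\<lambda>\<omega>. A \<omega> ^ 2 * B \<omega> ^ 2)" by (rule i22(1)) measurable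
  have j2: "integrable M (\<lambda>\<omega>. A \<omega> ^ 2 * B \<omega> ^ 2 * \<xi> \<omega> ^ 2)"
      "expectation (\<lambda>\<omega>. A \<omega> ^ 2 * B \<omega> ^ 2 * \<xi> \<omega> ^ 2)
        = expectation (\<lambda>\<omega>. A \<omega> ^ 2 * B \<omega> ^ 2) * expectation (\<lambda>\<omega>. \<xi> \<omega> ^ 2)"
    by (rule indep_var_integrable[OF d2 i22' i\<xi>2(1)], rule indep_var_lebesgue_integral[OF d2 i22' i\<xi>2(1)])
  have j4: "integrable M (\<lambda>\<omega>. B \<omega> ^ 4 * \<xi> \<omega> ^ 4)"
      "expectation (\<lambda>\<omega>. B \<omega> ^ 4 * \<xi> \<omega> ^ 4) = expectation (\<lambda>\<omega>. B \<omega> ^ 4) * expectation (\<lambda>\<omega>. \<xi> \<omega> ^ 4)"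
    by (rule indep_var_integrable[OF d4 iB i\<xi>], rule indep_var_lebesgue_integral[OF d4 iB i\<xi>])
  let ?rhs = "\<lambda>\<omega>. A \<omega> ^ 4 + 4 * (A \<omega> ^ 3 * B \<omega> * \<xi> \<omega>) + 8 * (A \<omega> ^ 2 * B \<omega> ^ 2 * \<xi> \<omega> ^ 2)
      + 3 * (B \<omega> ^ 4 * \<xi> \<omega> ^ 4)"
  have pw: "(A \<omega> + B \<omega> * \<xi> \<omega>) ^ 4 \<le> ?rhs \<omega>" for \<omega>
  proof -
    define a where "a = A \<omega>"
    define d where "d = B \<omega> * \<xi> \<omega>"
    \<comment> \<open>twice a perfect square is the gap between the two sides\<close>
    have "0 \<le> 2 * d\<^sup>2 * (a - d)\<^sup>2" by simp
    also have "\<dots> = a^4 + 4 * (a^3 * d) + 8 * (a\<^sup>2 * d\<^sup>2) + 3 * d^4 - (a + d) ^ 4"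
      by (simp add: power2_eq_square power4_eq_xxxx power3_eq_cube algebra_simps)
    finally show ?thesis unfolding a_def d_def by (simp add: power_mult_distrib mult.assoc)
  qed
  have irhs: "integrable M ?rhs" using iA j3(1) j2(1) j4(1) by auto
  show int: "integrable M (\<lambda>\<omega>. (A \<omega> + B \<omega> * \<xi> \<omega>) ^ 4)"
    by (rule integrable_between[OF irhs _ _ pw]) simp_all
  define x where "x = expectation (\<lambda>\<omega>. A \<omega> ^ 4)"
  define y where "y = expectation (\<lambda>\<omega>. B \<omega> ^ 4)"
  have x0: "0 \<le> x" and y0: "0 \<le> y" unfolding x_def y_def by simp_all
  have "expectation (\<lambda>\<omega>. (A \<omega> + B \<omega> * \<xi> \<omega>) ^ 4) \<le> expectation ?rhs"
    by (rule integral_mono[OF int irhs pw])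
  also have "\<dots> = x + 8 * (expectation (\<lambda>\<omega>. A \<omega> ^ 2 * B \<omega> ^ 2) * expectation (\<lambda>\<omega>. \<xi> \<omega> ^ 2))
      + 3 * (y * expectation (\<lambda>\<omega>. \<xi> \<omega> ^ 4))"
    using iA j3 j2 j4 by (simp add: x_def y_def)
  also have "\<dots> \<le> x + 8 * ((sqrt x * sqrt y) * sqrt K) + 3 * (y * K)"
    using i22(2) i\<xi>2(2) K K0 x0 y0 unfolding x_def y_def
    by (intro add_mono mult_left_mono mult_mono) auto
  also have "\<dots> \<le> (sqrt x + 4 * sqrt K * sqrt y)\<^sup>2"
  proof -
    have "0 \<le> y * K" using y0 K0 by simp
    then show ?thesis
      using x0 y0 K0 by (simp add: power2_sum power_mult_distrib algebra_simps)
  qed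
  finally show "sqrt (expectation (\<lambda>\<omega>. (A \<omega> + B \<omega> * \<xi> \<omega>) ^ 4)) \<le> sqrt x + 4 * sqrt K * sqrt y"
    using x0 y0 K0 by (intro real_le_lsqrt) auto
qed

lemma (in prob_space) indep_var_of_earlier:
  fixes \<xi> :: "nat \<Rightarrow> 'a \<Rightarrow> real"
  assumes "indep_vars (\<lambda>_. borel) \<xi> {..<n}" "m < n"
    and g: "g \<in> (\<Pi>\<^sub>M i\<in>{..<m}. borel) \<rightarrow>\<^sub>M borel"
  shows "indep_var borel (\<lambda>\<omega>. g (\<lambda>i\<in>{..<m}. \<xi> i \<omega>)) borel (\<xi> m)"
proof -
  have "indep_var (\<Pi>\<^sub>M i\<in>{..<m}. borel) (\<lambda>\<omega>. \<lambda>i\<in>{..<m}. \<xi> i \<omega>) (\<Pi>\<^sub>M i\<in>{m}. borel) (\<lambda>\<omega>. \<lambda>i\<in>{m}. \<xi> i \<omega>)"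
    using assms by (intro indep_var_restrict[OF assms(1)]) auto
  from indep_var_compose[OF this g, of "\<lambda>f. f m" borel]
  show ?thesis by (simp add: comp_def)
qed

text \<open>Each summand adds \<open>4 sqrt K (c i)\<^sup>2\<close> by the step lemma, with the constant \<open>c i\<close> in the role of \<open>B\<close>.\<close>

lemma (in prob_space) fourth_moment_linear:
  fixes \<xi> :: "nat \<Rightarrow> 'a \<Rightarrow> real"
  assumes ind: "indep_vars (\<lambda>_. borel) \<xi> {..<n}"
    and i4: "\<And>i. i < n \<Longrightarrow> integrable M (\<lambda>\<omega>. \<xi> i \<omega> ^ 4)"
    and mean: "\<And>i. i < n \<Longrightarrow> expectation (\<xi> i) = 0"
    and K: "\<And>i. i < n \<Longrightarrow> expectation (\<lambda>\<omega>. \<xi> i \<omega> ^ 4) \<le> K"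
    and m: "m \<le> n"
  shows "integrable M (\<lambda>\<omega>. (\<Sum>i<m. c i * \<xi> i \<omega>) ^ 4) \<and>
    sqrt (expectation (\<lambda>\<omega>. (\<Sum>i<m. c i * \<xi> i \<omega>) ^ 4)) \<le> 4 * sqrt K * (\<Sum>i<m. (c i)\<^sup>2)"
  using m
proof (induction m)
  case 0
  show ?case by simp
next
  case (Suc m)
  then have IH: "integrable M (\<lambda>\<omega>. (\<Sum>i<m. c i * \<xi> i \<omega>) ^ 4)"
    "sqrt (expectation (\<lambda>\<omega>. (\<Sum>i<m. c i * \<xi> i \<omega>) ^ 4)) \<le> 4 * sqrt K * (\<Sum>i<m. (c i)\<^sup>2)"
    and m: "m < n" by auto
  have [measurable]: "\<xi> i \<in> borel_measurable M" if "i < n" for i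
    using ind that unfolding indep_vars_def2 by auto
  have ind1: "\<forall>f\<in>borel \<Otimes>\<^sub>M borel \<rightarrow>\<^sub>M borel.
      indep_var borel (\<lambda>\<omega>. f (\<Sum>i<m. c i * \<xi> i \<omega>, c m) :: real) borel (\<xi> m)"
  proof
    fix f :: "real \<times> real \<Rightarrow> real" assume [measurable]: "f \<in> borel \<Otimes>\<^sub>M borel \<rightarrow>\<^sub>M borel"
    show "indep_var borel (\<lambda>\<omega>. f (\<Sum>i<m. c i * \<xi> i \<omega>, c m)) borel (\<xi> m)"
      using indep_var_of_earlier[OF ind m, of "\<lambda>g. f (\<Sum>i<m. c i * g i, c m)"] by simp
  qed
  have m1: "(\<lambda>\<omega>. \<Sum>i<m. c i * \<xi> i \<omega>) \<in> borel_measurable M" "(\<lambda>\<omega>. c m) \<in> borel_measurable M"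
    using m by (auto intro!: borel_measurable_sum)
  have "integrable M (\<lambda>\<omega>. c m ^ 4)" by simp
  note * = fourth_moment_step[OF m1 ind1 IH(1) this i4[OF m] mean[OF m] K[OF m]]
  have "sqrt (expectation (\<lambda>\<omega>. c m ^ 4)) = (c m)\<^sup>2"
    by (simp add: prob_space real_sqrt_unique)
  then show ?case using * IH(2) by (simp add: algebra_simps)
qed

text \<open>The form is revealed one variable at a time: variable \<open>i\<close> enters multiplied by a linear form in the
  earlier ones, whose fourth moment is already known. The diagonal is absent, so every
  increment is centred given the past.\<close>

lemma (in prob_space) fourth_moment_lower_chaos:
  fixes \<xi> :: "nat \<Rightarrow> 'a \<Rightarrow> real"
  assumes ind: "indep_vars (\<lambda>_. borel) \<xi> {..<n}"
    and i4: "\<And>i. i < n \<Longrightarrow> integrable M (\<lambda>\<omega>. \<xi> i \<omega> ^ 4)"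
    and mean: "\<And>i. i < n \<Longrightarrow> expectation (\<xi> i) = 0"
    and K: "\<And>i. i < n \<Longrightarrow> expectation (\<lambda>\<omega>. \<xi> i \<omega> ^ 4) \<le> K" and K0: "0 \<le> K"
    and m: "m \<le> n"
  shows "integrable M (\<lambda>\<omega>. (\<Sum>i<m. (\<Sum>j<i. h i j * \<xi> j \<omega>) * \<xi> i \<omega>) ^ 4) \<and>
    sqrt (expectation (\<lambda>\<omega>. (\<Sum>i<m. (\<Sum>j<i. h i j * \<xi> j \<omega>) * \<xi> i \<omega>) ^ 4))
      \<le> 16 * K * (\<Sum>i<m. \<Sum>j<i. (h i j)\<^sup>2)"
  using m
proof (induction m)
  case 0
  show ?case by simp
next
  case (Suc m)
  then have IH: "integrable M (\<lambda>\<omega>. (\<Sum>i<m. (\<Sum>j<i. h i j * \<xi> j \<omega>) * \<xi> i \<omega>) ^ 4)"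
    "sqrt (expectation (\<lambda>\<omega>. (\<Sum>i<m. (\<Sum>j<i. h i j * \<xi> j \<omega>) * \<xi> i \<omega>) ^ 4))
      \<le> 16 * K * (\<Sum>i<m. \<Sum>j<i. (h i j)\<^sup>2)"
    and m: "m < n" by auto
  have [measurable]: "\<xi> i \<in> borel_measurable M" if "i < n" for i
    using ind that unfolding indep_vars_def2 by auto
  have ind2: "\<forall>f\<in>borel \<Otimes>\<^sub>M borel \<rightarrow>\<^sub>M borel. indep_var borel
      (\<lambda>\<omega>. f (\<Sum>i<m. (\<Sum>j<i. h i j * \<xi> j \<omega>) * \<xi> i \<omega>, \<Sum>j<m. h m j * \<xi> j \<omega>) :: real) borel (\<xi> m)"
  proof
    fix f :: "real \<times> real \<Rightarrow> real" assume f: "f \<in> borel \<Otimes>\<^sub>M borel \<rightarrow>\<^sub>M borel"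
    have "indep_var borel
      (\<lambda>\<omega>. (\<lambda>g. f (\<Sum>i<m. (\<Sum>j<i. h i j * g j) * g i, \<Sum>j<m. h m j * g j)) (\<lambda>i\<in>{..<m}. \<xi> i \<omega>)) borel (\<xi> m)"
      by (intro indep_var_of_earlier[OF ind m] measurable_compose[OF _ f] measurable_Pair
        borel_measurable_sum borel_measurable_times
        measurable_component_singleton borel_measurable_const) auto
    also have "(\<lambda>\<omega>. (\<lambda>g. f (\<Sum>i<m. (\<Sum>j<i. h i j * g j) * g i, \<Sum>j<m. h m j * g j)) (\<lambda>i\<in>{..<m}. \<xi> i \<omega>))
       = (\<lambda>\<omega>. f (\<Sum>i<m. (\<Sum>j<i. h i j * \<xi> j \<omega>) * \<xi> i \<omega>, \<Sum>j<m. h m j * \<xi> j \<omega>))"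
      by (intro ext arg_cong[where f=f]) (auto intro!: sum.cong arg_cong2[where f="(*)"])
    finally show "indep_var borel
      (\<lambda>\<omega>. f (\<Sum>i<m. (\<Sum>j<i. h i j * \<xi> j \<omega>) * \<xi> i \<omega>, \<Sum>j<m. h m j * \<xi> j \<omega>)) borel (\<xi> m)" .
  qed
  have m1: "(\<lambda>\<omega>. \<Sum>i<m. (\<Sum>j<i. h i j * \<xi> j \<omega>) * \<xi> i \<omega>) \<in> borel_measurable M"
    "(\<lambda>\<omega>. \<Sum>j<m. h m j * \<xi> j \<omega>) \<in> borel_measurable M"
    using m by (auto intro!: borel_measurable_sum borel_measurable_times)
  have lin: "integrable M (\<lambda>\<omega>. (\<Sum>j<m. h m j * \<xi> j \<omega>) ^ 4)"
    "sqrt (expectation (\<lambda>\<omega>. (\<Sum>j<m. h m j * \<xi> j \<omega>) ^ 4)) \<le> 4 * sqrt K * (\<Sum>j<m. (h m j)\<^sup>2)"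
    using fourth_moment_linear[OF ind i4 mean K, of m "h m"] m by auto
  note * = fourth_moment_step[OF m1 ind2 IH(1) lin(1) i4[OF m] mean[OF m] K[OF m]]
  have "4 * sqrt K * sqrt (expectation (\<lambda>\<omega>. (\<Sum>j<m. h m j * \<xi> j \<omega>) ^ 4))
      \<le> 4 * sqrt K * (4 * sqrt K * (\<Sum>j<m. (h m j)\<^sup>2))"
    using lin(2) K0 by (intro mult_left_mono) auto
  also have "\<dots> = 16 * K * (\<Sum>j<m. (h m j)\<^sup>2)" using K0 by simp
  finally show ?case using * IH(2) by (simp add: algebra_simps)
qed

lemma sum_offdiag_symmetric:
  fixes f :: "nat \<Rightarrow> nat \<Rightarrow> real"
  assumes "\<And>i j. i < n \<Longrightarrow> j < n \<Longrightarrow> f i j = f j i"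
  shows "(\<Sum>i<n. \<Sum>j<n. f i j) = (\<Sum>i<n. f i i) + 2 * (\<Sum>i<n. \<Sum>j<i. f i j)"
  using assms
proof (induction n)
  case (Suc n)
  have "(\<Sum>i<n. f i n) = (\<Sum>i<n. f n i)" using Suc.prems by (intro sum.cong) auto
  then show ?case using Suc by (simp add: sum.distrib)
qed simp

lemma (in prob_space) nn_integral_offdiag_fourth:
  fixes \<xi> :: "nat \<Rightarrow> 'a \<Rightarrow> real"
  assumes ind: "indep_vars (\<lambda>_. borel) \<xi> {..<n}"
    and i4: "\<And>i. i < n \<Longrightarrow> integrable M (\<lambda>\<omega>. \<xi> i \<omega> ^ 4)"
    and mean: "\<And>i. i < n \<Longrightarrow> expectation (\<xi> i) = 0"
    and K: "\<And>i. i < n \<Longrightarrow> expectation (\<lambda>\<omega>. \<xi> i \<omega> ^ 4) \<le> K" and K0: "0 \<le> K"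
    and sym: "\<And>i j. i < n \<Longrightarrow> j < n \<Longrightarrow> h i j = h j i"
    and F: "(\<Sum>i<n. \<Sum>j<n. (h i j)\<^sup>2) \<le> F"
  shows "(\<integral>\<^sup>+\<omega>. ennreal (((\<Sum>i<n. \<Sum>j<n. h i j * \<xi> i \<omega> * \<xi> j \<omega>) - (\<Sum>i<n. h i i * (\<xi> i \<omega>)\<^sup>2)) ^ 4) \<partial>M)
     \<le> ennreal ((32 * K * F)\<^sup>2)"
proof -
  define Q where "Q \<omega> = (\<Sum>i<n. (\<Sum>j<i. h i j * \<xi> j \<omega>) * \<xi> i \<omega>)" for \<omega>
  have Q: "(\<Sum>i<n. \<Sum>j<n. h i j * \<xi> i \<omega> * \<xi> j \<omega>) - (\<Sum>i<n. h i i * (\<xi> i \<omega>)\<^sup>2) = 2 * Q \<omega>" for \<omega>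
    by (subst sum_offdiag_symmetric)
      (auto simp: sym Q_def power2_eq_square sum_distrib_left sum_distrib_right mult_ac intro!: sum.cong)
  have 1: "integrable M (\<lambda>\<omega>. Q \<omega> ^ 4)"
    "sqrt (expectation (\<lambda>\<omega>. Q \<omega> ^ 4)) \<le> 16 * K * (\<Sum>i<n. \<Sum>j<i. (h i j)\<^sup>2)"
    using fourth_moment_lower_chaos[OF ind i4 mean K K0 order_refl, of h] by (auto simp: Q_def)
  have "2 * (\<Sum>i<n. \<Sum>j<i. (h i j)\<^sup>2) \<le> (\<Sum>i<n. \<Sum>j<n. (h i j)\<^sup>2)"
    by (subst sum_offdiag_symmetric) (auto simp: sym intro!: sum_nonneg)
  then have "2 * (\<Sum>i<n. \<Sum>j<i. (h i j)\<^sup>2) \<le> F" using F by linarith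
  then have "8 * K * (2 * (\<Sum>i<n. \<Sum>j<i. (h i j)\<^sup>2)) \<le> 8 * K * F"
    using K0 by (intro mult_left_mono) auto
  then have "sqrt (expectation (\<lambda>\<omega>. Q \<omega> ^ 4)) \<le> 8 * K * F"
    using 1(2) by (simp add: mult_ac)
  then have "expectation (\<lambda>\<omega>. Q \<omega> ^ 4) \<le> (8 * K * F)\<^sup>2"
    by (rule sqrt_le_D)
  then have le: "16 * expectation (\<lambda>\<omega>. Q \<omega> ^ 4) \<le> (32 * K * F)\<^sup>2"
    by (simp add: power_mult_distrib mult_ac)
  have "(\<integral>\<^sup>+\<omega>. ennreal ((2 * Q \<omega>) ^ 4) \<partial>M) = ennreal (expectation (\<lambda>\<omega>. 16 * Q \<omega> ^ 4))"
    using 1(1) by (subst nn_integral_eq_integral[symmetric]) (auto simp: power_mult_distrib)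
  then show ?thesis unfolding Q using le by (simp add: ennreal_leI)
qed

lemma (in prob_space) nn_integral_linear_fourth:
  fixes \<xi> :: "nat \<Rightarrow> 'a \<Rightarrow> real"
  assumes ind: "indep_vars (\<lambda>_. borel) \<xi> {..<n}"
    and i4: "\<And>i. i < n \<Longrightarrow> integrable M (\<lambda>\<omega>. \<xi> i \<omega> ^ 4)"
    and mean: "\<And>i. i < n \<Longrightarrow> expectation (\<xi> i) = 0"
    and K: "\<And>i. i < n \<Longrightarrow> expectation (\<lambda>\<omega>. \<xi> i \<omega> ^ 4) \<le> K" and K0: "0 \<le> K"
    and F: "(\<Sum>i<n. (c i)\<^sup>2) \<le> F"
  shows "(\<integral>\<^sup>+\<omega>. ennreal ((\<Sum>i<n. c i * \<xi> i \<omega>) ^ 4) \<partial>M) \<le> ennreal (16 * K * F\<^sup>2)"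
proof -
  have 1: "integrable M (\<lambda>\<omega>. (\<Sum>i<n. c i * \<xi> i \<omega>) ^ 4)"
    "sqrt (expectation (\<lambda>\<omega>. (\<Sum>i<n. c i * \<xi> i \<omega>) ^ 4)) \<le> 4 * sqrt K * (\<Sum>i<n. (c i)\<^sup>2)"
    using fourth_moment_linear[OF ind i4 mean K order_refl, of c] by auto
  have "4 * sqrt K * (\<Sum>i<n. (c i)\<^sup>2) \<le> 4 * sqrt K * F"
    using F K0 by (intro mult_left_mono) auto
  then have "sqrt (expectation (\<lambda>\<omega>. (\<Sum>i<n. c i * \<xi> i \<omega>) ^ 4)) \<le> 4 * sqrt K * F" using 1(2) by linarith
  then have "expectation (\<lambda>\<omega>. (\<Sum>i<n. c i * \<xi> i \<omega>) ^ 4) \<le> (4 * sqrt K * F)\<^sup>2" by (rule sqrt_le_D)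
  then show ?thesis using 1(1) K0
    by (subst nn_integral_eq_integral) (auto simp: power_mult_distrib intro!: ennreal_leI)
qed

section \<open>Moments of order between two and three of sums\<close>

text \<open>With \<open>z\<close> one of the two shares \<open>x / (x + y)\<close> and \<open>y / (x + y)\<close>, the inequality \<open>z \<le> z powr r\<close> holds
  since \<open>z\<close> and \<open>r\<close> are at most one; the shares sum to one.\<close>

lemma powr_add_le_add_powr:
  fixes x y r :: real
  assumes "0 \<le> x" "0 \<le> y" "0 < r" "r \<le> 1"
  shows "(x + y) powr r \<le> x powr r + y powr r"
proof (cases "x + y = 0")
  case False
  then have p: "0 < x + y" using assms by linarith
  have le: "z / (x + y) \<le> z powr r / (x + y) powr r" if "0 \<le> z" "z \<le> x + y" for z
  proof (cases "z = 0")
    case False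
    then have "(z / (x + y)) powr 1 \<le> (z / (x + y)) powr r"
      using that p assms by (intro powr_mono') auto
    then show ?thesis using that p False by (simp add: powr_divide)
  qed simp
  have "1 = x / (x + y) + y / (x + y)" using p by (simp add: add_divide_distrib[symmetric])
  also have "\<dots> \<le> x powr r / (x + y) powr r + y powr r / (x + y) powr r"
    using assms by (intro add_mono le) auto
  also have "\<dots> = (x powr r + y powr r) / (x + y) powr r" by (simp add: add_divide_distrib)
  finally show ?thesis using p by (simp add: field_simps)
qed (use assms in auto)

lemma square_powr: "(x\<^sup>2) powr s = \<bar>x\<bar> powr (2 * s)" for x s :: real
proof (cases "x = 0")
  case False
  then have "x\<^sup>2 = \<bar>x\<bar> powr 2" by simp
  then show ?thesis by (simp only: powr_powr)
qed simp

text \<open>Second order Taylor expansion of \<open>x \<mapsto> (1 + x\<^sup>2) powr (q / 2)\<close>, a smooth substitute for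
  \<open>\<bar>x\<bar> powr q\<close>. Its second derivative is at most \<open>6 (1 + x\<^sup>2) powr (q / 2 - 1)\<close>, and for \<open>q \<le> 3\<close> the
  power \<open>\<bar>x\<bar> powr (q - 2)\<close> is subadditive, which separates \<open>a\<close> from \<open>b\<close>.\<close>

lemma smoothed_power_step:
  fixes a b q :: real
  assumes q: "2 < q" "q \<le> 3"
  shows "(1 + (a + b)\<^sup>2) powr (q / 2) \<le> (1 + a\<^sup>2) powr (q / 2)
     + q * a * (1 + a\<^sup>2) powr (q / 2 - 1) * b
     + 3 * b\<^sup>2 * (1 + \<bar>a\<bar> powr (q - 2) + \<bar>b\<bar> powr (q - 2))"
proof (cases "b = 0")
  case False
  define s where "s = q / 2 - 1"
  have s: "0 < s" "2 * s \<le> 1" "q = 2 * s + 2" using q by (auto simp: s_def field_simps)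
  \<comment> \<open>the function and its first two derivatives\<close>
  define diff :: "nat \<Rightarrow> real \<Rightarrow> real" where "diff = (\<lambda>m x. if m = 0 then (1 + x\<^sup>2) powr (s + 1)
     else if m = 1 then q * x * (1 + x\<^sup>2) powr s
     else q * (1 + x\<^sup>2) powr s + q * x * (s * (1 + x\<^sup>2) powr (s - 1) * (2 * x)))"
  have pos: "0 < 1 + x\<^sup>2" for x :: real by (simp add: add_pos_nonneg)
  have d0: "(diff 0 has_real_derivative diff (Suc 0) x) (at x)" for x
    unfolding diff_def using pos[of x] s(3)
    by (auto intro!: derivative_eq_intros simp: field_simps)
  have d1: "(diff (Suc 0) has_real_derivative diff (Suc (Suc 0)) x) (at x)" for x
    unfolding diff_def using pos[of x]
    by (auto intro!: derivative_eq_intros simp: field_simps)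
  let ?l = "min a (a + b)" and ?u = "max a (a + b)"
  have "\<exists>t. (if a + b < a then a + b < t \<and> t < a else a < t \<and> t < a + b) \<and>
      diff 0 (a + b) = (\<Sum>m<2. diff m a / fact m * (a + b - a) ^ m) + diff 2 t / fact 2 * (a + b - a) ^ 2"
  proof (rule Taylor[of 2 diff "diff 0" ?l ?u])
    show "\<forall>m t. m < 2 \<and> ?l \<le> t \<and> t \<le> ?u \<longrightarrow> DERIV (diff m) t :> diff (Suc m) t"
      using d0 d1 by (auto simp: less_2_cases_iff)
  qed (use False in auto)
  then obtain t where t: "if a + b < a then a + b < t \<and> t < a else a < t \<and> t < a + b"
    and eq: "diff 0 (a + b) = diff 0 a + diff 1 a * b + diff 2 t / 2 * b\<^sup>2"
    by (auto simp: numeral_2_eq_2)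
  have abt: "\<bar>t\<bar> \<le> \<bar>a\<bar> + \<bar>b\<bar>" using t by (auto split: if_splits)
  have sub: "(x + y) powr (2 * s) \<le> x powr (2 * s) + y powr (2 * s)" if "0 \<le> x" "0 \<le> y" for x y :: real
    using that s by (intro powr_add_le_add_powr) auto
  have "(1 + t\<^sup>2) powr s \<le> ((1 + \<bar>a\<bar> + \<bar>b\<bar>)\<^sup>2) powr s"
  proof (rule powr_mono2)
    have "1 + t\<^sup>2 \<le> (1 + \<bar>t\<bar>)\<^sup>2" by (simp add: power2_sum)
    also have "\<dots> \<le> (1 + \<bar>a\<bar> + \<bar>b\<bar>)\<^sup>2" using abt by (intro power_mono) auto
    finally show "1 + t\<^sup>2 \<le> (1 + \<bar>a\<bar> + \<bar>b\<bar>)\<^sup>2" .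
  qed (use s pos[of t] in auto)
  also have "\<dots> = (1 + \<bar>a\<bar> + \<bar>b\<bar>) powr (2 * s)"
    by (simp add: powr_powr[symmetric])
  also have "\<dots> \<le> (1 + \<bar>a\<bar>) powr (2 * s) + \<bar>b\<bar> powr (2 * s)" by (rule sub) auto
  also have "\<dots> \<le> 1 + \<bar>a\<bar> powr (2 * s) + \<bar>b\<bar> powr (2 * s)" using sub[of 1 "\<bar>a\<bar>"] by simp
  finally have t1: "(1 + t\<^sup>2) powr s \<le> 1 + \<bar>a\<bar> powr (2 * s) + \<bar>b\<bar> powr (2 * s)" .
  have "t\<^sup>2 * (1 + t\<^sup>2) powr (s - 1) \<le> (1 + t\<^sup>2) * (1 + t\<^sup>2) powr (s - 1)"
    by (intro mult_right_mono) auto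
  also have "\<dots> = (1 + t\<^sup>2) powr s" using pos[of t] by (simp add: powr_mult_base)
  finally have t2: "t\<^sup>2 * (1 + t\<^sup>2) powr (s - 1) \<le> (1 + t\<^sup>2) powr s" .
  have "diff 2 t = q * (1 + t\<^sup>2) powr s + 2 * q * s * (t\<^sup>2 * (1 + t\<^sup>2) powr (s - 1))"
    by (simp add: diff_def power2_eq_square mult_ac)
  also have "\<dots> \<le> q * (1 + t\<^sup>2) powr s + 2 * q * s * (1 + t\<^sup>2) powr s"
    using t2 q s by (intro add_mono mult_left_mono) auto
  also have "\<dots> = (q * (1 + 2 * s)) * (1 + t\<^sup>2) powr s" by (simp add: algebra_simps)
  also have "\<dots> \<le> 6 * (1 + t\<^sup>2) powr s"
  proof (rule mult_right_mono)
    have "q * (1 + 2 * s) \<le> 3 * 2" using q s by (intro mult_mono) auto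
    then show "q * (1 + 2 * s) \<le> 6" by simp
  qed simp
  also have "\<dots> \<le> 6 * (1 + \<bar>a\<bar> powr (2 * s) + \<bar>b\<bar> powr (2 * s))" using t1 by simp
  finally have rem: "diff 2 t / 2 * b\<^sup>2 \<le> 3 * (1 + \<bar>a\<bar> powr (2 * s) + \<bar>b\<bar> powr (2 * s)) * b\<^sup>2"
    by (intro mult_right_mono) auto
  have s2: "2 * s = q - 2" using s(3) by simp
  have "diff 0 x = (1 + x\<^sup>2) powr (q / 2)" for x by (simp add: diff_def s(3) add_divide_distrib)
  moreover have "diff 1 a = q * a * (1 + a\<^sup>2) powr (q / 2 - 1)" by (simp add: diff_def s_def)
  ultimately show ?thesis using eq rem[unfolded s2] by (simp add: algebra_simps)
qed simp

text \<open>When a summand is added, the first order Taylor term has mean zero by independence and the second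
  order term costs \<open>O(n powr (q / 2 - 1))\<close>. Second moments are carried along in the induction:
  \<open>\<bar>S\<bar> powr (q - 2) \<le> n powr (q / 2 - 1) + n powr (q / 2 - 2) * S\<^sup>2\<close>, so they control the
  remainder.\<close>

lemma (in prob_space) smoothed_power_moment:
  fixes \<zeta> :: "nat \<Rightarrow> 'a \<Rightarrow> real"
  assumes ind: "indep_vars (\<lambda>_. borel) \<zeta> {..<n}"
    and q: "2 < q" "q \<le> 3"
    and iq: "\<And>i. i < n \<Longrightarrow> integrable M (\<lambda>\<omega>. \<bar>\<zeta> i \<omega>\<bar> powr q)"
    and mean: "\<And>i. i < n \<Longrightarrow> expectation (\<zeta> i) = 0"
    and K: "\<And>i. i < n \<Longrightarrow> expectation (\<lambda>\<omega>. \<bar>\<zeta> i \<omega>\<bar> powr q) \<le> K" and K0: "0 \<le> K"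
    and n: "0 < n" and m: "m \<le> n"
  defines "S \<equiv> \<lambda>m \<omega>. \<Sum>i<m. \<zeta> i \<omega>"
  shows "integrable M (\<lambda>\<omega>. (1 + (S m \<omega>)\<^sup>2) powr (q / 2)) \<and> integrable M (\<lambda>\<omega>. (S m \<omega>)\<^sup>2) \<and>
    expectation (\<lambda>\<omega>. (S m \<omega>)\<^sup>2) \<le> real m * (1 + K) \<and>
    expectation (\<lambda>\<omega>. (1 + (S m \<omega>)\<^sup>2) powr (q / 2))
      \<le> 1 + real m * (3 * (1 + K) * (4 + K) * real n powr (q / 2 - 1))"
  using m
proof (induction m)
  case 0
  show ?case by (simp add: S_def prob_space)
next
  case (Suc m)
  let ?\<phi> = "\<lambda>x :: real. (1 + x\<^sup>2) powr (q / 2)"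
  let ?d = "\<lambda>x :: real. q * x * (1 + x\<^sup>2) powr (q / 2 - 1)"
  from Suc have m: "m < n" and i\<phi>: "integrable M (\<lambda>\<omega>. ?\<phi> (S m \<omega>))" and iS2: "integrable M (\<lambda>\<omega>. (S m \<omega>)\<^sup>2)"
    and ES2: "expectation (\<lambda>\<omega>. (S m \<omega>)\<^sup>2) \<le> real m * (1 + K)"
    and E\<phi>: "expectation (\<lambda>\<omega>. ?\<phi> (S m \<omega>)) \<le> 1 + real m * (3 * (1 + K) * (4 + K) * real n powr (q / 2 - 1))"
    by auto
  have meas: "\<zeta> i \<in> borel_measurable M" if "i < n" for i
    using ind that unfolding indep_vars_def2 by auto
  note [measurable] = meas[OF m]
  have [measurable]: "S m \<in> borel_measurable M" unfolding S_def using m meas by (intro borel_measurable_sum) auto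
  have S_Suc: "S (Suc m) \<omega> = S m \<omega> + \<zeta> m \<omega>" for \<omega> by (simp add: S_def)
  have ind': "indep_var borel (\<lambda>\<omega>. f (S m \<omega>)) borel (\<lambda>\<omega>. g (\<zeta> m \<omega>))"
    if [measurable]: "f \<in> borel \<rightarrow>\<^sub>M borel" "g \<in> borel \<rightarrow>\<^sub>M borel" for f g :: "real \<Rightarrow> real"
  proof -
    have "indep_var borel (\<lambda>\<omega>. f (S m \<omega>)) borel (\<zeta> m)"
      using indep_var_of_earlier[OF ind m, of "\<lambda>h. f (\<Sum>i<m. h i)"] by (simp add: S_def)
    from indep_var_compose[OF this measurable_ident that(2)] show ?thesis by (simp add: comp_def)
  qed
  have sq_le: "x\<^sup>2 \<le> 1 + \<bar>x\<bar> powr q" for x :: real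
  proof (cases "\<bar>x\<bar> \<le> 1")
    case True
    then have "x\<^sup>2 \<le> 1" by (simp add: abs_square_le_1)
    moreover have "0 \<le> \<bar>x\<bar> powr q" by simp
    ultimately show ?thesis by linarith
  next
    case False
    have "x\<^sup>2 = \<bar>x\<bar> powr 2" using False by simp
    also have "\<dots> \<le> \<bar>x\<bar> powr q" using False q by (intro powr_mono) auto
    finally show ?thesis by simp
  qed
  have "integrable M (\<lambda>\<omega>. 1 + \<bar>\<zeta> m \<omega>\<bar> powr q)" using iq[OF m] by simp
  then have i\<zeta>2: "integrable M (\<lambda>\<omega>. (\<zeta> m \<omega>)\<^sup>2)"
    by (rule integrable_between[OF _ _ _ sq_le]) simp_all
  have "expectation (\<lambda>\<omega>. (\<zeta> m \<omega>)\<^sup>2) \<le> expectation (\<lambda>\<omega>. 1 + \<bar>\<zeta> m \<omega>\<bar> powr q)"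
    by (rule integral_mono) (use i\<zeta>2 iq[OF m] sq_le in auto)
  then have E\<zeta>2: "expectation (\<lambda>\<omega>. (\<zeta> m \<omega>)\<^sup>2) \<le> 1 + K"
    using iq[OF m] K[OF m] by (simp add: prob_space)
  have i\<zeta>: "integrable M (\<zeta> m)" by (rule square_integrable_imp_integrable[OF _ i\<zeta>2]) simp
  have iS: "integrable M (S m)" by (rule square_integrable_imp_integrable[OF _ iS2]) simp
  have ind11: "indep_var borel (S m) borel (\<zeta> m)" using ind'[of "\<lambda>x. x" "\<lambda>x. x"] by simp
  have iS\<zeta>: "integrable M (\<lambda>\<omega>. S m \<omega> * \<zeta> m \<omega>)" "expectation (\<lambda>\<omega>. S m \<omega> * \<zeta> m \<omega>) = 0"
    using indep_var_integrable[OF ind11 iS i\<zeta>] indep_var_lebesgue_integral[OF ind11 iS i\<zeta>] mean[OF m] by auto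
  have sq_eq: "(S (Suc m) \<omega>)\<^sup>2 = (S m \<omega>)\<^sup>2 + 2 * (S m \<omega> * \<zeta> m \<omega>) + (\<zeta> m \<omega>)\<^sup>2" for \<omega>
    by (simp add: S_Suc power2_sum)
  have iS2': "integrable M (\<lambda>\<omega>. (S (Suc m) \<omega>)\<^sup>2)"
    unfolding sq_eq using iS2 iS\<zeta> i\<zeta>2 by auto
  have "expectation (\<lambda>\<omega>. (S (Suc m) \<omega>)\<^sup>2) = expectation (\<lambda>\<omega>. (S m \<omega>)\<^sup>2) + expectation (\<lambda>\<omega>. (\<zeta> m \<omega>)\<^sup>2)"
    unfolding sq_eq using iS2 iS\<zeta> i\<zeta>2 by simp
  then have ES2': "expectation (\<lambda>\<omega>. (S (Suc m) \<omega>)\<^sup>2) \<le> real (Suc m) * (1 + K)"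
    using ES2 E\<zeta>2 by (simp add: algebra_simps)
  define s where "s = q / 2 - 1"
  have s: "0 < s" "q = 2 * s + 2" "s \<le> 1/2" using q by (auto simp: s_def field_simps)
  have d_le: "\<bar>?d x\<bar> \<le> q * ?\<phi> x" for x
  proof -
    have "2 * \<bar>x\<bar> \<le> 1 + x\<^sup>2" using sum_squares_bound[of 1 "\<bar>x\<bar>"] by simp
    then have "\<bar>x\<bar> \<le> 1 + x\<^sup>2" by linarith
    then have "\<bar>x\<bar> * (1 + x\<^sup>2) powr (q / 2 - 1) \<le> (1 + x\<^sup>2) * (1 + x\<^sup>2) powr (q / 2 - 1)"
      by (intro mult_right_mono) auto
    also have "\<dots> = ?\<phi> x" by (subst powr_mult_base) auto
    finally show ?thesis using q by (simp add: abs_mult)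
  qed
  have id: "integrable M (\<lambda>\<omega>. ?d (S m \<omega>))"
    by (rule Bochner_Integration.integrable_bound[OF integrable_mult_right[OF i\<phi>, of q]])
      (use d_le q in \<open>auto simp: abs_mult\<close>)
  have indd: "indep_var borel (\<lambda>\<omega>. ?d (S m \<omega>)) borel (\<zeta> m)" by (rule ind'[of ?d "\<lambda>x. x"]) measurable
  have id\<zeta>: "integrable M (\<lambda>\<omega>. ?d (S m \<omega>) * \<zeta> m \<omega>)" "expectation (\<lambda>\<omega>. ?d (S m \<omega>) * \<zeta> m \<omega>) = 0"
    using indep_var_integrable[OF indd id i\<zeta>] indep_var_lebesgue_integral[OF indd id i\<zeta>] mean[OF m] by auto
  \<comment> \<open>splitting \<open>\<bar>S\<bar> powr (q - 2)\<close> at \<open>S\<^sup>2 = n\<close> turns it into a constant plus a multiple of \<open>S\<^sup>2\<close>\<close>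
  define c1 where "c1 = real n powr s"
  define c2 where "c2 = real n powr (s - 1)"
  have c: "0 \<le> c1" "0 \<le> c2" "real n * c2 = c1" "1 \<le> c1"
    using n s by (auto simp: c1_def c2_def powr_mult_base ge_one_powr_ge_zero)
  have absS: "\<bar>x\<bar> powr (q - 2) \<le> c1 + c2 * x\<^sup>2" for x :: real
  proof (cases "x\<^sup>2 \<le> real n")
    case True
    have "\<bar>x\<bar> powr (q - 2) = (x\<^sup>2) powr s" by (simp add: s square_powr)
    also have "\<dots> \<le> c1" unfolding c1_def using True s by (intro powr_mono2) auto
    finally show ?thesis using mult_nonneg_nonneg[OF c(2) zero_le_power2[of x]] by linarith
  next
    case False
    then have x: "0 < x\<^sup>2" "x \<noteq> 0" using n by auto
    have "\<bar>x\<bar> powr (q - 2) = (x\<^sup>2) powr s" by (simp add: s square_powr)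
    also have "\<dots> = x\<^sup>2 * (x\<^sup>2) powr (s - 1)" using x by (simp add: powr_mult_base)
    also have "\<dots> \<le> x\<^sup>2 * c2"
      unfolding c2_def using False s n by (intro mult_left_mono powr_mono2') auto
    finally show ?thesis using c by (simp add: mult_ac)
  qed
  have bq: "b\<^sup>2 * \<bar>b\<bar> powr (q - 2) = \<bar>b\<bar> powr q" for b :: real
  proof (cases "b = 0")
    case False
    then have "b\<^sup>2 = \<bar>b\<bar> powr 2" by simp
    then show ?thesis by (simp only: powr_add[symmetric]) simp
  qed simp
  let ?rhs = "\<lambda>\<omega>. ?\<phi> (S m \<omega>) + ?d (S m \<omega>) * \<zeta> m \<omega> + (3 * (1 + c1)) * (\<zeta> m \<omega>)\<^sup>2
     + (3 * c2) * ((S m \<omega>)\<^sup>2 * (\<zeta> m \<omega>)\<^sup>2) + 3 * \<bar>\<zeta> m \<omega>\<bar> powr q"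
  have pw: "?\<phi> (S (Suc m) \<omega>) \<le> ?rhs \<omega>" for \<omega>
  proof -
    define a where "a = S m \<omega>"
    define b where "b = \<zeta> m \<omega>"
    have "?\<phi> (a + b) \<le> ?\<phi> a + ?d a * b + 3 * b\<^sup>2 * (1 + \<bar>a\<bar> powr (q - 2) + \<bar>b\<bar> powr (q - 2))"
      using smoothed_power_step[OF q, of a b] by (simp add: mult_ac)
    also have "3 * b\<^sup>2 * (1 + \<bar>a\<bar> powr (q - 2) + \<bar>b\<bar> powr (q - 2))
       \<le> 3 * b\<^sup>2 * (1 + (c1 + c2 * a\<^sup>2) + \<bar>b\<bar> powr (q - 2))"
      using absS[of a] by (intro mult_left_mono) auto
    also have "\<dots> = 3 * (1 + c1) * b\<^sup>2 + 3 * c2 * (a\<^sup>2 * b\<^sup>2) + 3 * (b\<^sup>2 * \<bar>b\<bar> powr (q - 2))"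
      by (simp add: algebra_simps)
    finally show ?thesis unfolding bq S_Suc a_def b_def by simp
  qed
  have ind22: "indep_var borel (\<lambda>\<omega>. (S m \<omega>)\<^sup>2) borel (\<lambda>\<omega>. (\<zeta> m \<omega>)\<^sup>2)" by (rule ind') measurable
  have i22: "integrable M (\<lambda>\<omega>. (S m \<omega>)\<^sup>2 * (\<zeta> m \<omega>)\<^sup>2)"
     "expectation (\<lambda>\<omega>. (S m \<omega>)\<^sup>2 * (\<zeta> m \<omega>)\<^sup>2) = expectation (\<lambda>\<omega>. (S m \<omega>)\<^sup>2) * expectation (\<lambda>\<omega>. (\<zeta> m \<omega>)\<^sup>2)"
    by (rule indep_var_integrable[OF ind22 iS2 i\<zeta>2], rule indep_var_lebesgue_integral[OF ind22 iS2 i\<zeta>2])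
  have irhs: "integrable M ?rhs"
    using i\<phi> id\<zeta>(1) i\<zeta>2 i22(1) iq[OF m] by (intro Bochner_Integration.integrable_add integrable_mult_right) auto
  have int: "integrable M (\<lambda>\<omega>. ?\<phi> (S (Suc m) \<omega>))"
    by (rule integrable_between[OF irhs _ _ pw]) (simp_all add: S_Suc)
  have "expectation (\<lambda>\<omega>. ?\<phi> (S (Suc m) \<omega>)) \<le> expectation ?rhs"
    by (rule integral_mono[OF int irhs pw])
  also have "\<dots> = expectation (\<lambda>\<omega>. ?\<phi> (S m \<omega>)) + 0 + (3 * (1 + c1)) * expectation (\<lambda>\<omega>. (\<zeta> m \<omega>)\<^sup>2)
      + (3 * c2) * (expectation (\<lambda>\<omega>. (S m \<omega>)\<^sup>2) * expectation (\<lambda>\<omega>. (\<zeta> m \<omega>)\<^sup>2))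
      + 3 * expectation (\<lambda>\<omega>. \<bar>\<zeta> m \<omega>\<bar> powr q)"
    using i\<phi> id\<zeta> i\<zeta>2 i22 iq[OF m]
    by (simp del: distrib_left_numeral mult_eq_0_iff)
  also have "\<dots> \<le> expectation (\<lambda>\<omega>. ?\<phi> (S m \<omega>)) + 0 + (3 * (1 + c1)) * (1 + K)
      + (3 * c2) * ((real n * (1 + K)) * (1 + K)) + 3 * K"
  proof (intro add_mono mult_left_mono mult_mono order_refl E\<zeta>2 K m)
    show "expectation (\<lambda>\<omega>. (S m \<omega>)\<^sup>2) \<le> real n * (1 + K)"
      using ES2 m K0 by (intro order_trans[OF ES2] mult_right_mono) auto
  qed (use c K0 in auto)
  also have "(3 * c2) * ((real n * (1 + K)) * (1 + K)) = 3 * c1 * (1 + K)\<^sup>2"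
    using c(3) by (simp add: power2_eq_square mult_ac flip: c(3))
  also have "expectation (\<lambda>\<omega>. ?\<phi> (S m \<omega>)) + 0 + 3 * (1 + c1) * (1 + K) + 3 * c1 * (1 + K)\<^sup>2 + 3 * K
     \<le> expectation (\<lambda>\<omega>. ?\<phi> (S m \<omega>)) + 3 * (1 + K) * (4 + K) * c1"
  proof -
    have "3 * (1 + c1) * (1 + K) \<le> 3 * (c1 + c1) * (1 + K)" using c K0 by (intro mult_right_mono) auto
    moreover have "3 * K \<le> 3 * (c1 * (1 + K))" using c K0 mult_mono[of 1 c1 K "1 + K"] by simp
    moreover have "3 * (1 + K) * (4 + K) * c1 = 3 * (c1 + c1) * (1 + K) + 3 * c1 * (1 + K)\<^sup>2 + 3 * (c1 * (1 + K))"
      by (simp add: power2_eq_square algebra_simps)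
    ultimately show ?thesis by linarith
  qed
  also have "\<dots> \<le> 1 + real (Suc m) * (3 * (1 + K) * (4 + K) * real n powr (q / 2 - 1))"
    using E\<phi> by (simp add: algebra_simps c1_def s_def)
  finally show ?case using int iS2' ES2' by blast
qed

text \<open>For sums of \<open>n\<close> independent centred variables this is the order of growth of the Rosenthal inequality,
  in the range \<open>2 < q \<le> 3\<close>.\<close>

lemma (in prob_space) nn_integral_smoothed_power:
  fixes \<zeta> :: "nat \<Rightarrow> 'a \<Rightarrow> real"
  assumes ind: "indep_vars (\<lambda>_. borel) \<zeta> {..<n}"
    and q: "2 < q" "q \<le> 3"
    and iq: "\<And>i. i < n \<Longrightarrow> integrable M (\<lambda>\<omega>. \<bar>\<zeta> i \<omega>\<bar> powr q)"
    and mean: "\<And>i. i < n \<Longrightarrow> expectation (\<zeta> i) = 0"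
    and K: "\<And>i. i < n \<Longrightarrow> expectation (\<lambda>\<omega>. \<bar>\<zeta> i \<omega>\<bar> powr q) \<le> K" and K0: "0 \<le> K"
    and n: "0 < n"
  shows "(\<integral>\<^sup>+\<omega>. ennreal (\<bar>\<Sum>i<n. \<zeta> i \<omega>\<bar> powr q) \<partial>M)
    \<le> ennreal ((1 + 3 * (1 + K) * (4 + K)) * real n powr (q / 2))"
proof -
  let ?c = "3 * (1 + K) * (4 + K)"
  note * = smoothed_power_moment[OF ind q iq mean K K0 n order_refl]
  have le: "\<bar>x\<bar> powr q \<le> (1 + x\<^sup>2) powr (q / 2)" for x :: real
  proof -
    have "\<bar>x\<bar> powr q = (x\<^sup>2) powr (q / 2)" by (simp add: square_powr)
    also have "\<dots> \<le> (1 + x\<^sup>2) powr (q / 2)" using q by (intro powr_mono2) auto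
    finally show ?thesis .
  qed
  have "(\<integral>\<^sup>+\<omega>. ennreal (\<bar>\<Sum>i<n. \<zeta> i \<omega>\<bar> powr q) \<partial>M) \<le> (\<integral>\<^sup>+\<omega>. ennreal ((1 + (\<Sum>i<n. \<zeta> i \<omega>)\<^sup>2) powr (q / 2)) \<partial>M)"
    by (intro nn_integral_mono ennreal_leI le)
  also have "\<dots> = ennreal (expectation (\<lambda>\<omega>. (1 + (\<Sum>i<n. \<zeta> i \<omega>)\<^sup>2) powr (q / 2)))"
    using * by (intro nn_integral_eq_integral) auto
  also have "\<dots> \<le> ennreal ((1 + ?c) * real n powr (q / 2))"
  proof (rule ennreal_leI)
    have e: "real n * real n powr (q / 2 - 1) = real n powr (q / 2)" using n by (simp add: powr_mult_base)
    have "expectation (\<lambda>\<omega>. (1 + (\<Sum>i<n. \<zeta> i \<omega>)\<^sup>2) powr (q / 2)) \<le> 1 + ?c * (real n * real n powr (q / 2 - 1))"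
      using * by (simp add: mult_ac)
    also have "\<dots> = 1 + ?c * real n powr (q / 2)" unfolding e ..
    also have "\<dots> \<le> (1 + ?c) * real n powr (q / 2)"
      using n q by (simp add: distrib_right ge_one_powr_ge_zero)
    finally show "expectation (\<lambda>\<omega>. (1 + (\<Sum>i<n. \<zeta> i \<omega>)\<^sup>2) powr (q / 2)) \<le> (1 + ?c) * real n powr (q / 2)" .
  qed
  finally show ?thesis .
qed

section \<open>Euclidean and Frobenius norms\<close>

abbreviation sq_norm :: "real Matrix.vec \<Rightarrow> real" where
  "sq_norm v \<equiv> v \<bullet> v"

lemma scalar_prod_eq_sum: "dim_vec w = n \<Longrightarrow> v \<bullet> w = (\<Sum>i<n. v $ i * w $ i)"
  by (simp add: scalar_prod_def atLeast0LessThan)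

lemma scalar_prod_self_nonneg: "0 \<le> v \<bullet> (v :: real Matrix.vec)"
  by (simp add: scalar_prod_def sum_nonneg)

lemma scalar_prod_self_eq_0:
  assumes "v \<in> carrier_vec n" "v \<bullet> (v :: real Matrix.vec) = 0"
  shows "v = 0\<^sub>v n"
proof (rule eq_vecI)
  fix i assume "i < dim_vec (0\<^sub>v n :: real Matrix.vec)"
  with assms show "v $ i = 0\<^sub>v n $ i"
    by (simp add: scalar_prod_def sum_nonneg_eq_0_iff)
qed (use assms in auto)

text \<open>Young's inequality in each coordinate.\<close>

lemma scalar_prod_le:
  fixes v w :: "real Matrix.vec"
  assumes "v \<in> carrier_vec n" "w \<in> carrier_vec n" "0 < s"
  shows "v \<bullet> w \<le> s * (v \<bullet> v) + (w \<bullet> w) / (4 * s)"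
proof -
  have "a * b \<le> s * (a * a) + (b * b) / (4 * s)" for a b :: real
  proof -
    have "0 \<le> (2 * s * a - b)\<^sup>2" by simp
    then have "4 * s * (a * b) \<le> 4 * s * (s * (a * a)) + b * b"
      by (simp add: power2_eq_square algebra_simps)
    then show ?thesis using assms(3) by (simp add: field_simps)
  qed
  then have "(\<Sum>i<n. v $ i * w $ i) \<le> (\<Sum>i<n. s * (v $ i * v $ i) + (w $ i * w $ i) / (4 * s))"
    by (intro sum_mono)
  then show ?thesis
    using assms by (simp add: scalar_prod_eq_sum[of _ n] sum.distrib sum_distrib_left sum_divide_distrib)
qed

lemma scalar_prod_mult_mat_vec:
  fixes A :: "real mat"
  assumes "A \<in> carrier_mat n p" "v \<in> carrier_vec p" "w \<in> carrier_vec n"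
  shows "w \<bullet> (A *\<^sub>v v) = (A\<^sup>T *\<^sub>v w) \<bullet> v"
  by (rule transpose_vec_mult_scalar[OF assms, symmetric])

text \<open>The squared Frobenius norm.\<close>

definition frob2 :: "real mat \<Rightarrow> real" where
  "frob2 A = (\<Sum>i<dim_row A. \<Sum>j<dim_col A. (A $$ (i, j))\<^sup>2)"

lemma gram_entry:
  assumes "(A :: real mat) \<in> carrier_mat n p" "i < p" "j < p"
  shows "(A\<^sup>T * A) $$ (i, j) = (\<Sum>k<n. A $$ (k, i) * A $$ (k, j))"
  using assms by (simp add: scalar_prod_def atLeast0LessThan)

lemma frob2_trace:
  assumes "(A :: real mat) \<in> carrier_mat n p"
  shows "frob2 A = (\<Sum>j<p. (A\<^sup>T * A) $$ (j, j))"
proof -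
  have "frob2 A = (\<Sum>j<p. \<Sum>k<n. (A $$ (k, j))\<^sup>2)"
    using assms unfolding frob2_def by (subst sum.swap) auto
  also have "\<dots> = (\<Sum>j<p. (A\<^sup>T * A) $$ (j, j))"
    using gram_entry[OF assms] by (auto intro!: sum.cong simp: power2_eq_square)
  finally show ?thesis .
qed

lemma frob2_transpose: "frob2 (A\<^sup>T) = frob2 A"
  unfolding frob2_def by (subst sum.swap) (auto intro!: sum.cong)

lemma orthogonal_group_carrier: "U \<in> orthogonal_group m \<Longrightarrow> U \<in> carrier_mat m m"
  by (simp add: orthogonal_group_def)

lemma orthogonal_group_transpose_mult:
  assumes "U \<in> orthogonal_group m" shows "U\<^sup>T * U = 1\<^sub>m m" "U * U\<^sup>T = 1\<^sub>m m"
proof -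
  show 1: "U\<^sup>T * U = 1\<^sub>m m" using assms by (simp add: orthogonal_group_def)
  show "U * U\<^sup>T = 1\<^sub>m m"
    using mat_mult_left_right_inverse[OF _ _ 1] assms by (simp add: orthogonal_group_def)
qed

lemma orthogonal_group_transpose:
  assumes "U \<in> orthogonal_group m" shows "U\<^sup>T \<in> orthogonal_group m"
  using assms orthogonal_group_transpose_mult[OF assms] by (simp add: orthogonal_group_def)

lemma frob2_orthogonal_left:
  assumes U: "U \<in> orthogonal_group n" and A: "(A :: real mat) \<in> carrier_mat n p"
  shows "frob2 (U * A) = frob2 A"
proof -
  have Uc: "U \<in> carrier_mat n n" using U by (rule orthogonal_group_carrier)
  have "(U * A)\<^sup>T * (U * A) = A\<^sup>T * U\<^sup>T * (U * A)"
    using Uc A by (simp add: transpose_mult)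
  also have "\<dots> = A\<^sup>T * (U\<^sup>T * U) * A"
    using Uc A by (simp add: assoc_mult_mat[of _ p n _ n _ p] assoc_mult_mat[of _ n n _ n _ p] assoc_mult_mat[of _ p n _ n _ n])
  also have "\<dots> = A\<^sup>T * A"
    using A orthogonal_group_transpose_mult(1)[OF U] by simp
  finally show ?thesis
    using Uc A by (simp add: frob2_trace[of _ n p] frob2_trace[of A n p] del: index_mult_mat)
qed

lemma frob2_orthogonal_right:
  assumes U: "U \<in> orthogonal_group p" and A: "(A :: real mat) \<in> carrier_mat n p"
  shows "frob2 (A * U) = frob2 A"
proof -
  have "frob2 (A * U) = frob2 (U\<^sup>T * A\<^sup>T)"
    using transpose_mult[OF A orthogonal_group_carrier[OF U]] frob2_transpose[of "A * U"] by simp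
  also have "\<dots> = frob2 (A\<^sup>T)"
    by (rule frob2_orthogonal_left[OF orthogonal_group_transpose[OF U]]) (use A in simp)
  finally show ?thesis by (simp add: frob2_transpose)
qed

lemma mult_mat_vec_entry:
  assumes "(A :: real mat) \<in> carrier_mat n p" "v \<in> carrier_vec p" "i < n"
  shows "(A *\<^sub>v v) $ i = (\<Sum>j<p. A $$ (i, j) * v $ j)"
  using assms by (simp add: scalar_prod_eq_sum[of _ p])

lemma sq_norm_mult_mat_vec:
  assumes A: "(A :: real mat) \<in> carrier_mat n p" and v: "v \<in> carrier_vec p"
  shows "sq_norm (A *\<^sub>v v) = (\<Sum>i<p. \<Sum>j<p. (A\<^sup>T * A) $$ (i, j) * v $ i * v $ j)"
proof -
  have "sq_norm (A *\<^sub>v v) = (A\<^sup>T *\<^sub>v (A *\<^sub>v v)) \<bullet> v"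
    using A v by (intro scalar_prod_mult_mat_vec) auto
  also have "\<dots> = ((A\<^sup>T * A) *\<^sub>v v) \<bullet> v"
    using A v by (simp add: assoc_mult_mat_vec[of _ p n _ p])
  also have "\<dots> = (\<Sum>i<p. (\<Sum>j<p. (A\<^sup>T * A) $$ (i, j) * v $ j) * v $ i)"
    using A v mult_mat_vec_entry[of "A\<^sup>T * A" p p v]
    by (simp add: scalar_prod_eq_sum[of _ p] del: index_mult_mat index_mult_mat_vec)
  finally show ?thesis by (simp add: sum_distrib_right sum_distrib_left mult_ac)
qed

text \<open>Column \<open>j\<close> of \<open>A\<^sup>T A\<close> is \<open>A\<^sup>T\<close> applied to the image of the \<open>j\<close>-th unit vector under \<open>A\<close>, so it has
  squared length at most \<open>c\<^sup>2\<close> when \<open>A\<close> and \<open>A\<^sup>T\<close> have squared operator norm at most \<open>c\<close>.\<close>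

lemma gram_bounds:
  assumes A: "(A :: real mat) \<in> carrier_mat n p"
    and b1: "\<And>v. v \<in> carrier_vec p \<Longrightarrow> sq_norm (A *\<^sub>v v) \<le> c * (v \<bullet> v)"
    and b2: "\<And>w. w \<in> carrier_vec n \<Longrightarrow> sq_norm (A\<^sup>T *\<^sub>v w) \<le> c * (w \<bullet> w)"
    and c: "0 \<le> c"
  shows "(\<Sum>i<p. \<Sum>j<p. ((A\<^sup>T * A) $$ (i, j))\<^sup>2) \<le> real p * c\<^sup>2"
    "\<And>i. i < p \<Longrightarrow> 0 \<le> (A\<^sup>T * A) $$ (i, i)"
    "\<And>i. i < p \<Longrightarrow> (A\<^sup>T * A) $$ (i, i) \<le> c"
proof -
  let ?S = "A\<^sup>T * A"
  have S: "?S \<in> carrier_mat p p" using A by auto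
  have uu: "unit_vec p i \<bullet> unit_vec p i = (1 :: real)" if "i < p" for i
    using that by simp
  have col: "B *\<^sub>v unit_vec p i = col B i" if "i < p" "B \<in> carrier_mat m p" for i m and B :: "real mat"
    using that by (intro eq_vecI) auto
  have row: "(\<Sum>i<p. (?S $$ (i, j))\<^sup>2) \<le> c\<^sup>2" if j: "j < p" for j
  proof -
    have "(\<Sum>i<p. (?S $$ (i, j))\<^sup>2) = sq_norm (?S *\<^sub>v unit_vec p j)"
      unfolding col[OF j S] using S j
      by (subst scalar_prod_eq_sum[of _ p]) (auto simp: power2_eq_square simp del: index_mult_mat intro!: sum.cong)
    also have "?S *\<^sub>v unit_vec p j = A\<^sup>T *\<^sub>v (A *\<^sub>v unit_vec p j)"
      using A by (intro assoc_mult_mat_vec[of _ p n _ p]) auto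
    also have "sq_norm (A\<^sup>T *\<^sub>v (A *\<^sub>v unit_vec p j))
        \<le> c * sq_norm (A *\<^sub>v unit_vec p j)"
      using A by (intro b2) auto
    also have "\<dots> \<le> c * (c * (unit_vec p j \<bullet> unit_vec p j))"
      using c by (intro mult_left_mono b1) auto
    finally show ?thesis using uu[OF j] by (simp add: power2_eq_square)
  qed
  have "(\<Sum>i<p. \<Sum>j<p. (?S $$ (i, j))\<^sup>2) = (\<Sum>j<p. \<Sum>i<p. (?S $$ (i, j))\<^sup>2)" by (rule sum.swap)
  also have "\<dots> \<le> (\<Sum>j<p. c\<^sup>2)" by (intro sum_mono row) auto
  finally show "(\<Sum>i<p. \<Sum>j<p. (?S $$ (i, j))\<^sup>2) \<le> real p * c\<^sup>2" by simp
  fix i assume i: "i < p"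
  have d: "?S $$ (i, i) = sq_norm (A *\<^sub>v unit_vec p i)"
    unfolding col[OF i A] using gram_entry[OF A i i] A by (simp add: scalar_prod_eq_sum[of _ n] i)
  show "0 \<le> ?S $$ (i, i)" unfolding d by (rule scalar_prod_self_nonneg)
  show "?S $$ (i, i) \<le> c" unfolding d using b1[of "unit_vec p i"] uu[OF i] by simp
qed

text \<open>The reflection that exchanges \<open>u\<close> and \<open>v\<close>, namely \<open>I - 2 w w\<^sup>T / |w|\<^sup>2\<close> with \<open>w = u - v\<close>.\<close>

lemma householder:
  fixes u v :: "real Matrix.vec"
  assumes u: "u \<in> carrier_vec p" and v: "v \<in> carrier_vec p" and eq: "u \<bullet> u = v \<bullet> v"
  shows "\<exists>U\<in>orthogonal_group p. U *\<^sub>v u = v"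
proof (cases "u = v")
  case True
  have "1\<^sub>m p \<in> orthogonal_group p" by (simp add: orthogonal_group_def)
  then show ?thesis using True v by (intro bexI[of _ "1\<^sub>m p"]) auto
next
  case False
  define w where "w i = u $ i - v $ i" for i
  define c where "c = (\<Sum>i<p. (w i)\<^sup>2)"
  define U where "U = Matrix.mat p p (\<lambda>(i, j). (if i = j then 1 else 0) - 2 * w i * w j / c)"
  have U: "U \<in> carrier_mat p p" by (simp add: U_def)
  have "c \<noteq> 0"
  proof
    assume "c = 0"
    then have "\<forall>i<p. w i = 0" unfolding c_def by (simp add: sum_nonneg_eq_0_iff)
    then have "u = v" using u v by (intro eq_vecI) (auto simp: w_def)
    with False show False ..
  qed
  have "U\<^sup>T * U = 1\<^sub>m p"
  proof (rule eq_matI)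
    fix i j assume "i < dim_row (1\<^sub>m p :: real mat)" "j < dim_col (1\<^sub>m p :: real mat)"
    then have ij: "i < p" "j < p" by auto
    have "(U\<^sup>T * U) $$ (i, j) = (\<Sum>k<p. U $$ (k, i) * U $$ (k, j))"
      by (rule gram_entry[OF U ij])
    also have "\<dots> = (\<Sum>k<p. (if k = i then (if i = j then 1 else 0) - 2 * w i * w j / c else 0)
        - (if k = j then 2 * w j * w i / c else 0) + (4 * w i * w j / c\<^sup>2) * (w k)\<^sup>2)"
      using ij by (intro sum.cong refl) (use \<open>c \<noteq> 0\<close> in \<open>auto simp: U_def field_simps power2_eq_square\<close>)
    also have "\<dots> = (if i = j then 1 else 0) - 4 * w i * w j / c + (4 * w i * w j / c\<^sup>2) * c"
    proof -
      have "(\<Sum>k<p. (4 * w i * w j / c\<^sup>2) * (w k)\<^sup>2) = (4 * w i * w j / c\<^sup>2) * c"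
        by (simp only: c_def sum_distrib_left[symmetric])
      then show ?thesis using ij by (simp only: sum.distrib sum_subtractf) simp
    qed
    also have "\<dots> = (if i = j then 1 else 0)" using \<open>c \<noteq> 0\<close> by (simp add: power2_eq_square)
    finally show "(U\<^sup>T * U) $$ (i, j) = 1\<^sub>m p $$ (i, j)" using ij by simp
  qed (use U in auto)
  then have UO: "U \<in> orthogonal_group p" using U by (simp add: orthogonal_group_def)
  have uv: "(\<Sum>i<p. (u $ i)\<^sup>2) = (\<Sum>i<p. (v $ i)\<^sup>2)"
    using eq u v by (simp add: scalar_prod_eq_sum[of _ p] power2_eq_square)
  have c2: "c = 2 * (\<Sum>j<p. w j * u $ j)"
  proof -
    have "c = (\<Sum>i<p. 2 * (w i * u $ i) + ((v $ i)\<^sup>2 - (u $ i)\<^sup>2))"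
      unfolding c_def by (intro sum.cong) (auto simp: w_def power2_eq_square algebra_simps)
    then show ?thesis using uv by (simp add: sum.distrib sum_subtractf sum_distrib_left)
  qed
  have "U *\<^sub>v u = v"
  proof (rule eq_vecI)
    fix i assume "i < dim_vec v"
    then have i: "i < p" using v by simp
    have "(U *\<^sub>v u) $ i = (\<Sum>j<p. (if j = i then u $ i else 0) - (2 * w i / c) * (w j * u $ j))"
      unfolding mult_mat_vec_entry[OF U u i]
      using i by (intro sum.cong refl) (auto simp: U_def algebra_simps)
    also have "\<dots> = u $ i - (2 * w i / c) * (\<Sum>j<p. w j * u $ j)"
      using i by (simp only: sum_subtractf sum_distrib_left[symmetric]) simp
    also have "\<dots> = u $ i - w i" using c2 \<open>c \<noteq> 0\<close> by (simp add: field_simps)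
    finally show "(U *\<^sub>v u) $ i = v $ i" by (simp add: w_def)
  qed (use U v in auto)
  then show ?thesis using UO by blast
qed

section \<open>The residual matrix of ridge regression\<close>

definition shifted_gram :: "real mat \<Rightarrow> real \<Rightarrow> real mat" where
  "shifted_gram X l = X * X\<^sup>T + l \<cdot>\<^sub>m 1\<^sub>m (dim_row X)"

text \<open>This is the matrix \<open>l\<close> times the inverse of \<open>X X\<^sup>T + l I\<close>. Cramer's rule exhibits its entries as rational functions
  of the entries of \<open>X\<close>, which makes measurability evident.\<close>

definition residual_mat :: "real mat \<Rightarrow> real \<Rightarrow> real mat" where
  "residual_mat X l = (l / Determinant.det (shifted_gram X l)) \<cdot>\<^sub>m adj_mat (shifted_gram X l)"

context
  fixes X :: "real mat" and l :: real and n p :: nat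
  assumes X: "X \<in> carrier_mat n p" and l: "0 < l"
begin

lemma shifted_gram_carrier: "shifted_gram X l \<in> carrier_mat n n"
  using X by (auto simp: shifted_gram_def)

lemma residual_mat_carrier: "residual_mat X l \<in> carrier_mat n n"
  using adj_mat(1)[OF shifted_gram_carrier] by (simp add: residual_mat_def)

lemma shifted_gram_mult_vec:
  assumes v: "v \<in> carrier_vec n"
  shows "shifted_gram X l *\<^sub>v v = X *\<^sub>v (X\<^sup>T *\<^sub>v v) + l \<cdot>\<^sub>v v"
proof -
  have "shifted_gram X l *\<^sub>v v = (X * X\<^sup>T) *\<^sub>v v + (l \<cdot>\<^sub>m 1\<^sub>m n) *\<^sub>v v"
    unfolding shifted_gram_def using X v by (simp add: add_mult_distrib_mat_vec[of _ n n])
  also have "(X * X\<^sup>T) *\<^sub>v v = X *\<^sub>v (X\<^sup>T *\<^sub>v v)"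
    using X v by (intro assoc_mult_mat_vec) auto
  also have "(l \<cdot>\<^sub>m 1\<^sub>m n) *\<^sub>v v = l \<cdot>\<^sub>v v" using v by auto
  finally show ?thesis .
qed

lemma shifted_gram_energy:
  assumes v: "v \<in> carrier_vec n"
  shows "v \<bullet> (shifted_gram X l *\<^sub>v v)
    = sq_norm (X\<^sup>T *\<^sub>v v) + l * (v \<bullet> v)"
proof -
  have "v \<bullet> (shifted_gram X l *\<^sub>v v) = v \<bullet> (X *\<^sub>v (X\<^sup>T *\<^sub>v v)) + v \<bullet> (l \<cdot>\<^sub>v v)"
    unfolding shifted_gram_mult_vec[OF v] using X v by (intro scalar_prod_add_distrib) auto
  also have "v \<bullet> (X *\<^sub>v (X\<^sup>T *\<^sub>v v)) = sq_norm (X\<^sup>T *\<^sub>v v)"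
    using X v by (intro scalar_prod_mult_mat_vec) auto
  finally show ?thesis using v by simp
qed

text \<open>The quadratic form of the matrix is \<open>|X\<^sup>T v|\<^sup>2 + l |v|\<^sup>2\<close>, so its kernel is trivial.\<close>

lemma det_shifted_gram: "Determinant.det (shifted_gram X l) \<noteq> 0"
proof
  assume "Determinant.det (shifted_gram X l) = 0"
  then obtain v where v: "v \<in> carrier_vec n" "v \<noteq> 0\<^sub>v n" "shifted_gram X l *\<^sub>v v = 0\<^sub>v n"
    using det_0_iff_vec_prod_zero[OF shifted_gram_carrier] by auto
  have "sq_norm (X\<^sup>T *\<^sub>v v) + l * (v \<bullet> v) = 0"
    using shifted_gram_energy[OF v(1)] v by simp
  moreover have "0 \<le> sq_norm (X\<^sup>T *\<^sub>v v)" "0 \<le> l * (v \<bullet> v)"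
    using l scalar_prod_self_nonneg[of v] scalar_prod_self_nonneg[of "X\<^sup>T *\<^sub>v v"] by simp_all
  ultimately have "v \<bullet> v = 0" using l by (auto simp: add_nonneg_eq_0_iff)
  with v scalar_prod_self_eq_0 show False by auto
qed

lemma residual_mat_inverse:
  "shifted_gram X l * residual_mat X l = l \<cdot>\<^sub>m 1\<^sub>m n" "residual_mat X l * shifted_gram X l = l \<cdot>\<^sub>m 1\<^sub>m n"
proof -
  note A = adj_mat[OF shifted_gram_carrier]
  note d = det_shifted_gram
  have "shifted_gram X l * residual_mat X l
      = (l / Determinant.det (shifted_gram X l)) \<cdot>\<^sub>m (shifted_gram X l * adj_mat (shifted_gram X l))"
    unfolding residual_mat_def by (rule mult_smult_distrib[OF shifted_gram_carrier A(1)])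
  then show "shifted_gram X l * residual_mat X l = l \<cdot>\<^sub>m 1\<^sub>m n"
    unfolding A(2) using d by (auto intro!: eq_matI)
  have "residual_mat X l * shifted_gram X l
      = (l / Determinant.det (shifted_gram X l)) \<cdot>\<^sub>m (adj_mat (shifted_gram X l) * shifted_gram X l)"
    unfolding residual_mat_def by (rule mult_smult_assoc_mat[OF A(1) shifted_gram_carrier])
  then show "residual_mat X l * shifted_gram X l = l \<cdot>\<^sub>m 1\<^sub>m n"
    unfolding A(3) using d by (auto intro!: eq_matI)
qed

lemma residual_mat_unique:
  assumes B: "B \<in> carrier_mat n n" "shifted_gram X l * B = l \<cdot>\<^sub>m 1\<^sub>m n"
  shows "B = residual_mat X l"
proof -
  note G = shifted_gram_carrier and R = residual_mat_carrier
  have "l \<cdot>\<^sub>m B = (residual_mat X l * shifted_gram X l) * B"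
    unfolding residual_mat_inverse using B by (simp add: mult_smult_assoc_mat[of _ n n _ n])
  also have "\<dots> = residual_mat X l * (shifted_gram X l * B)" by (rule assoc_mult_mat[OF R G B(1)])
  also have "\<dots> = l \<cdot>\<^sub>m residual_mat X l"
    unfolding B(2) using R by (simp add: mult_smult_distrib[of _ n n _ n])
  finally have eq: "l \<cdot>\<^sub>m B = l \<cdot>\<^sub>m residual_mat X l" .
  show ?thesis
  proof (rule eq_matI)
    fix i j assume ij: "i < dim_row (residual_mat X l)" "j < dim_col (residual_mat X l)"
    have "(l \<cdot>\<^sub>m B) $$ (i, j) = (l \<cdot>\<^sub>m residual_mat X l) $$ (i, j)" using eq by simp
    then show "B $$ (i, j) = residual_mat X l $$ (i, j)" using ij B(1) R l by auto
  qed (use B R in auto)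
qed

lemma residual_mat_sym: "(residual_mat X l)\<^sup>T = residual_mat X l"
proof (rule residual_mat_unique)
  note G = shifted_gram_carrier and R = residual_mat_carrier
  show "(residual_mat X l)\<^sup>T \<in> carrier_mat n n" using R by simp
  have tG: "(shifted_gram X l)\<^sup>T = shifted_gram X l"
    unfolding shifted_gram_def using X
    by (intro eq_matI) (auto simp: scalar_prod_def mult.commute)
  have "(residual_mat X l * shifted_gram X l)\<^sup>T = shifted_gram X l * (residual_mat X l)\<^sup>T"
    by (subst transpose_mult[OF R G]) (simp add: tG)
  also have "(residual_mat X l * shifted_gram X l)\<^sup>T = l \<cdot>\<^sub>m 1\<^sub>m n"
    unfolding residual_mat_inverse by (intro eq_matI) auto
  finally show "shifted_gram X l * (residual_mat X l)\<^sup>T = l \<cdot>\<^sub>m 1\<^sub>m n" ..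
qed

text \<open>The source of all norm bounds on the residual matrix: pair \<open>v = R w\<close> with the equation
  \<open>X X\<^sup>T v + l v = l w\<close>.\<close>

lemma residual_energy:
  assumes w: "w \<in> carrier_vec n"
  defines "v \<equiv> residual_mat X l *\<^sub>v w"
  shows "l * (v \<bullet> w) = sq_norm (X\<^sup>T *\<^sub>v v) + l * (v \<bullet> v)"
proof -
  have v: "v \<in> carrier_vec n" unfolding v_def using residual_mat_carrier w by auto
  have "shifted_gram X l *\<^sub>v v = (shifted_gram X l * residual_mat X l) *\<^sub>v w"
    unfolding v_def by (rule assoc_mult_mat_vec[symmetric, OF shifted_gram_carrier residual_mat_carrier w])
  also have "\<dots> = l \<cdot>\<^sub>v w" unfolding residual_mat_inverse using w by auto
  finally show ?thesis using shifted_gram_energy[OF v] v w by simp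
qed

text \<open>Young's inequality applied to the left side \<open>l (v \<bullet> w)\<close> of the energy identity, once with
  weight \<open>1/2\<close> and once with weight \<open>1\<close>.\<close>

lemma residual_contraction:
  assumes w: "w \<in> carrier_vec n"
  shows "sq_norm (residual_mat X l *\<^sub>v w) \<le> w \<bullet> w"
    "sq_norm (X\<^sup>T *\<^sub>v (residual_mat X l *\<^sub>v w)) \<le> l / 4 * (w \<bullet> w)"
proof -
  define v where "v = residual_mat X l *\<^sub>v w"
  have v: "v \<in> carrier_vec n" unfolding v_def using residual_mat_carrier w by auto
  note e = residual_energy[OF w, folded v_def]
  have "v \<bullet> w \<le> 1/2 * (v \<bullet> v) + (w \<bullet> w) / 2" using scalar_prod_le[OF v w, of "1/2"] by simp
  then have "l * (v \<bullet> w) \<le> l * (1/2 * (v \<bullet> v) + (w \<bullet> w) / 2)" using l by (intro mult_left_mono) auto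
  then have "l * (v \<bullet> v) \<le> l * (w \<bullet> w)"
    using e scalar_prod_self_nonneg[of "X\<^sup>T *\<^sub>v v"] by (simp add: algebra_simps)
  then show "v \<bullet> v \<le> w \<bullet> w" using l by simp
  have "v \<bullet> w \<le> v \<bullet> v + (w \<bullet> w) / 4" using scalar_prod_le[OF v w, of 1] by simp
  then have "l * (v \<bullet> w) \<le> l * (v \<bullet> v + (w \<bullet> w) / 4)" using l by (intro mult_left_mono) auto
  then show "sq_norm (X\<^sup>T *\<^sub>v v) \<le> l / 4 * (w \<bullet> w)"
    using e by (simp add: algebra_simps)
qed

text \<open>Here \<open>v \<bullet> (X b) = (X\<^sup>T v) \<bullet> b\<close>, and the weight \<open>1 / l\<close> in Young's inequality cancels the
  term \<open>|X\<^sup>T v|\<^sup>2\<close> of the energy identity. The bound does not depend on the singular values.\<close>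

lemma residual_design_contraction:
  assumes b: "b \<in> carrier_vec p"
  shows "sq_norm (residual_mat X l *\<^sub>v (X *\<^sub>v b)) \<le> l / 4 * (b \<bullet> b)"
proof -
  define w where "w = X *\<^sub>v b"
  have w: "w \<in> carrier_vec n" unfolding w_def using X b by auto
  define v where "v = residual_mat X l *\<^sub>v w"
  have v: "v \<in> carrier_vec n" unfolding v_def using residual_mat_carrier w by auto
  define z where "z = X\<^sup>T *\<^sub>v v"
  have z: "z \<in> carrier_vec p" unfolding z_def using X v by auto
  have "v \<bullet> w = z \<bullet> b" unfolding w_def z_def by (rule scalar_prod_mult_mat_vec[OF X b v])
  then have e: "l * (z \<bullet> b) = z \<bullet> z + l * (v \<bullet> v)"
    using residual_energy[OF w] by (simp add: v_def z_def)
  have "z \<bullet> b \<le> 1 / l * (z \<bullet> z) + (b \<bullet> b) / (4 * (1 / l))"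
    using l by (intro scalar_prod_le[OF z b]) auto
  then have "l * (z \<bullet> b) \<le> l * (1 / l * (z \<bullet> z) + (b \<bullet> b) / (4 * (1 / l)))"
    using l by (intro mult_left_mono) auto
  also have "\<dots> = z \<bullet> z + l * (l / 4 * (b \<bullet> b))" using l by (simp add: field_simps)
  finally have "l * (v \<bullet> v) \<le> l * (l / 4 * (b \<bullet> b))" using e by simp
  then show ?thesis using l unfolding v_def w_def by (rule mult_left_le_imp_le)
qed

text \<open>The bounds on \<open>R\<^sup>T R\<close> under which the noise term splits into an off-diagonal part of Frobenius norm
  \<open>O(sqrt n)\<close> and a diagonal part with weights in the unit interval.\<close>

lemma residual_gram_bounds:
  defines "H \<equiv> (residual_mat X l)\<^sup>T * residual_mat X l"
  shows "(\<Sum>i<n. \<Sum>j<n. (H $$ (i, j))\<^sup>2) \<le> real n"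
    "i < n \<Longrightarrow> 0 \<le> H $$ (i, i)" "i < n \<Longrightarrow> H $$ (i, i) \<le> 1"
proof -
  have b: "sq_norm (residual_mat X l *\<^sub>v w) \<le> 1 * (w \<bullet> w)" if "w \<in> carrier_vec n" for w
    using residual_contraction(1)[OF that] by simp
  have b': "sq_norm ((residual_mat X l)\<^sup>T *\<^sub>v w) \<le> 1 * (w \<bullet> w)"
    if "w \<in> carrier_vec n" for w unfolding residual_mat_sym using b that .
  note g = gram_bounds[OF residual_mat_carrier b b']
  show "(\<Sum>i<n. \<Sum>j<n. (H $$ (i, j))\<^sup>2) \<le> real n" using g(1) by (simp add: H_def del: index_mult_mat)
  show "i < n \<Longrightarrow> 0 \<le> H $$ (i, i)" "i < n \<Longrightarrow> H $$ (i, i) \<le> 1"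
    using g(2,3) by (simp_all add: H_def del: index_mult_mat)
qed

lemma residual_design_gram_bound:
  defines "A \<equiv> residual_mat X l * X"
  shows "(\<Sum>i<p. \<Sum>j<p. ((A\<^sup>T * A) $$ (i, j))\<^sup>2) \<le> real p * (l / 4)\<^sup>2"
proof (rule gram_bounds(1))
  note R = residual_mat_carrier
  show "A \<in> carrier_mat n p" using R X by (simp add: A_def)
  show "sq_norm (A *\<^sub>v v) \<le> l / 4 * (v \<bullet> v)" if v: "v \<in> carrier_vec p" for v
    using residual_design_contraction[OF v] assoc_mult_mat_vec[OF R X v] by (simp add: A_def)
  show "sq_norm (A\<^sup>T *\<^sub>v w) \<le> l / 4 * (w \<bullet> w)" if w: "w \<in> carrier_vec n" for w
  proof -
    have "A\<^sup>T *\<^sub>v w = X\<^sup>T *\<^sub>v (residual_mat X l *\<^sub>v w)"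
      unfolding A_def transpose_mult[OF R X] residual_mat_sym
      using R X w by (intro assoc_mult_mat_vec) auto
    then show ?thesis using residual_contraction(2)[OF w] by simp
  qed
qed (use l in simp)

text \<open>Only \<open>X X\<^sup>T\<close> enters.\<close>

lemma residual_mat_orthogonal_right:
  assumes U: "U \<in> orthogonal_group p"
  shows "residual_mat (X * U) l = residual_mat X l"
proof -
  have Uc: "U \<in> carrier_mat p p" using U by (rule orthogonal_group_carrier)
  have "(X * U) * (X * U)\<^sup>T = (X * U) * (U\<^sup>T * X\<^sup>T)"
    using X Uc by (simp add: transpose_mult)
  also have "\<dots> = X * (U * U\<^sup>T) * X\<^sup>T"
    using X Uc by (simp add: assoc_mult_mat[of _ n p _ p _ n] assoc_mult_mat[of _ p p _ p _ n] assoc_mult_mat[of _ n p _ p _ p])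
  also have "\<dots> = X * X\<^sup>T" using X orthogonal_group_transpose_mult(2)[OF U] by simp
  finally have "shifted_gram (X * U) l = shifted_gram X l" by (simp add: shifted_gram_def)
  then show ?thesis by (simp add: residual_mat_def)
qed

end

text \<open>The ridge residual \<open>e = y - X b\<close> satisfies \<open>X\<^sup>T e = l b\<close> by the normal equations, hence
  \<open>(X X\<^sup>T + l I) e = l y\<close>, that is \<open>e = R y\<close>.\<close>

lemma train_err_eq:
  assumes X: "X \<in> carrier_mat n p" and l: "0 < l" and y: "y \<in> carrier_vec n"
  shows "train_err X y l = sq_norm (residual_mat X l *\<^sub>v y) / real n"
proof -
  note G = shifted_gram_carrier[OF X l] and R = residual_mat_carrier[OF X l]
  let ?Xt = "X\<^sup>T"
  let ?K = "?Xt * X + l \<cdot>\<^sub>m 1\<^sub>m p"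
  have K: "?K \<in> carrier_mat p p" using X by auto
  have Xt: "?Xt \<in> carrier_mat p n" using X by simp
  have KX: "?K = shifted_gram ?Xt l" using X by (simp add: shifted_gram_def)
  have Kv: "?K *\<^sub>v b = ?Xt *\<^sub>v (X *\<^sub>v b) + l \<cdot>\<^sub>v b" if b: "b \<in> carrier_vec p" for b
    unfolding KX using shifted_gram_mult_vec[OF Xt l b] by simp
  have "Determinant.det ?K \<noteq> 0" unfolding KX by (rule det_shifted_gram[OF Xt l])
  then have "?K \<in> Units (ring_mat TYPE(real) p ())" by (rule det_non_zero_imp_unit[OF K])
  then obtain B where mi: "mat_inverse ?K = Some B"
    using mat_inverse(1)[OF K, where b = "()"] by (cases "mat_inverse ?K") auto
  then have B: "?K * B = 1\<^sub>m p" "B \<in> carrier_mat p p" using mat_inverse(2)[OF K] by auto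
  define b where "b = B *\<^sub>v (?Xt *\<^sub>v y)"
  have b: "b \<in> carrier_vec p" unfolding b_def using B X y by auto
  have "?K *\<^sub>v b = (?K * B) *\<^sub>v (?Xt *\<^sub>v y)"
    unfolding b_def using K B X y by (intro assoc_mult_mat_vec[symmetric]) auto
  also have "\<dots> = ?Xt *\<^sub>v y" unfolding B(1) using X y by auto
  finally have Kb: "?K *\<^sub>v b = ?Xt *\<^sub>v y" .
  have ridge: "ridge X y l = b" unfolding ridge_def b_def using mi X by simp
  define e where "e = y - X *\<^sub>v b"
  have e: "e \<in> carrier_vec n" unfolding e_def using X y b by auto
  have Xe: "?Xt *\<^sub>v e = l \<cdot>\<^sub>v b"
  proof -
    have "?Xt *\<^sub>v e = ?Xt *\<^sub>v y - ?Xt *\<^sub>v (X *\<^sub>v b)"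
      unfolding e_def using X y b by (intro mult_minus_distrib_mat_vec) auto
    also have "\<dots> = (?Xt *\<^sub>v (X *\<^sub>v b) + l \<cdot>\<^sub>v b) - ?Xt *\<^sub>v (X *\<^sub>v b)"
      unfolding Kb[symmetric] Kv[OF b] ..
    also have "\<dots> = l \<cdot>\<^sub>v b" using X b by (intro eq_vecI) auto
    finally show ?thesis .
  qed
  have "shifted_gram X l *\<^sub>v e = X *\<^sub>v (l \<cdot>\<^sub>v b) + l \<cdot>\<^sub>v e" unfolding shifted_gram_mult_vec[OF X l e] Xe ..
  also have "\<dots> = l \<cdot>\<^sub>v y"
    using X b y by (intro eq_vecI) (auto simp: e_def algebra_simps)
  finally have Ge: "shifted_gram X l *\<^sub>v e = l \<cdot>\<^sub>v y" .
  have "l \<cdot>\<^sub>v e = (residual_mat X l * shifted_gram X l) *\<^sub>v e"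
    unfolding residual_mat_inverse[OF X l] using e by auto
  also have "\<dots> = residual_mat X l *\<^sub>v (l \<cdot>\<^sub>v y)" using assoc_mult_mat_vec[OF R G e] Ge by simp
  also have "\<dots> = l \<cdot>\<^sub>v (residual_mat X l *\<^sub>v y)" using R y by (simp add: mult_mat_vec)
  finally have "l \<cdot>\<^sub>v e = l \<cdot>\<^sub>v (residual_mat X l *\<^sub>v y)" .
  then have "(1 / l) \<cdot>\<^sub>v (l \<cdot>\<^sub>v e) = (1 / l) \<cdot>\<^sub>v (l \<cdot>\<^sub>v (residual_mat X l *\<^sub>v y))" by simp
  then have "e = residual_mat X l *\<^sub>v y" using l by (simp add: smult_smult_assoc)
  then show ?thesis
    using X scalar_prod_self_nonneg[of e] by (simp add: train_err_def ridge l2_norm_vec_def flip: e_def)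
qed

section \<open>Singular values and the coefficients of the linear system\<close>

lemma deriv_v_fun:
  assumes l: "0 < l"
  shows "deriv (v_fun D) (- l) = (\<Sum>i<dim_row D. 1 / ((diag_entry D i)\<^sup>2 + l)\<^sup>2) / real (dim_row D)"
proof (rule DERIV_imp_deriv)
  have pos: "(diag_entry D i)\<^sup>2 + l \<noteq> 0" for i using l by (metis add_nonneg_pos less_irrefl zero_le_power2)
  show "(v_fun D has_real_derivative (\<Sum>i<dim_row D. 1 / ((diag_entry D i)\<^sup>2 + l)\<^sup>2) / real (dim_row D)) (at (- l))"
    unfolding v_fun_def
    by (rule DERIV_cdivide, rule DERIV_sum)
      (use pos in \<open>auto intro!: derivative_eq_intros simp: power2_eq_square\<close>)
qed

lemma coef_b_eq:
  assumes l: "0 < l" and D: "D \<in> carrier_mat n p"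
  shows "coef_b D l = (\<Sum>i<n. (l / ((diag_entry D i)\<^sup>2 + l))\<^sup>2) / real n"
  using D unfolding coef_b_def deriv_v_fun[OF l]
  by (simp add: power_divide sum_distrib_left)

text \<open>The difference \<open>1 / (d\<^sup>2 + l) - l / (d\<^sup>2 + l)\<^sup>2\<close> equals \<open>d\<^sup>2 / (d\<^sup>2 + l)\<^sup>2\<close>.\<close>

lemma coef_a_eq:
  assumes l: "0 < l" and D: "D \<in> carrier_mat n p" and n: "0 < n"
  shows "coef_a D l = (\<Sum>i<n. (l * diag_entry D i / ((diag_entry D i)\<^sup>2 + l))\<^sup>2) / real p"
proof -
  let ?d = "diag_entry D"
  have pos: "(?d i)\<^sup>2 + l \<noteq> 0" for i using l by (metis add_nonneg_pos less_irrefl zero_le_power2)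
  have "v_fun D (- l) - l * deriv (v_fun D) (- l)
      = (\<Sum>i<n. 1 / ((?d i)\<^sup>2 + l) - l * (1 / ((?d i)\<^sup>2 + l)\<^sup>2)) / real n"
    using D unfolding deriv_v_fun[OF l] v_fun_def
    by (simp add: sum_subtractf sum_distrib_left diff_divide_distrib)
  also have "(\<Sum>i<n. 1 / ((?d i)\<^sup>2 + l) - l * (1 / ((?d i)\<^sup>2 + l)\<^sup>2)) = (\<Sum>i<n. (?d i / ((?d i)\<^sup>2 + l))\<^sup>2)"
  proof (rule sum.cong)
    fix i
    have "1 / x - l * (1 / x\<^sup>2) = (x - l) / x\<^sup>2" if "x \<noteq> 0" for x :: real
      using that by (simp add: field_simps power2_eq_square)
    from this[OF pos[of i]] show "1 / ((?d i)\<^sup>2 + l) - l * (1 / ((?d i)\<^sup>2 + l)\<^sup>2) = (?d i / ((?d i)\<^sup>2 + l))\<^sup>2"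
      by (simp add: power_divide)
  qed simp
  finally have "coef_a D l = l\<^sup>2 * (\<Sum>i<n. (?d i / ((?d i)\<^sup>2 + l))\<^sup>2) / real p"
    using D n by (simp add: coef_a_def)
  then show ?thesis by (simp add: sum_distrib_left power_divide power_mult_distrib)
qed

lemma diagonal_mat_entry:
  assumes "D \<in> carrier_mat n p" "diagonal_mat D" "i < n" "j < p"
  shows "D $$ (i, j) = (if i = j then diag_entry D i else 0)"
  using assms by (auto simp: diagonal_mat_def diag_entry_def)

text \<open>In the left singular basis \<open>X X\<^sup>T + l I\<close> is diagonal with entries \<open>d\<^sub>i\<^sup>2 + l\<close>.\<close>

lemma svd_residual:
  assumes svd: "is_svd n p X Q D V" and l: "0 < l"
  defines "E \<equiv> Matrix.mat n n (\<lambda>(i, j). if i = j then l / ((diag_entry D i)\<^sup>2 + l) else 0)"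
  shows "residual_mat X l = Q\<^sup>T * E * Q"
proof -
  have QO: "Q \<in> orthogonal_group n" and VO: "V \<in> orthogonal_group p"
    and D: "D \<in> carrier_mat n p" and diag: "diagonal_mat D" and X: "X = Q\<^sup>T * D * V"
    using svd by (auto simp: is_svd_def)
  have Q: "Q \<in> carrier_mat n n" and V: "V \<in> carrier_mat p p"
    using QO VO by (auto intro: orthogonal_group_carrier)
  note QQ = orthogonal_group_transpose_mult[OF QO] and VV = orthogonal_group_transpose_mult[OF VO]
  have Xc: "X \<in> carrier_mat n p" unfolding X using Q D V by auto
  have E: "E \<in> carrier_mat n n" by (simp add: E_def)
  define F where "F = D * D\<^sup>T + l \<cdot>\<^sub>m 1\<^sub>m n"
  have F: "F \<in> carrier_mat n n" using D by (auto simp: F_def)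
  let ?Qt = "Q\<^sup>T" and ?Vt = "V\<^sup>T" and ?Dt = "D\<^sup>T"
  have "X * X\<^sup>T = ?Qt * D * V * (?Vt * (?Dt * Q))"
    unfolding X using Q D V by (simp add: transpose_mult[of _ n p _ p] transpose_mult[of _ n n _ p])
  also have "\<dots> = ?Qt * D * (V * ?Vt) * (?Dt * Q)"
    using Q D V by (simp add: assoc_mult_mat[of _ n p _ p _ n] assoc_mult_mat[of _ n n _ p _ n]
      assoc_mult_mat[of _ n n _ p _ p] assoc_mult_mat[of _ n p _ p _ p] assoc_mult_mat[of _ p p _ p _ n])
  also have "\<dots> = ?Qt * (D * ?Dt) * Q"
    unfolding VV using Q D by (simp add: assoc_mult_mat[of _ n p _ n _ n] assoc_mult_mat[of _ n n _ p _ n]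
      assoc_mult_mat[of _ n n _ n _ n])
  finally have XX: "X * X\<^sup>T = ?Qt * (D * ?Dt) * Q" .
  have lQ: "l \<cdot>\<^sub>m 1\<^sub>m n = ?Qt * (l \<cdot>\<^sub>m 1\<^sub>m n) * Q"
    using Q QQ(1) by (simp add: mult_smult_distrib[of _ n n _ n] mult_smult_assoc_mat[of _ n n _ n])
  have "shifted_gram X l = ?Qt * (D * ?Dt) * Q + ?Qt * (l \<cdot>\<^sub>m 1\<^sub>m n) * Q"
    using Xc lQ by (simp add: shifted_gram_def XX)
  also have "\<dots> = ?Qt * F * Q"
    unfolding F_def using Q D
    by (subst mult_add_distrib_mat[of _ n n _ n]) (auto simp: add_mult_distrib_mat[of _ n n _ _ n])
  finally have G: "shifted_gram X l = ?Qt * F * Q" .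
  have FE: "F * E = l \<cdot>\<^sub>m 1\<^sub>m n"
  proof (rule eq_matI)
    fix i j assume "i < dim_row (l \<cdot>\<^sub>m 1\<^sub>m n :: real mat)" "j < dim_col (l \<cdot>\<^sub>m 1\<^sub>m n :: real mat)"
    then have ij: "i < n" "j < n" by auto
    have pos: "(diag_entry D i)\<^sup>2 + l \<noteq> 0" for i using l by (metis add_nonneg_pos less_irrefl zero_le_power2)
    have Fe: "F $$ (i, k) = (if i = k then (diag_entry D i)\<^sup>2 + l else 0)" if k: "k < n" for k
    proof -
      have "(D * ?Dt) $$ (i, k) = (\<Sum>m<p. D $$ (i, m) * D $$ (k, m))"
        using D ij k by (simp add: scalar_prod_def atLeast0LessThan)
      also have "\<dots> = (\<Sum>m<p. if m = i then (if i = k then (diag_entry D i)\<^sup>2 else 0) else 0)"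
        using ij k diagonal_mat_entry[OF D diag] by (intro sum.cong) (auto simp: power2_eq_square)
      also have "\<dots> = (if i = k then (diag_entry D i)\<^sup>2 else 0)"
        using D by (auto simp: diag_entry_def)
      finally show ?thesis using D ij k by (simp add: F_def del: index_mult_mat(1))
    qed
    have "(F * E) $$ (i, j) = (\<Sum>k<n. F $$ (i, k) * E $$ (k, j))"
      using F E ij by (simp add: scalar_prod_def atLeast0LessThan)
    also have "\<dots> = (\<Sum>k<n. if k = i then (if i = j then l else 0) else 0)"
      using ij Fe pos by (intro sum.cong) (auto simp: E_def)
    finally show "(F * E) $$ (i, j) = (l \<cdot>\<^sub>m 1\<^sub>m n) $$ (i, j)" using ij by simp
  qed (use F E in auto)
  have K: "?Qt * E * Q \<in> carrier_mat n n" using Q E by auto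
  have "shifted_gram X l * (?Qt * E * Q) = ?Qt * F * (Q * ?Qt) * (E * Q)"
    unfolding G using Q E F by (simp add: assoc_mult_mat[of _ n n _ n _ n])
  also have "\<dots> = ?Qt * (F * E) * Q"
    unfolding QQ using Q E F by (simp add: assoc_mult_mat[of _ n n _ n _ n])
  also have "\<dots> = l \<cdot>\<^sub>m 1\<^sub>m n" unfolding FE using lQ by simp
  finally show ?thesis using residual_mat_unique[OF Xc l K] by simp
qed

text \<open>Frobenius norms are invariant under orthogonal factors, so both reduce to sums over the
  singular values.\<close>

lemma svd_coefficients:
  assumes svd: "is_svd n p X Q D V" and l: "0 < l" and n: "0 < n"
  shows "frob2 (residual_mat X l) = real n * coef_b D l"
    "0 < p \<Longrightarrow> frob2 (residual_mat X l * X) = real p * coef_a D l"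
proof -
  have QO: "Q \<in> orthogonal_group n" and VO: "V \<in> orthogonal_group p"
    and D: "D \<in> carrier_mat n p" and diag: "diagonal_mat D" and X: "X = Q\<^sup>T * D * V"
    using svd by (auto simp: is_svd_def)
  have Q: "Q \<in> carrier_mat n n" and V: "V \<in> carrier_mat p p"
    using QO VO by (auto intro: orthogonal_group_carrier)
  have Xc: "X \<in> carrier_mat n p" unfolding X using Q D V by auto
  define E where "E = Matrix.mat n n (\<lambda>(i, j). if i = j then l / ((diag_entry D i)\<^sup>2 + l) else 0)"
  have E: "E \<in> carrier_mat n n" by (simp add: E_def)
  have R: "residual_mat X l = Q\<^sup>T * E * Q"
    unfolding E_def by (rule svd_residual[OF svd l])
  have "frob2 (residual_mat X l) = frob2 E"
    unfolding R using Q E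
    by (simp add: frob2_orthogonal_right[OF QO, of _ n] frob2_orthogonal_left[OF orthogonal_group_transpose[OF QO], of _ n])
  also have "\<dots> = (\<Sum>i<n. (l / ((diag_entry D i)\<^sup>2 + l))\<^sup>2)"
  proof -
    have "frob2 E = (\<Sum>i<n. \<Sum>j<n. if j = i then (l / ((diag_entry D i)\<^sup>2 + l))\<^sup>2 else 0)"
    proof -
      have "(\<Sum>j<n. (E $$ (i, j))\<^sup>2) = (\<Sum>j<n. if j = i then (l / ((diag_entry D i)\<^sup>2 + l))\<^sup>2 else 0)"
        if "i < n" for i using that by (intro sum.cong) (auto simp: E_def)
      then show ?thesis using E by (simp add: frob2_def)
    qed
    then show ?thesis by simp
  qed
  finally show "frob2 (residual_mat X l) = real n * coef_b D l"
    using n by (simp add: coef_b_eq[OF l D])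
  assume p: "0 < p"
  have "residual_mat X l * X = (Q\<^sup>T * E * Q) * (Q\<^sup>T * D * V)"
    by (subst R) (simp only: X)
  also have "\<dots> = Q\<^sup>T * E * (Q * Q\<^sup>T) * (D * V)"
    using Q E D V
    by (simp add: assoc_mult_mat[of _ n n _ n _ n] assoc_mult_mat[of _ n n _ n _ p] assoc_mult_mat[of _ n n _ p _ p])
  also have "\<dots> = Q\<^sup>T * (E * D) * V"
    unfolding orthogonal_group_transpose_mult[OF QO] using Q E D V
    by (simp add: assoc_mult_mat[of _ n n _ n _ p] assoc_mult_mat[of _ n n _ p _ p])
  finally have "frob2 (residual_mat X l * X) = frob2 (E * D)"
    using Q E D by (simp add: frob2_orthogonal_right[OF VO, of _ n] frob2_orthogonal_left[OF orthogonal_group_transpose[OF QO], of _ p])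
  also have "\<dots> = (\<Sum>i<n. (l * diag_entry D i / ((diag_entry D i)\<^sup>2 + l))\<^sup>2)"
  proof -
    have entry: "(E * D) $$ (i, j) = (if i = j then l * diag_entry D i / ((diag_entry D i)\<^sup>2 + l) else 0)"
      if ij: "i < n" "j < p" for i j
    proof -
      have "(E * D) $$ (i, j) = (\<Sum>k<n. E $$ (i, k) * D $$ (k, j))"
        using E D ij by (simp add: scalar_prod_def atLeast0LessThan)
      also have "\<dots> = (\<Sum>k<n. if k = i then l / ((diag_entry D i)\<^sup>2 + l) * D $$ (i, j) else 0)"
        using ij by (intro sum.cong) (auto simp: E_def)
      finally show ?thesis using ij diagonal_mat_entry[OF D diag ij] by auto
    qed
    have "frob2 (E * D) = (\<Sum>i<n. \<Sum>j<p. ((E * D) $$ (i, j))\<^sup>2)"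
      unfolding frob2_def using E D by simp
    also have "\<dots> = (\<Sum>i<n. \<Sum>j<p. if j = i then (l * diag_entry D i / ((diag_entry D i)\<^sup>2 + l))\<^sup>2 else 0)"
      by (intro sum.cong) (auto simp: entry simp del: index_mult_mat)
    also have "\<dots> = (\<Sum>i<n. (l * diag_entry D i / ((diag_entry D i)\<^sup>2 + l))\<^sup>2)"
      using D by (intro sum.cong) (auto simp: diag_entry_def)
    finally show ?thesis .
  qed
  finally show "frob2 (residual_mat X l * X) = real p * coef_a D l"
    using p by (simp add: coef_a_eq[OF l D n])
qed

section \<open>Measurability of matrix functions\<close>

text \<open>Reduces measurability into the matrix space to that of the entries; all further measurability
  statements are closure properties of this kind.\<close>

lemma measurable_mat_borel_iff:
  "f \<in> N \<rightarrow>\<^sub>M mat_borel n p \<longleftrightarrow> (\<forall>x\<in>space N. f x \<in> carrier_mat n p) \<and>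
     (\<forall>i<n. \<forall>j<p. (\<lambda>x. f x $$ (i, j)) \<in> borel_measurable N)" (is "?L = ?R")
proof
  let ?r = "\<lambda>A :: real mat. \<lambda>ij\<in>{..<n} \<times> {..<p}. A $$ ij"
  assume f: ?L
  have "?r \<in> mat_borel n p \<rightarrow>\<^sub>M (\<Pi>\<^sub>M ij\<in>{..<n} \<times> {..<p}. borel)"
    unfolding mat_borel_def by (rule measurable_vimage_algebra1) (auto simp: space_PiM)
  then have r: "(\<lambda>x. ?r (f x)) \<in> N \<rightarrow>\<^sub>M (\<Pi>\<^sub>M ij\<in>{..<n} \<times> {..<p}. borel)"
    by (rule measurable_compose[OF f])
  have "(\<lambda>x. f x $$ (i, j)) \<in> borel_measurable N" if "i < n" "j < p" for i j
    using measurable_compose[OF r measurable_component_singleton[of "(i, j)"]] that by simp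
  moreover have "f x \<in> carrier_mat n p" if "x \<in> space N" for x
    using measurable_space[OF f that] by (simp add: space_mat_borel)
  ultimately show ?R by blast
next
  assume ?R
  then show ?L
    unfolding mat_borel_def by (intro measurable_vimage_algebra2 measurable_restrict) auto
qed

lemma measurable_vec_borel_iff:
  "f \<in> N \<rightarrow>\<^sub>M vec_borel n \<longleftrightarrow> (\<forall>x\<in>space N. f x \<in> carrier_vec n) \<and>
     (\<forall>i<n. (\<lambda>x. f x $ i) \<in> borel_measurable N)" (is "?L = ?R")
proof
  let ?r = "\<lambda>v :: real Matrix.vec. \<lambda>i\<in>{..<n}. v $ i"
  assume f: ?L
  have "?r \<in> vec_borel n \<rightarrow>\<^sub>M (\<Pi>\<^sub>M i\<in>{..<n}. borel)"
    unfolding vec_borel_def by (rule measurable_vimage_algebra1) (auto simp: space_PiM)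
  then have r: "(\<lambda>x. ?r (f x)) \<in> N \<rightarrow>\<^sub>M (\<Pi>\<^sub>M i\<in>{..<n}. borel)"
    by (rule measurable_compose[OF f])
  have "(\<lambda>x. f x $ i) \<in> borel_measurable N" if "i < n" for i
    using measurable_compose[OF r measurable_component_singleton[of i]] that by simp
  moreover have "f x \<in> carrier_vec n" if "x \<in> space N" for x
    using measurable_space[OF f that] by (simp add: space_vec_borel)
  ultimately show ?R by blast
next
  assume ?R
  then show ?L
    unfolding vec_borel_def by (intro measurable_vimage_algebra2 measurable_restrict) auto
qed

lemma measurable_mat_mult:
  assumes "f \<in> N \<rightarrow>\<^sub>M mat_borel n m" "g \<in> N \<rightarrow>\<^sub>M mat_borel m p"
  shows "(\<lambda>x. f x * g x) \<in> N \<rightarrow>\<^sub>M mat_borel n p"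
  unfolding measurable_mat_borel_iff
proof (intro conjI ballI allI impI)
  note f = assms(1)[unfolded measurable_mat_borel_iff] and g = assms(2)[unfolded measurable_mat_borel_iff]
  show c: "f x * g x \<in> carrier_mat n p" if "x \<in> space N" for x using f g that by (meson mult_carrier_mat)
  fix i j assume ij: "i < n" "j < p"
  have "(\<lambda>x. \<Sum>k<m. f x $$ (i, k) * g x $$ (k, j)) \<in> borel_measurable N"
    using f g ij by (intro borel_measurable_sum borel_measurable_times) auto
  also have "?this \<longleftrightarrow> (\<lambda>x. (f x * g x) $$ (i, j)) \<in> borel_measurable N"
  proof (rule measurable_cong)
    fix x assume "x \<in> space N"
    then have "f x \<in> carrier_mat n m" "g x \<in> carrier_mat m p" using f g by auto
    then show "(\<Sum>k<m. f x $$ (i, k) * g x $$ (k, j)) = (f x * g x) $$ (i, j)"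
      using ij by (simp add: scalar_prod_def atLeast0LessThan)
  qed
  finally show "(\<lambda>x. (f x * g x) $$ (i, j)) \<in> borel_measurable N" .
qed

lemma measurable_mult_mat_vec:
  assumes "f \<in> N \<rightarrow>\<^sub>M mat_borel n m" "v \<in> N \<rightarrow>\<^sub>M vec_borel m"
  shows "(\<lambda>x. f x *\<^sub>v v x) \<in> N \<rightarrow>\<^sub>M vec_borel n"
  unfolding measurable_vec_borel_iff
proof (intro conjI ballI allI impI)
  note f = assms(1)[unfolded measurable_mat_borel_iff] and v = assms(2)[unfolded measurable_vec_borel_iff]
  show c: "f x *\<^sub>v v x \<in> carrier_vec n" if "x \<in> space N" for x using f v that by (meson mult_mat_vec_carrier)
  fix i assume i: "i < n"
  have "(\<lambda>x. \<Sum>k<m. f x $$ (i, k) * v x $ k) \<in> borel_measurable N"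
    using f v i by (intro borel_measurable_sum borel_measurable_times) auto
  also have "?this \<longleftrightarrow> (\<lambda>x. (f x *\<^sub>v v x) $ i) \<in> borel_measurable N"
    using f v i by (intro measurable_cong mult_mat_vec_entry[symmetric]) auto
  finally show "(\<lambda>x. (f x *\<^sub>v v x) $ i) \<in> borel_measurable N" .
qed

lemma measurable_scalar_prod:
  assumes "u \<in> N \<rightarrow>\<^sub>M vec_borel n" "v \<in> N \<rightarrow>\<^sub>M vec_borel n"
  shows "(\<lambda>x. u x \<bullet> v x) \<in> borel_measurable N"
proof -
  note u = assms(1)[unfolded measurable_vec_borel_iff] and v = assms(2)[unfolded measurable_vec_borel_iff]
  have "(\<lambda>x. \<Sum>i<n. u x $ i * v x $ i) \<in> borel_measurable N"
    using u v by (intro borel_measurable_sum borel_measurable_times) auto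
  also have "?this \<longleftrightarrow> (\<lambda>x. u x \<bullet> v x) \<in> borel_measurable N"
    using u v by (intro measurable_cong scalar_prod_eq_sum[symmetric]) auto
  finally show ?thesis .
qed

lemma measurable_frob2:
  assumes "f \<in> N \<rightarrow>\<^sub>M mat_borel n p"
  shows "(\<lambda>x. frob2 (f x)) \<in> borel_measurable N"
proof -
  note f = assms[unfolded measurable_mat_borel_iff]
  have "(\<lambda>x. \<Sum>i<n. \<Sum>j<p. (f x $$ (i, j))\<^sup>2) \<in> borel_measurable N"
    using f by (intro borel_measurable_sum borel_measurable_power) auto
  also have "?this \<longleftrightarrow> (\<lambda>x. frob2 (f x)) \<in> borel_measurable N"
    using f by (intro measurable_cong) (auto simp: frob2_def)
  finally show ?thesis .
qed

lemma measurable_det: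
  assumes "f \<in> N \<rightarrow>\<^sub>M mat_borel n n"
  shows "(\<lambda>x. Determinant.det (f x)) \<in> borel_measurable N"
proof -
  note f = assms[unfolded measurable_mat_borel_iff]
  have "(\<lambda>x. \<Sum>\<pi> | \<pi> permutes {0..<n}. signof \<pi> * (\<Prod>i = 0..<n. f x $$ (i, \<pi> i))) \<in> borel_measurable N"
  proof (intro borel_measurable_sum borel_measurable_times borel_measurable_const borel_measurable_prod)
    fix \<pi> i assume "\<pi> \<in> {\<pi>. \<pi> permutes {0..<n}}" "i \<in> {0..<n}"
    then have "\<pi> i < n" "i < n" using permutes_in_image[of \<pi> "{0..<n}" i] by auto
    then show "(\<lambda>x. f x $$ (i, \<pi> i)) \<in> borel_measurable N" using f by auto
  qed
  also have "?this \<longleftrightarrow> (\<lambda>x. Determinant.det (f x)) \<in> borel_measurable N"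
    using f by (intro measurable_cong det_def'[symmetric]) auto
  finally show ?thesis .
qed

lemma measurable_cofactor:
  assumes "f \<in> N \<rightarrow>\<^sub>M mat_borel n n" "i < n" "j < n"
  shows "(\<lambda>x. cofactor (f x) i j) \<in> borel_measurable N"
proof -
  note f = assms(1)[unfolded measurable_mat_borel_iff]
  have "(\<lambda>x. mat_delete (f x) i j) \<in> N \<rightarrow>\<^sub>M mat_borel (n - 1) (n - 1)"
    unfolding measurable_mat_borel_iff
  proof (intro conjI ballI allI impI)
    show "mat_delete (f x) i j \<in> carrier_mat (n - 1) (n - 1)" if "x \<in> space N" for x
      using f that by (intro mat_delete_carrier) auto
    fix i' j' assume *: "i' < n - 1" "j' < n - 1"
    have "(\<lambda>x. f x $$ (if i' < i then i' else Suc i', if j' < j then j' else Suc j')) \<in> borel_measurable N"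
      using f * by auto
    also have "?this \<longleftrightarrow> (\<lambda>x. mat_delete (f x) i j $$ (i', j')) \<in> borel_measurable N"
    proof (rule measurable_cong)
      fix x assume "x \<in> space N"
      then have "f x \<in> carrier_mat n n" using f by auto
      then show "f x $$ (if i' < i then i' else Suc i', if j' < j then j' else Suc j') = mat_delete (f x) i j $$ (i', j')"
        using * by (auto simp: mat_delete_def)
    qed
    finally show "(\<lambda>x. mat_delete (f x) i j $$ (i', j')) \<in> borel_measurable N" .
  qed
  from measurable_det[OF this] show ?thesis unfolding cofactor_def by simp
qed

lemma measurable_residual_mat:
  assumes "f \<in> N \<rightarrow>\<^sub>M mat_borel n p"
  shows "(\<lambda>x. residual_mat (f x) l) \<in> N \<rightarrow>\<^sub>M mat_borel n n"
proof -
  note f = assms[unfolded measurable_mat_borel_iff]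
  have G: "(\<lambda>x. shifted_gram (f x) l) \<in> N \<rightarrow>\<^sub>M mat_borel n n"
    unfolding measurable_mat_borel_iff
  proof (intro conjI ballI allI impI)
    show "shifted_gram (f x) l \<in> carrier_mat n n" if "x \<in> space N" for x
      using f that by (auto simp: shifted_gram_def)
    fix i j assume ij: "i < n" "j < n"
    have "(\<lambda>x. (\<Sum>k<p. f x $$ (i, k) * f x $$ (j, k)) + (if i = j then l else 0)) \<in> borel_measurable N"
      using f ij by (intro borel_measurable_add borel_measurable_sum borel_measurable_times borel_measurable_const) auto
    also have "?this \<longleftrightarrow> (\<lambda>x. shifted_gram (f x) l $$ (i, j)) \<in> borel_measurable N"
    proof (rule measurable_cong)
      fix x assume "x \<in> space N"
      then have "f x \<in> carrier_mat n p" using f by auto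
      then show "(\<Sum>k<p. f x $$ (i, k) * f x $$ (j, k)) + (if i = j then l else 0) = shifted_gram (f x) l $$ (i, j)"
        using ij by (simp add: shifted_gram_def scalar_prod_def atLeast0LessThan)
    qed
    finally show "(\<lambda>x. shifted_gram (f x) l $$ (i, j)) \<in> borel_measurable N" .
  qed
  note g = G[unfolded measurable_mat_borel_iff]
  show ?thesis
    unfolding measurable_mat_borel_iff
  proof (intro conjI ballI allI impI)
    show "residual_mat (f x) l \<in> carrier_mat n n" if "x \<in> space N" for x
      unfolding residual_mat_def using g that by (intro smult_carrier_mat adj_mat(1)) auto
    fix i j assume ij: "i < n" "j < n"
    have "(\<lambda>x. l / Determinant.det (shifted_gram (f x) l) * cofactor (shifted_gram (f x) l) j i) \<in> borel_measurable N"
      by (intro borel_measurable_times borel_measurable_divide borel_measurable_const measurable_det[OF G]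
        measurable_cofactor[OF G] ij)
    also have "?this \<longleftrightarrow> (\<lambda>x. residual_mat (f x) l $$ (i, j)) \<in> borel_measurable N"
    proof (rule measurable_cong)
      fix x assume "x \<in> space N"
      then have "shifted_gram (f x) l \<in> carrier_mat n n" using g by auto
      then show "l / Determinant.det (shifted_gram (f x) l) * cofactor (shifted_gram (f x) l) j i
          = residual_mat (f x) l $$ (i, j)"
        using ij by (auto simp: residual_mat_def adj_mat_def)
    qed
    finally show "(\<lambda>x. residual_mat (f x) l $$ (i, j)) \<in> borel_measurable N" .
  qed
qed

lemma measurable_residual_gram_diag:
  assumes f: "f \<in> N \<rightarrow>\<^sub>M mat_borel n p" and i: "i < n"
  shows "(\<lambda>z. (transpose_mat (residual_mat (f z) l) * residual_mat (f z) l) $$ (i, i)) \<in> borel_measurable N"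
proof -
  note r = measurable_residual_mat[OF f, of l, unfolded measurable_mat_borel_iff]
  have "(\<lambda>z. \<Sum>k<n. residual_mat (f z) l $$ (k, i) * residual_mat (f z) l $$ (k, i)) \<in> borel_measurable N"
    using r i by (intro borel_measurable_sum borel_measurable_times) auto
  also have "?this \<longleftrightarrow> ?thesis"
    using r i by (intro measurable_cong gram_entry[symmetric]) auto
  finally show ?thesis .
qed

lemma measurable_noise_deviation:
  assumes f: "f \<in> N \<rightarrow>\<^sub>M mat_borel n p" and g: "g \<in> N \<rightarrow>\<^sub>M vec_borel n"
  shows "(\<lambda>z. sq_norm (residual_mat (f z) l *\<^sub>v g z)
      - (\<Sum>i<n. ((residual_mat (f z) l)\<^sup>T * residual_mat (f z) l) $$ (i, i) * (g z $ i)\<^sup>2)) \<in> borel_measurable N"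
    "(\<lambda>z. \<Sum>i<n. ((residual_mat (f z) l)\<^sup>T * residual_mat (f z) l) $$ (i, i) * ((g z $ i)\<^sup>2 - \<tau>))
      \<in> borel_measurable N"
proof -
  note Rg = measurable_mult_mat_vec[OF measurable_residual_mat[OF f, of l] g]
  have gi: "(\<lambda>z. g z $ i) \<in> borel_measurable N" if "i < n" for i
    using g that unfolding measurable_vec_borel_iff by blast
  note m = borel_measurable_diff borel_measurable_sum borel_measurable_times borel_measurable_power
    measurable_scalar_prod[OF Rg Rg] measurable_residual_gram_diag[OF f] gi
  show "(\<lambda>z. sq_norm (residual_mat (f z) l *\<^sub>v g z)
      - (\<Sum>i<n. ((residual_mat (f z) l)\<^sup>T * residual_mat (f z) l) $$ (i, i) * (g z $ i)\<^sup>2)) \<in> borel_measurable N"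
    by (intro m) auto
  show "(\<lambda>z. \<Sum>i<n. ((residual_mat (f z) l)\<^sup>T * residual_mat (f z) l) $$ (i, i) * ((g z $ i)\<^sup>2 - \<tau>))
      \<in> borel_measurable N"
    by (intro m borel_measurable_const) auto
qed

section \<open>Integration over independent variables\<close>

lemma indep_rv_distr:
  assumes M: "prob_space M" and ind: "indep_rv M S X T Y"
  shows "distr M (S \<Otimes>\<^sub>M T) (\<lambda>\<omega>. (X \<omega>, Y \<omega>)) = distr M S X \<Otimes>\<^sub>M distr M T Y"
proof -
  interpret prob_space M by (rule M)
  have X[measurable]: "X \<in> M \<rightarrow>\<^sub>M S" and Y[measurable]: "Y \<in> M \<rightarrow>\<^sub>M T"
    and i: "indep_set {X -` A \<inter> space M | A. A \<in> sets S} {Y -` B \<inter> space M | B. B \<in> sets T}"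
    using ind by (auto simp: indep_rv_def)
  interpret X: prob_space "distr M S X" by (rule prob_space_distr) simp
  interpret Y: prob_space "distr M T Y" by (rule prob_space_distr) simp
  show ?thesis
  proof (rule pair_measure_eqI[symmetric])
    fix A B assume "A \<in> sets (distr M S X)" "B \<in> sets (distr M T Y)"
    then have [measurable]: "A \<in> sets S" "B \<in> sets T" by simp_all
    have "(\<lambda>\<omega>. (X \<omega>, Y \<omega>)) -` (A \<times> B) \<inter> space M = (X -` A \<inter> space M) \<inter> (Y -` B \<inter> space M)" by auto
    moreover have "prob ((X -` A \<inter> space M) \<inter> (Y -` B \<inter> space M))
        = prob (X -` A \<inter> space M) * prob (Y -` B \<inter> space M)"
      by (rule indep_setD[OF i]) auto
    ultimately show "emeasure (distr M S X) A * emeasure (distr M T Y) B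
        = emeasure (distr M (S \<Otimes>\<^sub>M T) (\<lambda>\<omega>. (X \<omega>, Y \<omega>))) (A \<times> B)"
      by (simp add: emeasure_distr emeasure_eq_measure ennreal_mult)
  qed (simp_all add: X.sigma_finite_measure_axioms Y.sigma_finite_measure_axioms cong: sets_pair_measure_cong)
qed

text \<open>Fubini: a bound on the integral over \<open>Y\<close> that holds for almost every frozen value of \<open>X\<close>
  survives averaging over \<open>X\<close>.\<close>

lemma nn_integral_indep_rv_le:
  assumes M: "prob_space M" and ind: "indep_rv M S X T Y"
    and F: "F \<in> borel_measurable (S \<Otimes>\<^sub>M T)"
    and le: "AE \<omega> in M. (\<integral>\<^sup>+\<omega>'. F (X \<omega>, Y \<omega>') \<partial>M) \<le> c"
  shows "(\<integral>\<^sup>+\<omega>. F (X \<omega>, Y \<omega>) \<partial>M) \<le> c"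
proof -
  interpret prob_space M by (rule M)
  have X[measurable]: "X \<in> M \<rightarrow>\<^sub>M S" and Y[measurable]: "Y \<in> M \<rightarrow>\<^sub>M T"
    using ind by (auto simp: indep_rv_def)
  interpret Y: prob_space "distr M T Y" by (rule prob_space_distr) simp
  note [measurable] = F
  have Fd: "F \<in> borel_measurable (distr M S X \<Otimes>\<^sub>M distr M T Y)" using F by simp
  have "(\<integral>\<^sup>+\<omega>. F (X \<omega>, Y \<omega>) \<partial>M) = (\<integral>\<^sup>+z. F z \<partial>distr M (S \<Otimes>\<^sub>M T) (\<lambda>\<omega>. (X \<omega>, Y \<omega>)))"
    by (subst nn_integral_distr) simp_all
  also have "\<dots> = (\<integral>\<^sup>+x. \<integral>\<^sup>+y. F (x, y) \<partial>distr M T Y \<partial>distr M S X)"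
    unfolding indep_rv_distr[OF M ind] by (rule Y.nn_integral_fst[symmetric, OF Fd])
  also have "\<dots> = (\<integral>\<^sup>+\<omega>. \<integral>\<^sup>+y. F (X \<omega>, y) \<partial>distr M T Y \<partial>M)"
    using Y.borel_measurable_nn_integral_fst[OF Fd] by (subst nn_integral_distr) simp_all
  also have "\<dots> = (\<integral>\<^sup>+\<omega>. \<integral>\<^sup>+\<omega>'. F (X \<omega>, Y \<omega>') \<partial>M \<partial>M)"
  proof (rule nn_integral_cong)
    fix \<omega> assume w: "\<omega> \<in> space M"
    have "(\<lambda>y. F (X \<omega>, y)) \<in> borel_measurable T"
      using F measurable_space[OF X w] by (rule measurable_compose[OF measurable_Pair1', rotated])
    then show "(\<integral>\<^sup>+y. F (X \<omega>, y) \<partial>distr M T Y) = (\<integral>\<^sup>+\<omega>'. F (X \<omega>, Y \<omega>') \<partial>M)"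
      by (subst nn_integral_distr) simp_all
  qed
  also have "\<dots> \<le> (\<integral>\<^sup>+\<omega>. c \<partial>M)" by (rule nn_integral_mono_AE[OF le])
  also have "\<dots> = c" by (simp add: emeasure_space_1)
  finally show ?thesis .
qed

section \<open>Random signs and rotational invariance of the signal\<close>

definition rademacher :: "nat \<Rightarrow> (nat \<Rightarrow> real) pmf" where
  "rademacher p = Pi_pmf {..<p} 0 (\<lambda>_. pmf_of_set {-1, 1})"

lemma set_pmf_rademacher: "set_pmf (rademacher p) \<subseteq> PiE_dflt {..<p} 0 (\<lambda>_. {-1, 1})"
  using set_Pi_pmf_subset'[of "{..<p}" 0 "\<lambda>_. pmf_of_set {-1, 1 :: real}"]
  by (simp add: rademacher_def comp_def)

lemma rademacher_support:
  assumes "g \<in> set_pmf (rademacher p)" "i < p" shows "(g i)\<^sup>2 = 1"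
proof -
  have "g i = -1 \<or> g i = 1" using set_pmf_rademacher assms by (fastforce simp: PiE_dflt_def)
  then show ?thesis by auto
qed

lemma finite_set_pmf_rademacher: "finite (set_pmf (rademacher p))"
  by (rule finite_subset[OF set_pmf_rademacher]) auto

text \<open>Squares of signs are one, so the diagonal part of the quadratic form of \<open>A\<^sup>T A\<close> is constant and equals
  the squared Frobenius norm of \<open>A\<close>; what remains is purely off-diagonal.\<close>

lemma rademacher_quadratic_form:
  assumes A: "(A :: real mat) \<in> carrier_mat n p"
    and F: "(\<Sum>i<p. \<Sum>j<p. ((A\<^sup>T * A) $$ (i, j))\<^sup>2) \<le> F"
  shows "(\<integral>\<^sup>+g. ennreal (((A *\<^sub>v Matrix.vec p g) \<bullet> (A *\<^sub>v Matrix.vec p g) - frob2 A) ^ 4) \<partial>measure_pmf (rademacher p))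
    \<le> ennreal ((32 * F)\<^sup>2)"
proof -
  let ?P = "measure_pmf (rademacher p)"
  let ?S = "A\<^sup>T * A"
  have int: "integrable ?P f" for f :: "_ \<Rightarrow> real"
    by (rule integrable_measure_pmf_finite[OF finite_set_pmf_rademacher])
  have "prob_space.indep_vars ?P (\<lambda>_. count_space UNIV) (\<lambda>i g. g i) {..<p}"
    unfolding rademacher_def by (rule indep_vars_Pi_pmf) simp
  then have ind: "prob_space.indep_vars ?P (\<lambda>_. borel) (\<lambda>i g. g i) {..<p}"
    by (rule prob_space.indep_vars_compose2[OF prob_space_measure_pmf, where Y = "\<lambda>_ x. x"]) simp
  have mean: "measure_pmf.expectation (rademacher p) (\<lambda>g. g i) = 0" if "i < p" for i
  proof -
    have "measure_pmf.expectation (rademacher p) (\<lambda>g. g i) = measure_pmf.expectation (map_pmf (\<lambda>g. g i) (rademacher p)) (\<lambda>x. x)" by simp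
    also have "map_pmf (\<lambda>g. g i) (rademacher p) = pmf_of_set {-1, 1}"
      unfolding rademacher_def using that by (subst Pi_pmf_component) auto
    finally show ?thesis by (simp add: integral_pmf_of_set)
  qed
  have fourth: "measure_pmf.expectation (rademacher p) (\<lambda>g. g i ^ 4) \<le> 1" if "i < p" for i
  proof -
    have "measure_pmf.expectation (rademacher p) (\<lambda>g. g i ^ 4) = measure_pmf.expectation (rademacher p) (\<lambda>g. 1)"
    proof (rule integral_cong_AE)
      show "AE g in ?P. g i ^ 4 = 1"
      proof (rule AE_pmfI)
        fix g assume "g \<in> set_pmf (rademacher p)"
        from rademacher_support[OF this that] have "((g i)\<^sup>2)\<^sup>2 = 1" by simp
        then show "g i ^ 4 = 1" by simp
      qed
    qed simp_all
    then show ?thesis by simp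
  qed
  have sym: "?S $$ (i, j) = ?S $$ (j, i)" if "i < p" "j < p" for i j
    unfolding gram_entry[OF A that] gram_entry[OF A that(2,1)] by (simp add: mult.commute)
  have "(\<integral>\<^sup>+g. ennreal (((A *\<^sub>v Matrix.vec p g) \<bullet> (A *\<^sub>v Matrix.vec p g) - frob2 A) ^ 4) \<partial>?P)
     = (\<integral>\<^sup>+g. ennreal (((\<Sum>i<p. \<Sum>j<p. ?S $$ (i, j) * g i * g j) - (\<Sum>i<p. ?S $$ (i, i) * (g i)\<^sup>2)) ^ 4) \<partial>?P)"
  proof (rule nn_integral_cong_AE, rule AE_pmfI)
    fix g assume g: "g \<in> set_pmf (rademacher p)"
    have "(\<Sum>i<p. ?S $$ (i, i) * (g i)\<^sup>2) = frob2 A"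
      unfolding frob2_trace[OF A] by (intro sum.cong) (simp_all add: rademacher_support[OF g])
    moreover have "(A *\<^sub>v Matrix.vec p g) \<bullet> (A *\<^sub>v Matrix.vec p g) = (\<Sum>i<p. \<Sum>j<p. ?S $$ (i, j) * g i * g j)"
      by (subst sq_norm_mult_mat_vec[OF A]) (auto intro!: sum.cong simp del: index_mult_mat)
    ultimately show "ennreal (((A *\<^sub>v Matrix.vec p g) \<bullet> (A *\<^sub>v Matrix.vec p g) - frob2 A) ^ 4)
      = ennreal (((\<Sum>i<p. \<Sum>j<p. ?S $$ (i, j) * g i * g j) - (\<Sum>i<p. ?S $$ (i, i) * (g i)\<^sup>2)) ^ 4)" by simp
  qed
  also have "\<dots> \<le> ennreal ((32 * 1 * F)\<^sup>2)"
    by (rule prob_space.nn_integral_offdiag_fourth[OF prob_space_measure_pmf ind int mean fourth _ sym F]) auto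
  finally show ?thesis by simp
qed

lemma mult_mat_vec_scale:
  assumes "(A :: real mat) \<in> carrier_mat n p" "v \<in> carrier_vec p"
  shows "sq_norm (A *\<^sub>v (s \<cdot>\<^sub>v v)) = s\<^sup>2 * sq_norm (A *\<^sub>v v)"
  using assms by (simp add: mult_mat_vec power2_eq_square)

text \<open>The signal energy minus the value at which it concentrates, which is attained with
  \<open>\<rho> = |v|\<^sup>2 / p\<close>.\<close>

definition signal_deviation :: "real \<Rightarrow> real mat \<Rightarrow> real \<Rightarrow> real Matrix.vec \<Rightarrow> real" where
  "signal_deviation l x \<rho> v =
     sq_norm ((residual_mat x l * x) *\<^sub>v v) - \<rho> * frob2 (residual_mat x l * x)"

lemma measurable_signal_deviation:
  assumes f: "f \<in> N \<rightarrow>\<^sub>M mat_borel n p" and g: "g \<in> N \<rightarrow>\<^sub>M vec_borel p"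
  shows "(\<lambda>z. signal_deviation l (f z) \<rho> (g z)) \<in> borel_measurable N"
proof -
  have A: "(\<lambda>z. residual_mat (f z) l * f z) \<in> N \<rightarrow>\<^sub>M mat_borel n p"
    by (rule measurable_mat_mult[OF measurable_residual_mat[OF f] f])
  note [measurable] = measurable_scalar_prod[OF measurable_mult_mat_vec[OF A g] measurable_mult_mat_vec[OF A g]]
    measurable_frob2[OF A]
  show ?thesis unfolding signal_deviation_def by measurable
qed

lemma measurable_signal_deviation_fixed:
  assumes f: "f \<in> N \<rightarrow>\<^sub>M mat_borel n p" and v: "v \<in> carrier_vec p"
  shows "(\<lambda>z. signal_deviation l (f z) \<rho> v) \<in> borel_measurable N"
  using v by (intro measurable_signal_deviation[OF f]) (simp add: measurable_vec_borel_iff)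

text \<open>Multiplication by \<open>U\<close> on the right changes neither \<open>R\<close> nor the Frobenius norm of \<open>R X\<close>, and it
  turns \<open>R X b\<close> into \<open>s R X c\<close>.\<close>

lemma signal_deviation_rotation:
  assumes x: "x \<in> carrier_mat n p" and l: "0 < l" and U: "U \<in> orthogonal_group p"
    and b: "b \<in> carrier_vec p" and c: "c \<in> carrier_vec p" and Ub: "U *\<^sub>v b = s \<cdot>\<^sub>v c"
  shows "signal_deviation l (x * U) (s\<^sup>2) b = s\<^sup>2 * signal_deviation l x 1 c"
proof -
  let ?A = "residual_mat x l * x"
  have Uc: "U \<in> carrier_mat p p" using U by (rule orthogonal_group_carrier)
  have R: "residual_mat x l \<in> carrier_mat n n" by (rule residual_mat_carrier[OF x l])
  have A: "?A \<in> carrier_mat n p" using R x by auto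
  have AU: "residual_mat (x * U) l * (x * U) = ?A * U"
    unfolding residual_mat_orthogonal_right[OF x l U] by (rule assoc_mult_mat[symmetric, OF R x Uc])
  have "(?A * U) *\<^sub>v b = ?A *\<^sub>v (s \<cdot>\<^sub>v c)"
    unfolding Ub[symmetric] by (rule assoc_mult_mat_vec[OF A Uc b])
  then show ?thesis
    unfolding signal_deviation_def AU frob2_orthogonal_right[OF U A]
    by (simp only: mult_mat_vec_scale[OF A c] right_diff_distrib mult_1)
qed

text \<open>Two vectors whose lengths have ratio \<open>s\<close> are related by an orthogonal \<open>U\<close> and scaling with \<open>s\<close>, and
  \<open>X U\<close> has the same law as \<open>X\<close>.\<close>

lemma rotation_signal_fourth_moment:
  assumes inv: "right_rotationally_invariant M n p X" and l: "0 < l"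
    and b: "b \<in> carrier_vec p" and c: "c \<in> carrier_vec p" and s: "b \<bullet> b = s\<^sup>2 * (c \<bullet> c)"
  shows "(\<integral>\<^sup>+\<omega>. ennreal (signal_deviation l (X \<omega>) (s\<^sup>2) b ^ 4) \<partial>M)
    = ennreal (s ^ 8) * (\<integral>\<^sup>+\<omega>. ennreal (signal_deviation l (X \<omega>) 1 c ^ 4) \<partial>M)"
proof -
  have X: "X \<in> M \<rightarrow>\<^sub>M mat_borel n p"
    and dist: "\<And>U. U \<in> orthogonal_group p \<Longrightarrow>
       distr M (mat_borel n p) (\<lambda>\<omega>. X \<omega> * U) = distr M (mat_borel n p) X"
    using inv by (auto simp: right_rotationally_invariant_def)
  have "b \<bullet> b = sq_norm (s \<cdot>\<^sub>v c)" using s c by (simp add: power2_eq_square)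
  then obtain U where U: "U \<in> orthogonal_group p" "U *\<^sub>v b = s \<cdot>\<^sub>v c"
    using householder[of b p "s \<cdot>\<^sub>v c"] b c by auto
  define \<phi> where "\<phi> x = ennreal (signal_deviation l x (s\<^sup>2) b ^ 4)" for x
  have [measurable]: "(\<lambda>x. signal_deviation l x (s\<^sup>2) b) \<in> borel_measurable (mat_borel n p)"
    by (rule measurable_signal_deviation_fixed[OF _ b, where n = n]) simp
  have m\<phi>: "\<phi> \<in> borel_measurable (mat_borel n p)" unfolding \<phi>_def by measurable
  have mXU: "(\<lambda>\<omega>. X \<omega> * U) \<in> M \<rightarrow>\<^sub>M mat_borel n p"
    using orthogonal_group_carrier[OF U(1)] by (intro measurable_mat_mult[OF X]) (simp add: measurable_mat_borel_iff)
  have "(\<integral>\<^sup>+\<omega>. \<phi> (X \<omega>) \<partial>M) = (\<integral>\<^sup>+x. \<phi> x \<partial>distr M (mat_borel n p) X)"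
    using X m\<phi> by (subst nn_integral_distr) simp_all
  also have "\<dots> = (\<integral>\<^sup>+x. \<phi> x \<partial>distr M (mat_borel n p) (\<lambda>\<omega>. X \<omega> * U))" by (simp add: dist[OF U(1)])
  also have "\<dots> = (\<integral>\<^sup>+\<omega>. \<phi> (X \<omega> * U) \<partial>M)"
    using mXU m\<phi> by (subst nn_integral_distr) simp_all
  also have "\<dots> = (\<integral>\<^sup>+\<omega>. ennreal (s ^ 8) * ennreal (signal_deviation l (X \<omega>) 1 c ^ 4) \<partial>M)"
  proof (rule nn_integral_cong)
    fix \<omega> assume "\<omega> \<in> space M"
    then have x: "X \<omega> \<in> carrier_mat n p" using measurable_space[OF X] by (simp add: space_mat_borel)
    show "\<phi> (X \<omega> * U) = ennreal (s ^ 8) * ennreal (signal_deviation l (X \<omega>) 1 c ^ 4)"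
      unfolding \<phi>_def signal_deviation_rotation[OF x l U(1) b c U(2)]
      by (simp add: power_mult_distrib flip: power_mult ennreal_mult)
  qed
  also have "\<dots> = ennreal (s ^ 8) * (\<integral>\<^sup>+\<omega>. ennreal (signal_deviation l (X \<omega>) 1 c ^ 4) \<partial>M)"
  proof (rule nn_integral_cmult)
    note [measurable] = measurable_signal_deviation_fixed[OF X c]
    show "(\<lambda>\<omega>. ennreal (signal_deviation l (X \<omega>) 1 c ^ 4)) \<in> borel_measurable M" by measurable
  qed
  finally show ?thesis unfolding \<phi>_def .
qed

text \<open>The left side equals \<open>s\<^sup>8\<close> times the same expression at any sign vector \<open>g\<close>, because all of them have
  squared length \<open>p\<close>. Averaging over \<open>g\<close> and exchanging the integrals leaves, for each
  fixed design, a quadratic form in random signs.\<close>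

lemma signal_fourth_moment:
  assumes M: "prob_space M" and inv: "right_rotationally_invariant M n p X" and l: "0 < l"
    and p: "0 < p" and b: "b \<in> carrier_vec p"
  shows "(\<integral>\<^sup>+\<omega>. ennreal (signal_deviation l (X \<omega>) ((b \<bullet> b) / real p) b ^ 4) \<partial>M)
    \<le> ennreal (((b \<bullet> b) / real p) ^ 4 * (2 * l\<^sup>2 * real p)\<^sup>2)"
proof -
  interpret prob_space M by (rule M)
  have X: "X \<in> M \<rightarrow>\<^sub>M mat_borel n p" using inv by (simp add: right_rotationally_invariant_def)
  let ?P = "rademacher p"
  define s where "s = sqrt ((b \<bullet> b) / real p)"
  have s2: "s\<^sup>2 = (b \<bullet> b) / real p" unfolding s_def using scalar_prod_self_nonneg[of b] by simp
  let ?I = "\<integral>\<^sup>+\<omega>. ennreal (signal_deviation l (X \<omega>) (s\<^sup>2) b ^ 4) \<partial>M"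
  define \<psi> where "\<psi> \<omega> g = ennreal (signal_deviation l (X \<omega>) 1 (Matrix.vec p g) ^ 4)" for \<omega> g
  have \<psi>: "(\<lambda>\<omega>. \<psi> \<omega> g) \<in> borel_measurable M" for g
  proof -
    note [measurable] = measurable_signal_deviation_fixed[OF X vec_carrier]
    show ?thesis unfolding \<psi>_def by measurable
  qed
  have eq: "?I = ennreal (s ^ 8) * (\<integral>\<^sup>+\<omega>. \<psi> \<omega> g \<partial>M)" if g: "g \<in> set_pmf ?P" for g
  proof -
    have "sq_norm (Matrix.vec p g) = (\<Sum>i<p. (g i)\<^sup>2)"
      by (simp add: scalar_prod_eq_sum[of _ p] power2_eq_square)
    also have "\<dots> = real p" using rademacher_support[OF g] by simp
    finally have "b \<bullet> b = s\<^sup>2 * sq_norm (Matrix.vec p g)" using s2 p by simp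
    from rotation_signal_fourth_moment[OF inv l b vec_carrier this]
    show ?thesis unfolding \<psi>_def .
  qed
  have "?I = (\<integral>\<^sup>+g. ?I \<partial>measure_pmf ?P)" by simp
  also have "\<dots> = (\<integral>\<^sup>+g. ennreal (s ^ 8) * (\<integral>\<^sup>+\<omega>. \<psi> \<omega> g \<partial>M) \<partial>measure_pmf ?P)"
    by (intro nn_integral_cong_AE AE_pmfI eq)
  also have "\<dots> = ennreal (s ^ 8) * (\<integral>\<^sup>+g. (\<integral>\<^sup>+\<omega>. \<psi> \<omega> g \<partial>M) \<partial>measure_pmf ?P)"
    by (rule nn_integral_cmult) simp
  also have "(\<integral>\<^sup>+g. (\<integral>\<^sup>+\<omega>. \<psi> \<omega> g \<partial>M) \<partial>measure_pmf ?P) = (\<integral>\<^sup>+\<omega>. (\<integral>\<^sup>+g. \<psi> \<omega> g \<partial>measure_pmf ?P) \<partial>M)"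
    using \<psi> by (simp add: nn_integral_measure_pmf_finite[OF finite_set_pmf_rademacher] nn_integral_sum nn_integral_multc)
  also have "\<dots> \<le> (\<integral>\<^sup>+\<omega>. ennreal ((32 * (real p * (l / 4)\<^sup>2))\<^sup>2) \<partial>M)"
  proof (rule nn_integral_mono)
    fix \<omega> assume "\<omega> \<in> space M"
    then have x: "X \<omega> \<in> carrier_mat n p" using measurable_space[OF X] by (simp add: space_mat_borel)
    have A: "residual_mat (X \<omega>) l * X \<omega> \<in> carrier_mat n p" using residual_mat_carrier[OF x l] x by auto
    show "(\<integral>\<^sup>+g. \<psi> \<omega> g \<partial>measure_pmf ?P) \<le> ennreal ((32 * (real p * (l / 4)\<^sup>2))\<^sup>2)"
      using rademacher_quadratic_form[OF A residual_design_gram_bound[OF x l]]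
      by (simp only: \<psi>_def signal_deviation_def mult_1)
  qed
  also have "\<dots> = ennreal ((2 * l\<^sup>2 * real p)\<^sup>2)"
    by (simp add: emeasure_space_1 power_divide power_mult_distrib mult_ac)
  also have "ennreal (s ^ 8) * \<dots> = ennreal (((b \<bullet> b) / real p) ^ 4 * (2 * l\<^sup>2 * real p)\<^sup>2)"
  proof -
    have "s ^ 8 = (s\<^sup>2) ^ 4" by (simp flip: power_mult)
    then show ?thesis unfolding s2 by (simp add: ennreal_mult)
  qed
  finally show ?thesis by (simp add: mult_left_mono s2)
qed

section \<open>Noise and cross terms for a fixed design\<close>

text \<open>The noise of one model. Here \<open>q\<close> is an order above two in which the centred squares still have a moment.\<close>

locale noise_vector = prob_space M
  for M :: "'w measure" +
  fixes n :: nat and e :: "'w \<Rightarrow> real Matrix.vec" and K q \<sigma> Kq :: real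
  assumes e: "e \<in> M \<rightarrow>\<^sub>M vec_borel n"
    and ind: "indep_vars (\<lambda>_. borel) (\<lambda>i \<omega>. e \<omega> $ i) {..<n}"
    and mean: "\<And>i. i < n \<Longrightarrow> expectation (\<lambda>\<omega>. e \<omega> $ i) = 0"
    and i2: "\<And>i. i < n \<Longrightarrow> integrable M (\<lambda>\<omega>. (e \<omega> $ i)\<^sup>2)"
    and var: "\<And>i. i < n \<Longrightarrow> expectation (\<lambda>\<omega>. (e \<omega> $ i)\<^sup>2) = \<sigma>\<^sup>2"
    and i4: "\<And>i. i < n \<Longrightarrow> integrable M (\<lambda>\<omega>. (e \<omega> $ i) ^ 4)"
    and K: "\<And>i. i < n \<Longrightarrow> expectation (\<lambda>\<omega>. (e \<omega> $ i) ^ 4) \<le> K" and K0: "0 \<le> K"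
    and q: "2 < q" "q \<le> 3"
    and iq: "\<And>i. i < n \<Longrightarrow> integrable M (\<lambda>\<omega>. \<bar>(e \<omega> $ i)\<^sup>2 - \<sigma>\<^sup>2\<bar> powr q)"
    and Kq: "\<And>i. i < n \<Longrightarrow> expectation (\<lambda>\<omega>. \<bar>(e \<omega> $ i)\<^sup>2 - \<sigma>\<^sup>2\<bar> powr q) \<le> Kq" and Kq0: "0 \<le> Kq"
begin

lemma e_carrier: "\<omega> \<in> space M \<Longrightarrow> e \<omega> \<in> carrier_vec n"
  using measurable_space[OF e] by (simp add: space_vec_borel)

text \<open>A linear form in the noise with coefficient vector \<open>R R X b\<close>, which the contraction bounds control.\<close>

lemma cross_fourth_moment:
  assumes x: "x \<in> carrier_mat n p" and l: "0 < l" and b: "b \<in> carrier_vec p"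
  defines "R \<equiv> residual_mat x l"
  shows "(\<integral>\<^sup>+\<omega>. ennreal (((R *\<^sub>v (x *\<^sub>v b)) \<bullet> (R *\<^sub>v e \<omega>)) ^ 4) \<partial>M)
    \<le> ennreal (16 * K * (l / 4 * (b \<bullet> b))\<^sup>2)"
proof -
  have R: "R \<in> carrier_mat n n" unfolding R_def by (rule residual_mat_carrier[OF x l])
  define u where "u = R *\<^sub>v (x *\<^sub>v b)"
  have u: "u \<in> carrier_vec n" unfolding u_def using R x b by auto
  define c where "c = R *\<^sub>v u"
  have c: "c \<in> carrier_vec n" unfolding c_def using R u by auto
  have eq: "u \<bullet> (R *\<^sub>v e \<omega>) = (\<Sum>i<n. c $ i * (e \<omega> $ i))" if "\<omega> \<in> space M" for \<omega>
  proof -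
    have "u \<bullet> (R *\<^sub>v e \<omega>) = (R\<^sup>T *\<^sub>v u) \<bullet> e \<omega>"
      by (rule scalar_prod_mult_mat_vec[OF R e_carrier[OF that] u])
    also have "R\<^sup>T = R" unfolding R_def by (rule residual_mat_sym[OF x l])
    finally show ?thesis using e_carrier[OF that] by (simp add: c_def scalar_prod_eq_sum[of _ n])
  qed
  have "(\<Sum>i<n. (c $ i)\<^sup>2) = c \<bullet> c" using c by (simp add: scalar_prod_eq_sum[of _ n] power2_eq_square)
  also have "\<dots> \<le> u \<bullet> u" unfolding c_def R_def by (rule residual_contraction(1)[OF x l u])
  also have "\<dots> \<le> l / 4 * (b \<bullet> b)" unfolding u_def R_def by (rule residual_design_contraction[OF x l b])
  finally have F: "(\<Sum>i<n. (c $ i)\<^sup>2) \<le> l / 4 * (b \<bullet> b)" .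
  have "(\<integral>\<^sup>+\<omega>. ennreal ((u \<bullet> (R *\<^sub>v e \<omega>)) ^ 4) \<partial>M)
      = (\<integral>\<^sup>+\<omega>. ennreal ((\<Sum>i<n. c $ i * (e \<omega> $ i)) ^ 4) \<partial>M)"
    by (intro nn_integral_cong) (simp only: eq)
  also have "\<dots> \<le> ennreal (16 * K * (l / 4 * (b \<bullet> b))\<^sup>2)"
    by (rule nn_integral_linear_fourth[OF ind i4 mean K K0 F])
  finally show ?thesis unfolding u_def .
qed

lemma noise_offdiag_fourth_moment:
  assumes x: "x \<in> carrier_mat n p" and l: "0 < l"
  defines "R \<equiv> residual_mat x l"
  shows "(\<integral>\<^sup>+\<omega>. ennreal ((sq_norm (R *\<^sub>v e \<omega>)
      - (\<Sum>i<n. (R\<^sup>T * R) $$ (i, i) * (e \<omega> $ i)\<^sup>2)) ^ 4) \<partial>M)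
    \<le> ennreal ((32 * K * real n)\<^sup>2)"
proof -
  have R: "R \<in> carrier_mat n n" unfolding R_def by (rule residual_mat_carrier[OF x l])
  have sym: "(R\<^sup>T * R) $$ (i, j) = (R\<^sup>T * R) $$ (j, i)" if "i < n" "j < n" for i j
    unfolding gram_entry[OF R that] gram_entry[OF R that(2,1)] by (simp add: mult.commute)
  have "(\<integral>\<^sup>+\<omega>. ennreal ((sq_norm (R *\<^sub>v e \<omega>)
      - (\<Sum>i<n. (R\<^sup>T * R) $$ (i, i) * (e \<omega> $ i)\<^sup>2)) ^ 4) \<partial>M)
    = (\<integral>\<^sup>+\<omega>. ennreal (((\<Sum>i<n. \<Sum>j<n. (R\<^sup>T * R) $$ (i, j) * e \<omega> $ i * e \<omega> $ j)
      - (\<Sum>i<n. (R\<^sup>T * R) $$ (i, i) * (e \<omega> $ i)\<^sup>2)) ^ 4) \<partial>M)"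
    by (intro nn_integral_cong) (simp only: sq_norm_mult_mat_vec[OF R e_carrier])
  also have "\<dots> \<le> ennreal ((32 * K * real n)\<^sup>2)"
    by (rule nn_integral_offdiag_fourth[OF ind i4 mean K K0 sym])
      (use residual_gram_bounds(1)[OF x l] in \<open>simp_all only: R_def\<close>)
  finally show ?thesis .
qed

text \<open>The weights lie in the unit interval, so the weighted variables inherit the moment bound.\<close>

lemma noise_diag_moment:
  assumes x: "x \<in> carrier_mat n p" and l: "0 < l" and n: "0 < n"
  defines "R \<equiv> residual_mat x l"
  shows "(\<integral>\<^sup>+\<omega>. ennreal (\<bar>\<Sum>i<n. (R\<^sup>T * R) $$ (i, i) * ((e \<omega> $ i)\<^sup>2 - \<sigma>\<^sup>2)\<bar> powr q) \<partial>M)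
    \<le> ennreal ((1 + 3 * (1 + Kq) * (4 + Kq)) * real n powr (q / 2))"
proof -
  define h where "h i = (R\<^sup>T * R) $$ (i, i)" for i
  have h: "0 \<le> h i" "h i \<le> 1" if "i < n" for i
    using residual_gram_bounds(2,3)[OF x l that] by (simp_all only: h_def R_def)
  define \<zeta> where "\<zeta> i \<omega> = h i * ((e \<omega> $ i)\<^sup>2 - \<sigma>\<^sup>2)" for i \<omega>
  have ind\<zeta>: "indep_vars (\<lambda>_. borel) \<zeta> {..<n}"
    unfolding \<zeta>_def by (rule indep_vars_compose2[OF ind, where Y = "\<lambda>i x. h i * (x\<^sup>2 - \<sigma>\<^sup>2)"]) simp
  have le: "\<bar>\<zeta> i \<omega>\<bar> powr q \<le> \<bar>(e \<omega> $ i)\<^sup>2 - \<sigma>\<^sup>2\<bar> powr q" if "i < n" for i \<omega>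
  proof (rule powr_mono2)
    show "\<bar>\<zeta> i \<omega>\<bar> \<le> \<bar>(e \<omega> $ i)\<^sup>2 - \<sigma>\<^sup>2\<bar>"
      using h[OF that] unfolding \<zeta>_def abs_mult by (intro mult_left_le_one_le) auto
  qed (use q in auto)
  have m: "\<zeta> i \<in> borel_measurable M" if "i < n" for i
    using ind\<zeta> that unfolding indep_vars_def2 by auto
  have iq\<zeta>: "integrable M (\<lambda>\<omega>. \<bar>\<zeta> i \<omega>\<bar> powr q)" if "i < n" for i
  proof -
    note [measurable] = m[OF that]
    show ?thesis by (rule integrable_between[OF iq[OF that] _ _ le[OF that]]) simp_all
  qed
  have K\<zeta>: "expectation (\<lambda>\<omega>. \<bar>\<zeta> i \<omega>\<bar> powr q) \<le> Kq" if "i < n" for i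
    using integral_mono[OF iq\<zeta>[OF that] iq[OF that] le[OF that]] Kq[OF that] by linarith
  have mean: "expectation (\<zeta> i) = 0" if "i < n" for i
    unfolding \<zeta>_def[abs_def] using i2[OF that] var[OF that] by (simp add: prob_space)
  show ?thesis
    using nn_integral_smoothed_power[OF ind\<zeta> q iq\<zeta> mean K\<zeta> Kq0 n] by (simp only: \<zeta>_def h_def)
qed

end

section \<open>Moment bounds for the random design\<close>

context prob_space
begin

text \<open>The coefficient vector is independent of the design and has known length; it can be frozen.\<close>

lemma signal_deviation_moment:
  assumes ind: "indep_rv M (vec_borel p) \<beta> (mat_borel n p \<Otimes>\<^sub>M vec_borel n) (\<lambda>\<omega>. (X \<omega>, e \<omega>))"
    and inv: "right_rotationally_invariant M n p X" and l: "0 < l" and p: "0 < p"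
    and norm: "AE \<omega> in M. \<beta> \<omega> \<bullet> \<beta> \<omega> = s"
  shows "(\<integral>\<^sup>+\<omega>. ennreal (signal_deviation l (X \<omega>) (s / real p) (\<beta> \<omega>) ^ 4) \<partial>M)
    \<le> ennreal ((s / real p) ^ 4 * (2 * l\<^sup>2 * real p)\<^sup>2)"
proof -
  have \<beta>: "\<beta> \<in> M \<rightarrow>\<^sub>M vec_borel p" using ind by (simp add: indep_rv_def)
  define F where "F z = ennreal (signal_deviation l (fst (snd z)) (s / real p) (fst z) ^ 4)"
    for z :: "real Matrix.vec \<times> real mat \<times> real Matrix.vec"
  let ?N = "vec_borel p \<Otimes>\<^sub>M (mat_borel n p \<Otimes>\<^sub>M vec_borel n)"
  have b: "fst \<in> ?N \<rightarrow>\<^sub>M vec_borel p" and x: "(\<lambda>z. fst (snd z)) \<in> ?N \<rightarrow>\<^sub>M mat_borel n p" by measurable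
  note [measurable] = measurable_signal_deviation[OF x b]
  have F: "F \<in> borel_measurable ?N" unfolding F_def by measurable
  have "(\<integral>\<^sup>+\<omega>. F (\<beta> \<omega>, (X \<omega>, e \<omega>)) \<partial>M) \<le> ennreal ((s / real p) ^ 4 * (2 * l\<^sup>2 * real p)\<^sup>2)"
  proof (rule nn_integral_indep_rv_le[OF prob_space_axioms ind F])
    show "AE \<omega> in M. (\<integral>\<^sup>+\<omega>'. F (\<beta> \<omega>, X \<omega>', e \<omega>') \<partial>M) \<le> ennreal ((s / real p) ^ 4 * (2 * l\<^sup>2 * real p)\<^sup>2)"
      using norm AE_space
    proof eventually_elim
      case (elim \<omega>)
      then have "\<beta> \<omega> \<in> carrier_vec p" using measurable_space[OF \<beta>] by (simp add: space_vec_borel)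
      from signal_fourth_moment[OF prob_space_axioms inv l p this] show ?case
        unfolding F_def elim(1) by simp
    qed
  qed
  then show ?thesis unfolding F_def by simp
qed

end

context noise_vector
begin

text \<open>First the coefficient vector and then the design is frozen, which leaves the noise as the
  only random object.\<close>

lemma cross_moment:
  assumes ind: "indep_rv M (vec_borel p) \<beta> (mat_borel n p \<Otimes>\<^sub>M vec_borel n) (\<lambda>\<omega>. (X \<omega>, e \<omega>))"
    and indX: "indep_rv M (mat_borel n p) X (vec_borel n) e" and l: "0 < l"
    and norm: "AE \<omega> in M. \<beta> \<omega> \<bullet> \<beta> \<omega> = s"
  defines "R \<equiv> \<lambda>x. residual_mat x l"
  shows "(\<integral>\<^sup>+\<omega>. ennreal (((R (X \<omega>) *\<^sub>v (X \<omega> *\<^sub>v \<beta> \<omega>)) \<bullet> (R (X \<omega>) *\<^sub>v e \<omega>)) ^ 4) \<partial>M)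
    \<le> ennreal (16 * K * (l / 4 * s)\<^sup>2)"
proof -
  have \<beta>: "\<beta> \<in> M \<rightarrow>\<^sub>M vec_borel p" using ind by (simp add: indep_rv_def)
  have X: "X \<in> M \<rightarrow>\<^sub>M mat_borel n p" using indX by (simp add: indep_rv_def)
  define F where "F z = ennreal (((R (fst (snd z)) *\<^sub>v (fst (snd z) *\<^sub>v fst z)) \<bullet> (R (fst (snd z)) *\<^sub>v snd (snd z))) ^ 4)"
    for z :: "real Matrix.vec \<times> real mat \<times> real Matrix.vec"
  let ?T = "mat_borel n p \<Otimes>\<^sub>M vec_borel n"
  let ?N = "vec_borel p \<Otimes>\<^sub>M ?T"
  have b: "fst \<in> ?N \<rightarrow>\<^sub>M vec_borel p" and x: "(\<lambda>z. fst (snd z)) \<in> ?N \<rightarrow>\<^sub>M mat_borel n p"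
    and v: "(\<lambda>z. snd (snd z)) \<in> ?N \<rightarrow>\<^sub>M vec_borel n" by measurable
  have mR: "(\<lambda>z. R (fst (snd z))) \<in> ?N \<rightarrow>\<^sub>M mat_borel n n"
    unfolding R_def by (rule measurable_residual_mat[OF x])
  note [measurable] = measurable_scalar_prod[OF measurable_mult_mat_vec[OF mR measurable_mult_mat_vec[OF x b]] measurable_mult_mat_vec[OF mR v]]
  have F: "F \<in> borel_measurable ?N" unfolding F_def by measurable
  have "(\<integral>\<^sup>+\<omega>. F (\<beta> \<omega>, (X \<omega>, e \<omega>)) \<partial>M) \<le> ennreal (16 * K * (l / 4 * s)\<^sup>2)"
  proof (rule nn_integral_indep_rv_le[OF prob_space_axioms ind F])
    show "AE \<omega> in M. (\<integral>\<^sup>+\<omega>'. F (\<beta> \<omega>, X \<omega>', e \<omega>') \<partial>M) \<le> ennreal (16 * K * (l / 4 * s)\<^sup>2)"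
      using norm AE_space
    proof eventually_elim
      case (elim \<omega>)
      then have bs: "\<beta> \<omega> \<in> space (vec_borel p)" using measurable_space[OF \<beta>] by simp
      then have bc: "\<beta> \<omega> \<in> carrier_vec p" by (simp add: space_vec_borel)
      have Fb: "(\<lambda>z. F (\<beta> \<omega>, z)) \<in> borel_measurable ?T"
        by (rule measurable_compose[OF measurable_Pair1'[OF bs] F])
      show ?case
      proof (rule nn_integral_indep_rv_le[OF prob_space_axioms indX Fb])
        show "AE \<omega>'' in M. (\<integral>\<^sup>+\<omega>'. F (\<beta> \<omega>, X \<omega>'', e \<omega>') \<partial>M) \<le> ennreal (16 * K * (l / 4 * s)\<^sup>2)"
        proof (rule AE_I2)
          fix \<omega>'' assume "\<omega>'' \<in> space M"
          then have xc: "X \<omega>'' \<in> carrier_mat n p" using measurable_space[OF X] by (simp add: space_mat_borel)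
          from cross_fourth_moment[OF xc l bc]
          show "(\<integral>\<^sup>+\<omega>'. F (\<beta> \<omega>, X \<omega>'', e \<omega>') \<partial>M) \<le> ennreal (16 * K * (l / 4 * s)\<^sup>2)"
            unfolding F_def R_def elim(1) by simp
        qed
      qed
    qed
  qed
  then show ?thesis unfolding F_def by simp
qed

lemma nn_integral_random_design_le:
  assumes indX: "indep_rv M (mat_borel n p) X (vec_borel n) e"
    and Z: "(\<lambda>z. Z (fst z) (snd z)) \<in> borel_measurable (mat_borel n p \<Otimes>\<^sub>M vec_borel n)"
    and le: "\<And>x. x \<in> carrier_mat n p \<Longrightarrow> (\<integral>\<^sup>+\<omega>. Z x (e \<omega>) \<partial>M) \<le> c"
  shows "(\<integral>\<^sup>+\<omega>. Z (X \<omega>) (e \<omega>) \<partial>M) \<le> c"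
proof -
  have X: "X \<in> M \<rightarrow>\<^sub>M mat_borel n p" using indX by (simp add: indep_rv_def)
  have "AE \<omega> in M. (\<integral>\<^sup>+\<omega>'. Z (X \<omega>) (e \<omega>') \<partial>M) \<le> c"
    using measurable_space[OF X] by (intro AE_I2 le) (simp add: space_mat_borel)
  then show ?thesis using nn_integral_indep_rv_le[OF prob_space_axioms indX Z, of c] by simp
qed

lemma noise_offdiag_moment:
  assumes indX: "indep_rv M (mat_borel n p) X (vec_borel n) e" and l: "0 < l"
  defines "R \<equiv> \<lambda>x. residual_mat x l"
  defines "Z \<equiv> \<lambda>x v. sq_norm (R x *\<^sub>v v) - (\<Sum>i<n. ((R x)\<^sup>T * R x) $$ (i, i) * (v $ i)\<^sup>2)"
  shows "(\<integral>\<^sup>+\<omega>. ennreal (Z (X \<omega>) (e \<omega>) ^ 4) \<partial>M) \<le> ennreal ((32 * K * real n)\<^sup>2)"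
proof (rule nn_integral_random_design_le[OF indX])
  note [measurable] = measurable_noise_deviation(1)[OF measurable_fst measurable_snd, where l = l and n = n and p = p]
  show "(\<lambda>z. ennreal (Z (fst z) (snd z) ^ 4)) \<in> borel_measurable (mat_borel n p \<Otimes>\<^sub>M vec_borel n)"
    unfolding Z_def R_def by measurable
  show "(\<integral>\<^sup>+\<omega>. ennreal (Z x (e \<omega>) ^ 4) \<partial>M) \<le> ennreal ((32 * K * real n)\<^sup>2)" if "x \<in> carrier_mat n p" for x
    using noise_offdiag_fourth_moment[OF that l] by (simp only: Z_def R_def)
qed

lemma noise_diag_moment_random_design:
  assumes indX: "indep_rv M (mat_borel n p) X (vec_borel n) e" and l: "0 < l" and n: "0 < n"
  defines "R \<equiv> \<lambda>x. residual_mat x l"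
  defines "Z \<equiv> \<lambda>x v. \<Sum>i<n. ((R x)\<^sup>T * R x) $$ (i, i) * ((v $ i)\<^sup>2 - \<sigma>\<^sup>2)"
  shows "(\<integral>\<^sup>+\<omega>. ennreal (\<bar>Z (X \<omega>) (e \<omega>)\<bar> powr q) \<partial>M) \<le> ennreal ((1 + 3 * (1 + Kq) * (4 + Kq)) * real n powr (q / 2))"
proof (rule nn_integral_random_design_le[OF indX])
  note [measurable] = measurable_noise_deviation(2)[OF measurable_fst measurable_snd, where l = l and n = n and p = p]
  show "(\<lambda>z. ennreal (\<bar>Z (fst z) (snd z)\<bar> powr q)) \<in> borel_measurable (mat_borel n p \<Otimes>\<^sub>M vec_borel n)"
    unfolding Z_def R_def by measurable
  show "(\<integral>\<^sup>+\<omega>. ennreal (\<bar>Z x (e \<omega>)\<bar> powr q) \<partial>M) \<le> ennreal ((1 + 3 * (1 + Kq) * (4 + Kq)) * real n powr (q / 2))"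
    if "x \<in> carrier_mat n p" for x
    using noise_diag_moment[OF that l n] by (simp only: Z_def R_def)
qed

end

text \<open>All moments that are used of an entry are dominated by its moment of order \<open>4 + \<eta>\<close>.\<close>

lemma (in prob_space) noise_moment_bounds:
  fixes e :: "'a \<Rightarrow> real"
  assumes [measurable]: "e \<in> borel_measurable M" and \<eta>: "0 < \<eta>"
    and i: "integrable M (\<lambda>\<omega>. \<bar>e \<omega>\<bar> powr (4 + \<eta>))"
    and K: "expectation (\<lambda>\<omega>. \<bar>e \<omega>\<bar> powr (4 + \<eta>)) \<le> K"
    and q: "0 < q" "q \<le> 2 + \<eta> / 2"
  shows "integrable M (\<lambda>\<omega>. e \<omega> ^ 4)" "expectation (\<lambda>\<omega>. e \<omega> ^ 4) \<le> 1 + K"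
    "integrable M (\<lambda>\<omega>. (e \<omega>)\<^sup>2)"
    "integrable M (\<lambda>\<omega>. \<bar>(e \<omega>)\<^sup>2 - \<sigma>\<^sup>2\<bar> powr q)"
    "expectation (\<lambda>\<omega>. \<bar>(e \<omega>)\<^sup>2 - \<sigma>\<^sup>2\<bar> powr q) \<le> 1 + K + (\<sigma>\<^sup>2) powr q"
proof -
  have low: "\<bar>x\<bar> powr s \<le> 1 + \<bar>x\<bar> powr (4 + \<eta>)" if "0 < s" "s \<le> 4 + \<eta>" for x s :: real
  proof (cases "\<bar>x\<bar> \<le> 1")
    case True
    then have "\<bar>x\<bar> powr s \<le> 1 powr s" using that by (intro powr_mono2) auto
    then have "\<bar>x\<bar> powr s \<le> 1" by simp
    then show ?thesis using powr_ge_zero[of "\<bar>x\<bar>" "4 + \<eta>"] by linarith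
  next
    case False
    then have "\<bar>x\<bar> powr s \<le> \<bar>x\<bar> powr (4 + \<eta>)" using that by (intro powr_mono) auto
    then show ?thesis by simp
  qed
  have dom: "integrable M (\<lambda>\<omega>. 1 + \<bar>e \<omega>\<bar> powr (4 + \<eta>))" using i by simp
  have Edom: "expectation (\<lambda>\<omega>. 1 + \<bar>e \<omega>\<bar> powr (4 + \<eta>)) \<le> 1 + K" using i K by (simp add: prob_space)
  have p4: "x ^ 4 \<le> 1 + \<bar>x\<bar> powr (4 + \<eta>)" for x :: real
    using low[of 4 x] \<eta> by (cases "x = 0") (simp_all add: power_even_abs)
  have p2: "x ^ 2 \<le> 1 + \<bar>x\<bar> powr (4 + \<eta>)" for x :: real
    using low[of 2 x] \<eta> by (cases "x = 0") simp_all
  show i4: "integrable M (\<lambda>\<omega>. e \<omega> ^ 4)"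
    by (rule integrable_between[OF dom _ _ p4]) simp_all
  show "integrable M (\<lambda>\<omega>. (e \<omega>)\<^sup>2)"
    by (rule integrable_between[OF dom _ _ p2]) simp_all
  show "expectation (\<lambda>\<omega>. e \<omega> ^ 4) \<le> 1 + K"
    using integral_mono[OF i4 dom p4] Edom by linarith
  have pq: "\<bar>x\<^sup>2 - \<sigma>\<^sup>2\<bar> powr q \<le> 1 + \<bar>x\<bar> powr (4 + \<eta>) + (\<sigma>\<^sup>2) powr q" for x
  proof -
    have "x\<^sup>2 powr q = \<bar>x\<bar> powr (2 * q)" by (rule square_powr)
    also have "\<dots> \<le> 1 + \<bar>x\<bar> powr (4 + \<eta>)" using q by (intro low) auto
    finally have x: "x\<^sup>2 powr q \<le> 1 + \<bar>x\<bar> powr (4 + \<eta>)" .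
    have nn: "0 \<le> x\<^sup>2" "0 \<le> \<sigma>\<^sup>2" by simp_all
    have "\<bar>x\<^sup>2 - \<sigma>\<^sup>2\<bar> \<le> max (x\<^sup>2) (\<sigma>\<^sup>2)" using nn by (auto simp: max_def abs_if)
    then have "\<bar>x\<^sup>2 - \<sigma>\<^sup>2\<bar> powr q \<le> max (x\<^sup>2) (\<sigma>\<^sup>2) powr q" using q by (intro powr_mono2) auto
    also have "\<dots> \<le> x\<^sup>2 powr q + (\<sigma>\<^sup>2) powr q" by (auto simp: max_def)
    finally show ?thesis using x by linarith
  qed
  have dom2: "integrable M (\<lambda>\<omega>. 1 + \<bar>e \<omega>\<bar> powr (4 + \<eta>) + (\<sigma>\<^sup>2) powr q)" using i by simp
  show iq: "integrable M (\<lambda>\<omega>. \<bar>(e \<omega>)\<^sup>2 - \<sigma>\<^sup>2\<bar> powr q)"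
    by (rule integrable_between[OF dom2 _ _ pq]) simp_all
  have "expectation (\<lambda>\<omega>. \<bar>(e \<omega>)\<^sup>2 - \<sigma>\<^sup>2\<bar> powr q) \<le> expectation (\<lambda>\<omega>. 1 + \<bar>e \<omega>\<bar> powr (4 + \<eta>) + (\<sigma>\<^sup>2) powr q)"
    by (rule integral_mono[OF iq dom2 pq])
  also have "\<dots> \<le> 1 + K + (\<sigma>\<^sup>2) powr q" using i K by (simp add: prob_space)
  finally show "expectation (\<lambda>\<omega>. \<bar>(e \<omega>)\<^sup>2 - \<sigma>\<^sup>2\<bar> powr q) \<le> 1 + K + (\<sigma>\<^sup>2) powr q" .
qed

section \<open>Limits of the estimators\<close>

text \<open>Let \<open>u\<^sub>i = a\<^sub>i / b\<^sub>i - a\<^sub>1 / b\<^sub>1\<close>. Without errors the ratio is exactly \<open>A\<close>, as \<open>B\<close> cancels in the differences. An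
  error \<open>f\<^sub>i\<close> in the \<open>i\<close>-th difference changes it by \<open>f\<^sub>i u\<^sub>i / \<Sum> u\<^sup>2\<close>, at most \<open>\<bar>f\<^sub>i\<bar> / c\<close>.\<close>

lemma r2_hat_tendsto:
  fixes a b t :: "nat \<Rightarrow> nat \<Rightarrow> real"
  assumes k: "k \<in> {1..L}" and \<delta>: "0 < \<delta>" and c: "0 < c"
    and b: "eventually (\<lambda>n. \<forall>i\<in>{1..L}. \<delta> \<le> b n i) sequentially"
    and sep: "eventually (\<lambda>n. c \<le> \<bar>a n k / b n k - a n 1 / b n 1\<bar>) sequentially"
    and err: "\<And>i. i \<in> {1..L} \<Longrightarrow> (\<lambda>n. t n i - (A * a n i + B * b n i)) \<longlonglongrightarrow> 0"
  shows "(\<lambda>n. r2_hat L (a n) (b n) (t n)) \<longlonglongrightarrow> A"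
proof -
  define e where "e n i = t n i - (A * a n i + B * b n i)" for n i
  define f where "f n i = e n i / b n i - e n 1 / b n 1" for n i
  define u where "u n i = a n i / b n i - a n 1 / b n 1" for n i
  have one: "1 \<in> {1..L}" using k by auto
  have eb: "(\<lambda>n. e n i / b n i) \<longlonglongrightarrow> 0" if i: "i \<in> {1..L}" for i
  proof (rule Lim_null_comparison)
    show "eventually (\<lambda>n. norm (e n i / b n i) \<le> \<bar>e n i\<bar> / \<delta>) sequentially"
      using b
    proof eventually_elim
      case (elim n)
      then have "\<delta> \<le> b n i" using i by auto
      then show ?case using \<delta> by (auto intro!: divide_left_mono)
    qed
    show "(\<lambda>n. \<bar>e n i\<bar> / \<delta>) \<longlonglongrightarrow> 0"
      using tendsto_divide[OF tendsto_rabs[OF err[OF i]] tendsto_const[of \<delta>]] \<delta> by (simp add: e_def)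
  qed
  have f: "(\<lambda>n. f n i) \<longlonglongrightarrow> 0" if i: "i \<in> {1..L}" for i
    unfolding f_def using tendsto_diff[OF eb[OF i] eb[OF one]] by simp
  have "(\<lambda>n. r2_hat L (a n) (b n) (t n) - A) \<longlonglongrightarrow> 0"
  proof (rule Lim_null_comparison)
    show "eventually (\<lambda>n. norm (r2_hat L (a n) (b n) (t n) - A) \<le> (\<Sum>i=1..L. \<bar>f n i\<bar>) / c) sequentially"
      using b sep
    proof eventually_elim
      case (elim n)
      define S where "S = (\<Sum>i=1..L. (u n i)\<^sup>2)"
      have "(u n k)\<^sup>2 \<le> S" unfolding S_def using k by (intro member_le_sum) auto
      moreover have "c\<^sup>2 \<le> (u n k)\<^sup>2"
        using elim(2) c unfolding u_def[symmetric] by (metis abs_ge_zero less_imp_le power2_abs power_mono)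
      ultimately have cS: "c\<^sup>2 \<le> S" by linarith
      have S: "0 < S" using cS zero_less_power[OF c, of 2] by linarith
      have t: "t n i / b n i - t n 1 / b n 1 = A * u n i + f n i" if i: "i \<in> {1..L}" for i
      proof -
        have "b n i \<noteq> 0" "b n 1 \<noteq> 0" using elim(1) i one \<delta> by force+
        then show ?thesis unfolding u_def f_def e_def by (simp add: field_simps)
      qed
      have "(\<Sum>i=1..L. (t n i / b n i - t n 1 / b n 1) * (a n i / b n i - a n 1 / b n 1))
          = (\<Sum>i=1..L. A * (u n i)\<^sup>2 + f n i * u n i)"
      proof (rule sum.cong)
        fix i assume i: "i \<in> {1..L}"
        show "(t n i / b n i - t n 1 / b n 1) * (a n i / b n i - a n 1 / b n 1) = A * (u n i)\<^sup>2 + f n i * u n i"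
          unfolding t[OF i] u_def[symmetric] by (simp add: power2_eq_square algebra_simps)
      qed simp
      also have "\<dots> = A * S + (\<Sum>i=1..L. f n i * u n i)"
        by (simp add: S_def sum.distrib sum_distrib_left)
      finally have "r2_hat L (a n) (b n) (t n) - A = (\<Sum>i=1..L. f n i * u n i) / S"
        unfolding r2_hat_def u_def[symmetric] S_def[symmetric] using S by (simp add: field_simps)
      then have "norm (r2_hat L (a n) (b n) (t n) - A) \<le> (\<Sum>i=1..L. \<bar>f n i * u n i\<bar>) / S"
        using S by (simp add: divide_right_mono sum_abs)
      also have "\<dots> \<le> (\<Sum>i=1..L. \<bar>f n i\<bar> * (S / c)) / S"
      proof (intro divide_right_mono sum_mono)
        fix i assume i: "i \<in> {1..L}"
        have "(u n i)\<^sup>2 \<le> S" unfolding S_def using i by (intro member_le_sum) auto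
        then have "\<bar>u n i\<bar> \<le> sqrt S" by (simp add: real_le_rsqrt)
        moreover have "c \<le> sqrt S" using cS by (rule real_le_rsqrt)
        ultimately have "\<bar>u n i\<bar> * c \<le> sqrt S * sqrt S" using c S by (intro mult_mono) auto
        then have "\<bar>u n i\<bar> \<le> S / c" using S c by (simp add: field_simps)
        then show "\<bar>f n i * u n i\<bar> \<le> \<bar>f n i\<bar> * (S / c)" unfolding abs_mult by (rule mult_left_mono) simp
      qed (use S in simp)
      also have "\<dots> = (\<Sum>i=1..L. \<bar>f n i\<bar>) / c" using S by (simp add: sum_divide_distrib[symmetric] sum_distrib_right[symmetric])
      finally show ?case .
    qed
    have "(\<lambda>n. (\<Sum>i=1..L. \<bar>f n i\<bar>) / c) \<longlonglongrightarrow> (\<Sum>i=1..L. 0) / c"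
      by (intro tendsto_divide tendsto_sum tendsto_const tendsto_rabs_zero f) (use c in auto)
    then show "(\<lambda>n. (\<Sum>i=1..L. \<bar>f n i\<bar>) / c) \<longlonglongrightarrow> 0" by simp
  qed
  then show ?thesis by (simp add: LIM_zero_iff)
qed

text \<open>The two estimators are exchanged by exchanging the roles of signal and noise.\<close>

lemma sigma2_hat_eq_r2_hat: "sigma2_hat L a b t = r2_hat L b a t"
  by (simp add: sigma2_hat_def r2_hat_def)

text \<open>For \<open>coef_a\<close>: each summand is at most \<open>l / 4\<close>, and at most \<open>p\<close> of them are nonzero.\<close>

lemma coef_upper_bounds:
  assumes l: "0 < l" and D: "D \<in> carrier_mat n p" and n: "0 < n"
  shows "0 \<le> coef_b D l" "coef_b D l \<le> 1" "0 \<le> coef_a D l" "coef_a D l \<le> l / 4"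
proof -
  let ?d = "diag_entry D"
  show "0 \<le> coef_b D l" "0 \<le> coef_a D l"
    unfolding coef_a_eq[OF l D n] coef_b_eq[OF l D] by (auto intro!: divide_nonneg_nonneg sum_nonneg)
  have "(\<Sum>i<n. (l / ((?d i)\<^sup>2 + l))\<^sup>2) \<le> (\<Sum>i<n. 1)"
    using l by (intro sum_mono) (simp add: abs_square_le_1 add_nonneg_pos)
  then show "coef_b D l \<le> 1" using n unfolding coef_b_eq[OF l D] by simp
  have y: "(l * x / (x\<^sup>2 + l))\<^sup>2 \<le> l / 4" for x :: real
  proof -
    have pos: "0 < x\<^sup>2 + l" using l by (simp add: add_nonneg_pos)
    \<comment> \<open>AM-GM: \<open>4 l x\<^sup>2 \<le> (x\<^sup>2 + l)\<^sup>2\<close>\<close>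
    have "0 \<le> l * (x\<^sup>2 - l)\<^sup>2" using l by simp
    then have "4 * (l * x)\<^sup>2 \<le> l * (x\<^sup>2 + l)\<^sup>2" by (simp add: power2_eq_square algebra_simps)
    then show ?thesis using pos by (simp add: power_divide field_simps)
  qed
  have "(\<Sum>i<n. (l * ?d i / ((?d i)\<^sup>2 + l))\<^sup>2) = (\<Sum>i<min n p. (l * ?d i / ((?d i)\<^sup>2 + l))\<^sup>2)"
    using D by (intro sum.mono_neutral_right) (auto simp: diag_entry_def)
  also have "\<dots> \<le> (\<Sum>i<min n p. l / 4)" by (intro sum_mono y)
  also have "\<dots> = real (min n p) * (l / 4)" by simp
  also have "\<dots> \<le> real p * (l / 4)" using l by (intro mult_right_mono) auto
  finally have S: "(\<Sum>i<n. (l * ?d i / ((?d i)\<^sup>2 + l))\<^sup>2) \<le> real p * (l / 4)" .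
  show "coef_a D l \<le> l / 4"
  proof (cases "p = 0")
    case False
    then show ?thesis using S unfolding coef_a_eq[OF l D n] by (simp add: field_simps)
  qed (use l in \<open>simp add: coef_a_eq[OF l D n]\<close>)
qed

text \<open>For singular values at most \<open>C\<close> the summands of \<open>coef_a\<close> at different penalties are comparable up to
  constants. One of these coefficients being bounded away from zero therefore forces the same for
  all of them.\<close>

lemma coef_lower_bounds:
  assumes l: "0 < l" and D: "D \<in> carrier_mat n p" and n: "0 < n"
    and C: "\<And>i. i < n \<Longrightarrow> (diag_entry D i)\<^sup>2 \<le> C\<^sup>2"
  shows "(l / (C\<^sup>2 + l))\<^sup>2 \<le> coef_b D l"
    "0 < l' \<Longrightarrow> (l / (C\<^sup>2 + l))\<^sup>2 * coef_a D l' \<le> coef_a D l"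
proof -
  let ?d = "diag_entry D"
  have r: "(l / (C\<^sup>2 + l))\<^sup>2 \<le> (l / ((?d i)\<^sup>2 + l))\<^sup>2" if "i < n" for i
    using C[OF that] l by (intro power_mono divide_left_mono mult_pos_pos add_nonneg_pos) auto
  have "(\<Sum>i<n. (l / (C\<^sup>2 + l))\<^sup>2) \<le> (\<Sum>i<n. (l / ((?d i)\<^sup>2 + l))\<^sup>2)"
    by (intro sum_mono r) auto
  then show "(l / (C\<^sup>2 + l))\<^sup>2 \<le> coef_b D l" using n unfolding coef_b_eq[OF l D] by (simp add: field_simps)
  assume l': "0 < l'"
  have "(l / (C\<^sup>2 + l))\<^sup>2 * (l' * ?d i / ((?d i)\<^sup>2 + l'))\<^sup>2 \<le> (l * ?d i / ((?d i)\<^sup>2 + l))\<^sup>2" if "i < n" for i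
  proof -
    have "(l' / ((?d i)\<^sup>2 + l'))\<^sup>2 \<le> 1" using l' by (simp add: abs_square_le_1 add_nonneg_pos)
    then have "(l / (C\<^sup>2 + l))\<^sup>2 * ((l' / ((?d i)\<^sup>2 + l'))\<^sup>2 * (?d i)\<^sup>2) \<le> (l / ((?d i)\<^sup>2 + l))\<^sup>2 * (1 * (?d i)\<^sup>2)"
      using r[OF that] by (intro mult_mono) auto
    then show ?thesis by (simp add: power_divide power_mult_distrib)
  qed
  then have "(l / (C\<^sup>2 + l))\<^sup>2 * (\<Sum>i<n. (l' * ?d i / ((?d i)\<^sup>2 + l'))\<^sup>2) \<le> (\<Sum>i<n. (l * ?d i / ((?d i)\<^sup>2 + l))\<^sup>2)"
    unfolding sum_distrib_left by (intro sum_mono) auto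
  then show "(l / (C\<^sup>2 + l))\<^sup>2 * coef_a D l' \<le> coef_a D l"
    unfolding coef_a_eq[OF l D n] coef_a_eq[OF l' D n] by (simp add: divide_right_mono)
qed

text \<open>The four terms are the signal deviation, the cross term, and the off-diagonal and diagonal parts of the
  noise deviation.\<close>

lemma train_err_decomposition:
  assumes svd: "is_svd n p X Q D V" and l: "0 < l" and n: "0 < n" and p: "0 < p"
    and b: "b \<in> carrier_vec p" and e: "e \<in> carrier_vec n"
  defines "R \<equiv> residual_mat X l"
  shows "train_err X (X *\<^sub>v b + e) l - (\<rho> * coef_a D l + \<sigma>\<^sup>2 * coef_b D l)
    = signal_deviation l X (\<rho> * real n / real p) b / real n
     + 2 * (((R *\<^sub>v (X *\<^sub>v b)) \<bullet> (R *\<^sub>v e)) / real n)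
     + (sq_norm (R *\<^sub>v e) - (\<Sum>i<n. (R\<^sup>T * R) $$ (i, i) * (e $ i)\<^sup>2)) / real n
     + (\<Sum>i<n. (R\<^sup>T * R) $$ (i, i) * ((e $ i)\<^sup>2 - \<sigma>\<^sup>2)) / real n"
proof -
  have X: "X \<in> carrier_mat n p"
    using svd by (auto simp: is_svd_def orthogonal_group_def)
  have R: "R \<in> carrier_mat n n" unfolding R_def by (rule residual_mat_carrier[OF X l])
  define u where "u = R *\<^sub>v (X *\<^sub>v b)"
  define v where "v = R *\<^sub>v e"
  have u: "u \<in> carrier_vec n" and v: "v \<in> carrier_vec n" unfolding u_def v_def using R X b e by auto
  have RX: "(R * X) *\<^sub>v b = u" unfolding u_def using R X b by (intro assoc_mult_mat_vec) auto
  have "R *\<^sub>v (X *\<^sub>v b + e) = u + v"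
    unfolding u_def v_def using R X b e by (intro mult_add_distrib_mat_vec) auto
  then have "train_err X (X *\<^sub>v b + e) l = sq_norm (u + v) / real n"
    using train_err_eq[OF X l, of "X *\<^sub>v b + e"] X b e by (simp add: R_def)
  also have "sq_norm (u + v) = u \<bullet> u + 2 * (u \<bullet> v) + v \<bullet> v"
    using u v by (simp add: scalar_prod_eq_sum[of _ n] sum.distrib[symmetric] sum_distrib_left algebra_simps)
  finally have t: "train_err X (X *\<^sub>v b + e) l = (u \<bullet> u + 2 * (u \<bullet> v) + v \<bullet> v) / real n" .
  have "real n * coef_b D l = (\<Sum>i<n. (R\<^sup>T * R) $$ (i, i))"
    using svd_coefficients(1)[OF svd l n] frob2_trace[OF R] by (simp only: R_def)
  then have S: "(\<Sum>i<n. (R\<^sup>T * R) $$ (i, i) * ((e $ i)\<^sup>2 - \<sigma>\<^sup>2))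
      = (\<Sum>i<n. (R\<^sup>T * R) $$ (i, i) * (e $ i)\<^sup>2) - \<sigma>\<^sup>2 * (real n * coef_b D l)"
    by (simp add: right_diff_distrib sum_subtractf sum_distrib_left mult.commute del: index_mult_mat)
  have a: "frob2 (R * X) = real p * coef_a D l"
    unfolding R_def by (rule svd_coefficients(2)[OF svd l n p])
  show ?thesis
    unfolding t S signal_deviation_def R_def[symmetric] RX a u_def[symmetric] v_def[symmetric] using n p by (simp add: field_simps del: index_mult_mat)
qed

section \<open>Consistency\<close>

theorem corollary2:
  fixes M :: "'w measure"
    and p :: "nat \<Rightarrow> nat"
    and X Q D V :: "nat \<Rightarrow> 'w \<Rightarrow> real mat"
    and \<beta> \<epsilon> y :: "nat \<Rightarrow> 'w \<Rightarrow> real Matrix.vec"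
    and \<gamma> C r \<sigma> :: real
    and L :: nat and lam :: "nat \<Rightarrow> real"
  assumes prob: "prob_space M"
    and gamma: "0 < \<gamma>" "(\<lambda>n. real (p n) / real n) \<longlonglongrightarrow> \<gamma>"
    and X_inv: "\<And>n. 0 < n \<Longrightarrow> right_rotationally_invariant M n (p n) (X n)"
    and svd_meas: "\<And>n. 0 < n \<Longrightarrow> Q n \<in> M \<rightarrow>\<^sub>M mat_borel n n"
      "\<And>n. 0 < n \<Longrightarrow> D n \<in> M \<rightarrow>\<^sub>M mat_borel n (p n)"
      "\<And>n. 0 < n \<Longrightarrow> V n \<in> M \<rightarrow>\<^sub>M mat_borel (p n) (p n)"
    and svd: "\<And>n. 0 < n \<Longrightarrow> AE \<omega> in M. is_svd n (p n) (X n \<omega>) (Q n \<omega>) (D n \<omega>) (V n \<omega>)"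
    and D_bound: "AE \<omega> in M.
      limsup (\<lambda>n. SUP i\<in>{..<min n (p n)}. ereal (D n \<omega> $$ (i, i))) < ereal C"
    (* a fixed vector is the case of a constant random vector *)
    and beta_meas: "\<And>n. 0 < n \<Longrightarrow> \<beta> n \<in> M \<rightarrow>\<^sub>M vec_borel (p n)"
    and beta_norm: "0 \<le> r"
      "\<And>n. 0 < n \<Longrightarrow> AE \<omega> in M. l2_norm_vec (\<beta> n \<omega>) = r * sqrt (real n)"
    and beta_indep: "\<And>n. 0 < n \<Longrightarrow>
      indep_rv M (vec_borel (p n)) (\<beta> n)
        (mat_borel n (p n) \<Otimes>\<^sub>M vec_borel n) (\<lambda>\<omega>. (X n \<omega>, \<epsilon> n \<omega>))"
    and eps_meas: "\<And>n. 0 < n \<Longrightarrow> \<epsilon> n \<in> M \<rightarrow>\<^sub>M vec_borel n"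
    and eps_indep_X: "\<And>n. 0 < n \<Longrightarrow>
      indep_rv M (mat_borel n (p n)) (X n) (vec_borel n) (\<epsilon> n)"
    and eps_indep: "\<And>n. 0 < n \<Longrightarrow>
      prob_space.indep_vars M (\<lambda>_. borel) (\<lambda>i \<omega>. \<epsilon> n \<omega> $ i) {..<n}"
    and eps_mean: "\<And>n i. i < n \<Longrightarrow> (LINT \<omega>|M. \<epsilon> n \<omega> $ i) = 0"
    and eps_var: "\<And>n i. i < n \<Longrightarrow> (LINT \<omega>|M. (\<epsilon> n \<omega> $ i)\<^sup>2) = \<sigma>\<^sup>2"
    (* uniform over the triangular array *)
    and eps_moment: "\<exists>\<eta>>0. \<exists>K. \<forall>n. \<forall>i<n.
      integrable M (\<lambda>\<omega>. \<bar>\<epsilon> n \<omega> $ i\<bar> powr (4 + \<eta>)) \<and>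
      (LINT \<omega>|M. \<bar>\<epsilon> n \<omega> $ i\<bar> powr (4 + \<eta>)) \<le> K"
    and y: "\<And>n \<omega>. 0 < n \<Longrightarrow> \<omega> \<in> space M \<Longrightarrow> y n \<omega> = X n \<omega> *\<^sub>v \<beta> n \<omega> + \<epsilon> n \<omega>"
    and L: "2 \<le> L"
    and lam: "0 < lam 1" "\<And>i. 1 \<le> i \<Longrightarrow> i < L \<Longrightarrow> lam i < lam (Suc i)"
    and nondeg1: "AE \<omega> in M.
      (\<lambda>n. indicator ((\<Union>i\<in>{1..L}. {\<omega>\<in>space M. coef_a (D n \<omega>) (lam i) = 0}) \<union>
                     (\<Union>i\<in>{1..L}. {\<omega>\<in>space M. coef_b (D n \<omega>) (lam i) = 0})) \<omega> :: real) \<longlonglongrightarrow> 0"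
    and nondeg2: "\<exists>k\<in>{2..L}. \<exists>c>0. AE \<omega> in M.
      ereal c < liminf (\<lambda>n. ereal \<bar>coef_a (D n \<omega>) (lam k) * coef_b (D n \<omega>) (lam 1)
                                 - coef_a (D n \<omega>) (lam 1) * coef_b (D n \<omega>) (lam k)\<bar>)"
  shows "(AE \<omega> in M.
      (\<lambda>n. r2_hat L (\<lambda>i. coef_a (D n \<omega>) (lam i)) (\<lambda>i. coef_b (D n \<omega>) (lam i))
             (\<lambda>i. train_err (X n \<omega>) (y n \<omega>) (lam i))) \<longlonglongrightarrow> r\<^sup>2) \<and>
    (AE \<omega> in M.
      (\<lambda>n. sigma2_hat L (\<lambda>i. coef_a (D n \<omega>) (lam i)) (\<lambda>i. coef_b (D n \<omega>) (lam i))
             (\<lambda>i. train_err (X n \<omega>) (y n \<omega>) (lam i))) \<longlonglongrightarrow> \<sigma>\<^sup>2)"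
proof -
  interpret prob_space M by (rule prob)
  obtain \<eta> K where \<eta>: "0 < \<eta>"
    and mom: "\<And>n i. i < n \<Longrightarrow> integrable M (\<lambda>\<omega>. \<bar>\<epsilon> n \<omega> $ i\<bar> powr (4 + \<eta>))"
      "\<And>n i. i < n \<Longrightarrow> expectation (\<lambda>\<omega>. \<bar>\<epsilon> n \<omega> $ i\<bar> powr (4 + \<eta>)) \<le> K"
    using eps_moment by blast
  \<comment> \<open>the single entry of the model of size one shows that the moment constant is nonnegative\<close>
  have "0 \<le> expectation (\<lambda>\<omega>. \<bar>\<epsilon> 1 \<omega> $ 0\<bar> powr (4 + \<eta>))" by simp
  also have "\<dots> \<le> K" by (rule mom(2)) simp
  finally have K0: "0 \<le> K" .
  \<comment> \<open>\<open>\<epsilon>\<^sub>i\<^sup>2 - \<sigma>\<^sup>2\<close> has a moment of order \<open>2 + \<eta> / 2\<close>; the moment bound for sums covers orders up to three\<close>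
  define q where "q = min 3 (2 + \<eta> / 2)"
  have q: "2 < q" "q \<le> 3" "0 < q" "q \<le> 2 + \<eta> / 2" using \<eta> by (auto simp: q_def)
  define Kq where "Kq = 1 + K + (\<sigma>\<^sup>2) powr q"
  have Kq0: "0 \<le> Kq" using K0 by (simp add: Kq_def)
  have eps_entry: "(\<lambda>\<omega>. \<epsilon> n \<omega> $ i) \<in> borel_measurable M" if "i < n" for n i
    using eps_meas[of n] that unfolding measurable_vec_borel_iff by auto
  note nm = noise_moment_bounds(1-3)[OF eps_entry \<eta> mom(1) mom(2) q(3,4)]
  note nmq = noise_moment_bounds(4,5)[OF eps_entry \<eta> mom(1) mom(2) q(3,4), where \<sigma> = \<sigma>, folded Kq_def]
  have "eventually (\<lambda>n. \<gamma> / 2 < real (p n) / real n) sequentially"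
    using gamma by (intro order_tendstoD(1)[OF gamma(2)]) simp
  then obtain N0 where N0: "\<And>n. n \<ge> N0 \<Longrightarrow> \<gamma> / 2 < real (p n) / real n"
    unfolding eventually_sequentially by blast
  define N where "N = max 1 N0"
  have N: "0 < N" by (simp add: N_def)
  have n_pos: "0 < n" if "n \<ge> N" for n using that by (simp add: N_def)
  have p_ge: "\<gamma> / 2 * real n \<le> real (p n)" if "n \<ge> N" for n
    using N0[of n] that n_pos[OF that] by (simp add: N_def field_simps)
  have p_pos: "0 < p n" if "n \<ge> N" for n
  proof -
    have "0 < \<gamma> / 2 * real n" using gamma(1) n_pos[OF that] by simp
    then show ?thesis using p_ge[OF that] by simp
  qed
  have norm: "AE \<omega> in M. \<beta> n \<omega> \<bullet> \<beta> n \<omega> = r\<^sup>2 * real n" if "0 < n" for n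
    using beta_norm(2)[OF that]
  proof eventually_elim
    case (elim \<omega>)
    have "\<beta> n \<omega> \<bullet> \<beta> n \<omega> = (l2_norm_vec (\<beta> n \<omega>))\<^sup>2"
      using scalar_prod_self_nonneg by (simp add: l2_norm_vec_def)
    then show ?case unfolding elim by (simp add: power_mult_distrib)
  qed
  have X: "X n \<in> M \<rightarrow>\<^sub>M mat_borel n (p n)" if "0 < n" for n
    using X_inv[OF that] by (simp add: right_rotationally_invariant_def)
  let ?svd = "\<lambda>n \<omega>. is_svd n (p n) (X n \<omega>) (Q n \<omega>) (D n \<omega>) (V n \<omega>)"
  have AE_svd: "AE \<omega> in M. \<forall>n\<ge>N. ?svd n \<omega>"
    unfolding AE_all_countable
  proof
    fix n show "AE \<omega> in M. N \<le> n \<longrightarrow> ?svd n \<omega>"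
      using svd[OF n_pos] by (cases "N \<le> n") simp_all
  qed
  have noise: "noise_vector M n (\<epsilon> n) (1 + K) q \<sigma> Kq" if n: "0 < n" for n
    by (unfold_locales; (rule eps_meas[OF n] eps_indep[OF n] eps_mean nm(3) eps_var nm(1,2) q nmq Kq0)?)
      (use K0 in simp_all)
  have err: "AE \<omega> in M. (\<lambda>n. train_err (X n \<omega>) (y n \<omega>) l
      - (r\<^sup>2 * coef_a (D n \<omega>) l + \<sigma>\<^sup>2 * coef_b (D n \<omega>) l)) \<longlonglongrightarrow> 0" if l: "0 < l" for l
  proof -
    define R where "R n \<omega> = residual_mat (X n \<omega>) l" for n \<omega>
    define Z1 where "Z1 n \<omega> = signal_deviation l (X n \<omega>) (r\<^sup>2 * real n / real (p n)) (\<beta> n \<omega>)" for n \<omega>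
    define Z2 where "Z2 n \<omega> = (R n \<omega> *\<^sub>v (X n \<omega> *\<^sub>v \<beta> n \<omega>)) \<bullet> (R n \<omega> *\<^sub>v \<epsilon> n \<omega>)" for n \<omega>
    define Z3 where "Z3 n \<omega> = sq_norm (R n \<omega> *\<^sub>v \<epsilon> n \<omega>)
        - (\<Sum>i<n. ((R n \<omega>)\<^sup>T * R n \<omega>) $$ (i, i) * (\<epsilon> n \<omega> $ i)\<^sup>2)" for n \<omega>
    define Z4 where "Z4 n \<omega> = (\<Sum>i<n. ((R n \<omega>)\<^sup>T * R n \<omega>) $$ (i, i) * ((\<epsilon> n \<omega> $ i)\<^sup>2 - \<sigma>\<^sup>2))" for n \<omega>
    have R: "R n \<in> M \<rightarrow>\<^sub>M mat_borel n n" if "0 < n" for n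
      unfolding R_def by (rule measurable_residual_mat[OF X[OF that]])
    have m1: "Z1 n \<in> borel_measurable M" if n: "0 < n" for n
      unfolding Z1_def by (rule measurable_signal_deviation[OF X[OF n] beta_meas[OF n]])
    have m2: "Z2 n \<in> borel_measurable M" if n: "0 < n" for n
      unfolding Z2_def
      by (rule measurable_scalar_prod[OF measurable_mult_mat_vec[OF R[OF n] measurable_mult_mat_vec[OF X[OF n] beta_meas[OF n]]]
          measurable_mult_mat_vec[OF R[OF n] eps_meas[OF n]]])
    have "AE \<omega> in M. (\<lambda>n. Z1 n \<omega> / real n) \<longlonglongrightarrow> 0"
    proof (rule AE_tendsto_of_fourth_moment[OF m1[OF n_pos] _ N])
      fix n assume n: "n \<ge> N"
      note n0 = n_pos[OF n] and p0 = p_pos[OF n]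
      have "(\<integral>\<^sup>+\<omega>. ennreal (Z1 n \<omega> ^ 4) \<partial>M)
          \<le> ennreal ((r\<^sup>2 * real n / real (p n)) ^ 4 * (2 * l\<^sup>2 * real (p n))\<^sup>2)"
        using signal_deviation_moment[OF beta_indep[OF n0] X_inv[OF n0] l p0 norm[OF n0]]
        by (simp only: Z1_def)
      also have "(r\<^sup>2 * real n / real (p n)) ^ 4 * (2 * l\<^sup>2 * real (p n))\<^sup>2
          \<le> 16 * r ^ 8 * l ^ 4 / \<gamma>\<^sup>2 * (real n)\<^sup>2"
      proof -
        have "(r\<^sup>2 * real n / real (p n)) ^ 4 * (2 * l\<^sup>2 * real (p n))\<^sup>2
            = 4 * r ^ 8 * l ^ 4 * real n ^ 4 / (real (p n))\<^sup>2"
          using p0 by (simp add: power_divide power_mult_distrib field_simps flip: power_mult power_add)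
        also have "\<dots> \<le> 4 * r ^ 8 * l ^ 4 * real n ^ 4 / (\<gamma> / 2 * real n)\<^sup>2"
          using p_ge[OF n] p0 n0 gamma(1)
          by (intro divide_left_mono power_mono mult_pos_pos mult_nonneg_nonneg) auto
        also have "\<dots> = 16 * r ^ 8 * l ^ 4 / \<gamma>\<^sup>2 * (real n)\<^sup>2"
          using n0 gamma(1) by (simp add: power_divide power_mult_distrib field_simps flip: power_add)
        finally show ?thesis .
      qed
      finally show "(\<integral>\<^sup>+\<omega>. ennreal (Z1 n \<omega> ^ 4) \<partial>M) \<le> ennreal (16 * r ^ 8 * l ^ 4 / \<gamma>\<^sup>2 * (real n)\<^sup>2)"
        by (simp add: ennreal_leI)
    qed (use l in auto)
    moreover have "AE \<omega> in M. (\<lambda>n. Z2 n \<omega> / real n) \<longlonglongrightarrow> 0"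
    proof (rule AE_tendsto_of_fourth_moment[OF m2[OF n_pos] _ N])
      fix n assume n: "n \<ge> N"
      note n0 = n_pos[OF n]
      have "(\<integral>\<^sup>+\<omega>. ennreal (Z2 n \<omega> ^ 4) \<partial>M) \<le> ennreal (16 * (1 + K) * (l / 4 * (r\<^sup>2 * real n))\<^sup>2)"
        unfolding Z2_def R_def
        by (rule noise_vector.cross_moment[OF noise[OF n0] beta_indep[OF n0] eps_indep_X[OF n0] l norm[OF n0]])
      also have "16 * (1 + K) * (l / 4 * (r\<^sup>2 * real n))\<^sup>2 = (1 + K) * l\<^sup>2 * r ^ 4 * (real n)\<^sup>2"
        by (simp add: power_mult_distrib power_divide flip: power_mult)
      finally show "(\<integral>\<^sup>+\<omega>. ennreal (Z2 n \<omega> ^ 4) \<partial>M) \<le> ennreal ((1 + K) * l\<^sup>2 * r ^ 4 * (real n)\<^sup>2)" .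
    qed (use K0 in auto)
    moreover have "AE \<omega> in M. (\<lambda>n. Z3 n \<omega> / real n) \<longlonglongrightarrow> 0"
    proof (rule AE_tendsto_of_fourth_moment[OF _ _ N])
      fix n assume n: "n \<ge> N"
      note n0 = n_pos[OF n]
      note off = noise_vector.noise_offdiag_moment[OF noise[OF n0] eps_indep_X[OF n0] l]
      show "Z3 n \<in> borel_measurable M"
        unfolding Z3_def R_def by (rule measurable_noise_deviation(1)[OF X[OF n0] eps_meas[OF n0]])
      have "(\<integral>\<^sup>+\<omega>. ennreal (Z3 n \<omega> ^ 4) \<partial>M) \<le> ennreal ((32 * (1 + K) * real n)\<^sup>2)"
        using off by (simp only: Z3_def R_def)
      then show "(\<integral>\<^sup>+\<omega>. ennreal (Z3 n \<omega> ^ 4) \<partial>M) \<le> ennreal ((32 * (1 + K))\<^sup>2 * (real n)\<^sup>2)"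
        by (simp only: power_mult_distrib)
    qed simp
    moreover have "AE \<omega> in M. (\<lambda>n. Z4 n \<omega> / real n) \<longlonglongrightarrow> 0"
    proof (rule AE_tendsto_of_moment[OF _ q(1) _ N])
      fix n assume n: "n \<ge> N"
      note n0 = n_pos[OF n]
      note diag = noise_vector.noise_diag_moment_random_design[OF noise[OF n0] eps_indep_X[OF n0] l n0]
      show "Z4 n \<in> borel_measurable M"
        unfolding Z4_def R_def by (rule measurable_noise_deviation(2)[OF X[OF n0] eps_meas[OF n0]])
      show "(\<integral>\<^sup>+\<omega>. ennreal (\<bar>Z4 n \<omega>\<bar> powr q) \<partial>M)
          \<le> ennreal ((1 + 3 * (1 + Kq) * (4 + Kq)) * real n powr (q / 2))"
        using diag by (simp only: Z4_def R_def)
    qed (use Kq0 in auto)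
    ultimately show ?thesis
      using AE_svd AE_space
    proof eventually_elim
      case (elim \<omega>)
      have "(\<lambda>n. Z1 n \<omega> / real n + 2 * (Z2 n \<omega> / real n) + Z3 n \<omega> / real n + Z4 n \<omega> / real n) \<longlonglongrightarrow> 0 + 2 * 0 + 0 + 0"
        by (intro tendsto_add tendsto_mult tendsto_const elim)
      moreover have "eventually (\<lambda>n. Z1 n \<omega> / real n + 2 * (Z2 n \<omega> / real n) + Z3 n \<omega> / real n + Z4 n \<omega> / real n
          = train_err (X n \<omega>) (y n \<omega>) l - (r\<^sup>2 * coef_a (D n \<omega>) l + \<sigma>\<^sup>2 * coef_b (D n \<omega>) l)) sequentially"
        using eventually_ge_at_top[of N]
      proof eventually_elim
        case (elim n)
        note n0 = n_pos[OF elim] and p0 = p_pos[OF elim]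
        have "\<beta> n \<omega> \<in> carrier_vec (p n)" "\<epsilon> n \<omega> \<in> carrier_vec n"
          using measurable_space[OF beta_meas[OF n0]] measurable_space[OF eps_meas[OF n0]] \<open>\<omega> \<in> space M\<close>
          by (auto simp: space_vec_borel)
        moreover have "?svd n \<omega>"
          using \<open>\<forall>n\<ge>N. ?svd n \<omega>\<close> elim by blast
        ultimately show ?case
          unfolding Z1_def Z2_def Z3_def Z4_def R_def y[OF n0 \<open>\<omega> \<in> space M\<close>]
          using train_err_decomposition[OF _ l n0 p0, of "X n \<omega>" "Q n \<omega>" "D n \<omega>" "V n \<omega>" "\<beta> n \<omega>" "\<epsilon> n \<omega>" "r\<^sup>2" \<sigma>]
          by simp
      qed
      ultimately show ?case by (simp add: tendsto_cong)
    qed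
  qed
  have lam_pos: "0 < lam i" if "1 \<le> i" "i \<le> L" for i
    using that
  proof (induction i rule: dec_induct)
    case (step m)
    then show ?case using lam(2)[of m] by force
  qed (rule lam(1))
  obtain k c where k: "k \<in> {2..L}" and c: "0 < c"
    and sep: "AE \<omega> in M. ereal c < liminf (\<lambda>n. ereal \<bar>coef_a (D n \<omega>) (lam k) * coef_b (D n \<omega>) (lam 1)
                                 - coef_a (D n \<omega>) (lam 1) * coef_b (D n \<omega>) (lam k)\<bar>)"
    using nondeg2 by blast
  have k1: "k \<in> {1..L}" and one: "1 \<in> {1..L}" using k by auto
  \<comment> \<open>the comparison constant of \<open>coef_lower_bounds\<close>, made uniform over the penalties\<close>
  define \<delta> where "\<delta> = Min ((\<lambda>i. (lam i / (C\<^sup>2 + lam i))\<^sup>2) ` {1..L})"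
  have \<delta>_le: "\<delta> \<le> (lam i / (C\<^sup>2 + lam i))\<^sup>2" if "i \<in> {1..L}" for i
    unfolding \<delta>_def using that by (intro Min_le) auto
  have \<delta>: "0 < \<delta>"
  proof -
    have "0 < (lam i / (C\<^sup>2 + lam i))\<^sup>2" if "i \<in> {1..L}" for i
      using lam_pos[of i] that by (intro zero_less_power divide_pos_pos add_nonneg_pos) auto
    then show ?thesis unfolding \<delta>_def using one by (subst Min_gr_iff) auto
  qed
  have AE_err: "AE \<omega> in M. \<forall>i\<in>{1..L}. (\<lambda>n. train_err (X n \<omega>) (y n \<omega>) (lam i)
      - (r\<^sup>2 * coef_a (D n \<omega>) (lam i) + \<sigma>\<^sup>2 * coef_b (D n \<omega>) (lam i))) \<longlonglongrightarrow> 0"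
    using err lam_pos by (intro AE_finite_allI) auto
  show ?thesis
    unfolding AE_conj_iff[symmetric]
    using AE_err AE_svd D_bound sep
  proof eventually_elim
    case (elim \<omega>)
    define a where "a n i = coef_a (D n \<omega>) (lam i)" for n i
    define b where "b n i = coef_b (D n \<omega>) (lam i)" for n i
    define t where "t n i = train_err (X n \<omega>) (y n \<omega>) (lam i)" for n i
    \<comment> \<open>an upper bound for the product of the two coefficients \<open>a\<close> in the determinant condition\<close>
    define \<Lambda> where "\<Lambda> = (lam k / 4) * (lam 1 / 4)"
    have \<Lambda>: "0 < \<Lambda>" using lam_pos k one by (auto simp: \<Lambda>_def)
    have e1: "(\<lambda>n. t n i - (r\<^sup>2 * a n i + \<sigma>\<^sup>2 * b n i)) \<longlonglongrightarrow> 0" if "i \<in> {1..L}" for i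
      using elim(1) that by (simp add: a_def b_def t_def)
    have e2: "(\<lambda>n. t n i - (\<sigma>\<^sup>2 * b n i + r\<^sup>2 * a n i)) \<longlonglongrightarrow> 0" if "i \<in> {1..L}" for i
      using e1[OF that] by (simp add: add.commute)
    have ev_sep: "eventually (\<lambda>n. c < \<bar>a n k * b n 1 - a n 1 * b n k\<bar>) sequentially"
      using less_LiminfD[OF elim(4)] by (simp add: a_def b_def)
    have ev_C: "eventually (\<lambda>n. (SUP i\<in>{..<min n (p n)}. ereal (D n \<omega> $$ (i, i))) < ereal C) sequentially"
      by (rule Limsup_lessD[OF elim(3)])
    have bounds: "eventually (\<lambda>n. (\<forall>i\<in>{1..L}. \<delta> \<le> b n i \<and> b n i \<le> 1 \<and> \<delta> * c \<le> a n i \<and> a n i \<le> lam i / 4)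
        \<and> c < \<bar>a n k * b n 1 - a n 1 * b n k\<bar>) sequentially"
      using ev_sep ev_C eventually_ge_at_top[of N]
    proof eventually_elim
      case (elim n)
      note n0 = n_pos[OF elim(3)]
      have svdn: "?svd n \<omega>"
        using \<open>\<forall>n\<ge>N. ?svd n \<omega>\<close> elim(3) by blast
      then have Dc: "D n \<omega> \<in> carrier_mat n (p n)" and D0: "\<And>i. i < min n (p n) \<Longrightarrow> 0 \<le> D n \<omega> $$ (i, i)"
        by (auto simp: is_svd_def)
      have dC: "(diag_entry (D n \<omega>) i)\<^sup>2 \<le> C\<^sup>2" for i
      proof (cases "i < min n (p n)")
        case True
        then have "ereal (D n \<omega> $$ (i, i)) \<le> (SUP i\<in>{..<min n (p n)}. ereal (D n \<omega> $$ (i, i)))"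
          by (intro SUP_upper) auto
        then have "ereal (D n \<omega> $$ (i, i)) < ereal C" using elim(2) by (rule order.strict_trans1)
        then have "D n \<omega> $$ (i, i) \<le> C" by simp
        then show ?thesis using True D0[OF True] Dc by (auto simp: diag_entry_def intro!: power_mono)
      qed (use Dc in \<open>auto simp: diag_entry_def\<close>)
      have up: "0 \<le> b n i" "b n i \<le> 1" "0 \<le> a n i" "a n i \<le> lam i / 4" if "i \<in> {1..L}" for i
        using coef_upper_bounds[OF lam_pos Dc n0] that by (auto simp: a_def b_def)
      have lob: "\<delta> \<le> b n i" if "i \<in> {1..L}" for i
        using coef_lower_bounds(1)[OF lam_pos Dc n0 dC, of i] \<delta>_le[OF that] that by (simp add: b_def)
      \<comment> \<open>both \<open>b\<close> are at most one, so a determinant above \<open>c\<close> needs one of the two \<open>a\<close> above \<open>c\<close>\<close>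
      have "\<exists>j\<in>{1..L}. c \<le> a n j"
      proof -
        have "0 \<le> a n k * b n 1" "0 \<le> a n 1 * b n k" using up[OF k1] up[OF one] by simp_all
        moreover have "a n k * b n 1 \<le> a n k" "a n 1 * b n k \<le> a n 1"
          using up[OF k1] up[OF one] by (auto intro!: mult_right_le_one_le)
        ultimately have "c \<le> a n k \<or> c \<le> a n 1" using elim(1) by linarith
        then show ?thesis using k1 one by blast
      qed
      then obtain j where j: "j \<in> {1..L}" "c \<le> a n j" by blast
      have loa: "\<delta> * c \<le> a n i" if i: "i \<in> {1..L}" for i
      proof -
        have "\<delta> * c \<le> (lam i / (C\<^sup>2 + lam i))\<^sup>2 * a n j"
          using \<delta>_le[OF i] j(2) c \<delta> by (intro mult_mono) auto
        also have "\<dots> \<le> a n i"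
          using coef_lower_bounds(2)[OF lam_pos Dc n0 dC lam_pos, of i j] i j(1) by (simp add: a_def)
        finally show ?thesis .
      qed
      show ?case using up lob loa elim(1) by blast
    qed
    have "(\<lambda>n. r2_hat L (a n) (b n) (t n)) \<longlonglongrightarrow> r\<^sup>2"
    proof (rule r2_hat_tendsto[OF k1 \<delta> c _ _ e1])
      show "eventually (\<lambda>n. \<forall>i\<in>{1..L}. \<delta> \<le> b n i) sequentially"
        using bounds by eventually_elim blast
      show "eventually (\<lambda>n. c \<le> \<bar>a n k / b n k - a n 1 / b n 1\<bar>) sequentially"
        using bounds
      proof eventually_elim
        case (elim n)
        then have bk: "\<delta> \<le> b n k" "b n k \<le> 1" and b1: "\<delta> \<le> b n 1" "b n 1 \<le> 1"
          and s: "c < \<bar>a n k * b n 1 - a n 1 * b n k\<bar>" using k1 one by auto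
        have pos: "0 < b n k" "0 < b n 1" using bk b1 \<delta> by auto
        have "b n k * b n 1 \<le> 1" using bk b1 pos by (intro mult_le_one) auto
        then have "\<bar>a n k * b n 1 - a n 1 * b n k\<bar> \<le> \<bar>a n k * b n 1 - a n 1 * b n k\<bar> / (b n k * b n 1)"
          using pos by (simp add: le_divide_eq mult_left_le)
        also have "\<dots> = \<bar>a n k / b n k - a n 1 / b n 1\<bar>"
          using pos by (simp add: diff_frac_eq abs_mult)
        finally show ?case using s by simp
      qed
    qed
    moreover have "(\<lambda>n. sigma2_hat L (a n) (b n) (t n)) \<longlonglongrightarrow> \<sigma>\<^sup>2"
      unfolding sigma2_hat_eq_r2_hat
    proof (rule r2_hat_tendsto[OF k1 mult_pos_pos[OF \<delta> c] divide_pos_pos[OF c \<Lambda>] _ _ e2])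
      show "eventually (\<lambda>n. \<forall>i\<in>{1..L}. \<delta> * c \<le> a n i) sequentially"
        using bounds by eventually_elim blast
      show "eventually (\<lambda>n. c / \<Lambda> \<le> \<bar>b n k / a n k - b n 1 / a n 1\<bar>) sequentially"
        using bounds
      proof eventually_elim
        case (elim n)
        then have ak: "\<delta> * c \<le> a n k" "a n k \<le> lam k / 4" and a1: "\<delta> * c \<le> a n 1" "a n 1 \<le> lam 1 / 4"
          and s: "c < \<bar>a n k * b n 1 - a n 1 * b n k\<bar>" using k1 one by auto
        have pos: "0 < a n k" "0 < a n 1" using ak a1 mult_pos_pos[OF \<delta> c] by auto
        have le: "a n k * a n 1 \<le> \<Lambda>" unfolding \<Lambda>_def using ak a1 pos by (intro mult_mono) auto
        have "c / \<Lambda> \<le> \<bar>a n k * b n 1 - a n 1 * b n k\<bar> / (a n k * a n 1)"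
          using s c pos le by (intro frac_le) auto
        also have "\<dots> = \<bar>b n k / a n k - b n 1 / a n 1\<bar>"
          using pos by (simp add: diff_frac_eq abs_mult abs_minus_commute mult.commute)
        finally show ?case .
      qed
    qed
    ultimately show ?case by (simp add: a_def[abs_def] b_def[abs_def] t_def[abs_def])
  qed
qed

end
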